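(* The degrees of freedom (DoF) region of an interference network with general message demands with $K$ transmitters, $J$ receivers, and $M$ antennas (at every transmitter and every receiver) is given by $$\mathcal{D}=\Big\{\boldsymbol{d}=(d_1,\dots,d_K)\in\mathbb{R}^K_+ :\ \sum_{k\in\mathcal{M}_j} d_k+\max_{i\in\mathcal{M}_j^c} d_i\le M,\quad \forall\, 1\le j\le J\Big\},$$ where $\mathcal{M}_j$ is the set of indices of messages requested by receiver $j$, $1\le j\le J$, and $\mathcal{M}_j^c=\{1,\dots,K\}\setminus\mathcal{M}_j$ (a maximum over an empty set being read as $0$).
   Context: $\mathbb{R}^K_+=\{(x_1,\dots,x_K)\in\mathbb{R}^K : x_k\ge 0 \text{ for all } k\}$. Interference network with general message demands: a single hop network with $K$ transmitters and $J$ receivers, each having $M$ antennas. Each transmitter has one and only one independent message (message $k$ at transmitter $k$). Each receiver can request an arbitrary set of messages; $\mathcal{M}_j\subseteq\{1,\dots,K\}$ is the set of indices of the messages requested by receiver $j$. At time $t$ receiver $j$ observes $$\boldsymbol{y}_j(t)=\sum_{k=1}^K \boldsymbol{H}_{jk}(t)\boldsymbol{x}_k(t)+\boldsymbol{z}_j(t),$$ where $\boldsymbol{x}_k(t)\in\mathbb{C}^M$ is the transmitted signal of transmitter $k$, satisfying the power constraint $\mathrm{E}(\|\boldsymbol{x}_k(t)\|^2)\le P$; $\boldsymbol{H}_{jk}(t)\in\mathbb{C}^{M\times M}$ is the channel between transmitter $k$ and receiver $j$; and $\boldsymbol{z}_j(t)\in\mathbb{C}^M$ is independent circularly symmetric complex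 Gaussian noise with each entry $\mathcal{CN}(0,1)$ distributed. The elements of all the channel matrices at different time instants are independently drawn from some continuous distribution, and the channel gains are bounded between a positive minimum value and a finite maximum value. There is perfect channel state information at the receivers and global channel state information at the transmitters. $C(P)$ denotes the capacity region of this system, in the usual sense: rate tuples $(R_1,\dots,R_K)$, with $R_k$ the rate of message $k$, for which every receiver $j$ can reliably decode all messages in $\mathcal{M}_j$. The DoF region is defined as $$\mathcal{D}=\Big\{\boldsymbol{d}\in\mathbb{R}^K_+ : \exists\,(R_1(P),\dots,R_K(P))\in C(P)\text{ such that } d_k=\lim_{P\to\infty}\frac{R_k(P)}{\log P},\ 1\le k\le K\Big\}.$$
   Formalization: It is assumed additionally that every message is requested by at least one receiver; otherwise an unrequested message has unbounded rate and the stated region, which bounds its DoF by M, is wrong. *)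

theory Defs
  imports "HOL-Probability.Probability"
begin

text \<open>
  The types \<open>'k\<close>, \<open>'j\<close> and \<open>'m\<close> index the transmitters (and hence the messages), the receivers
  and the antennas of every node, so that \<open>K = CARD('k)\<close>, \<open>J = CARD('j)\<close> and \<open>M = CARD('m)\<close>.
  If \<open>S\<close> is the channel state at some time, \<open>S $ j $ k\<close> is the channel matrix
  from transmitter \<open>k\<close> to receiver \<open>j\<close>.
\<close>

type_synonym ('j, 'k, 'm) channel_state = "complex ^ 'm ^ 'm ^ 'k ^ 'j"

text \<open>
  All entries of all channel matrices at all times and all noise entries are mutually
  independent; the channel entries have the common law \<open>\<mu>\<close>, which is continuous (has no atoms), and
  their moduli lie between \<open>hmin > 0\<close> and \<open>hmax\<close>.  The function \<open>exp (- \<bar>z\<bar>\<^sup>2) / pi\<close> is the density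
  of the circularly symmetric complex Gaussian \<open>CN(0,1)\<close> with respect to
  Lebesgue measure on the complex plane.
\<close>

locale interference_channel = prob_space \<Omega>
  for \<Omega> :: "'w measure" +
  fixes H :: "nat \<Rightarrow> 'w \<Rightarrow> ('j::finite, 'k::finite, 'm::finite) channel_state"
    and Z :: "nat \<Rightarrow> 'w \<Rightarrow> complex ^ 'm ^ 'j"
    and \<mu> :: "complex measure"
    and hmin hmax :: real
  assumes indep:
      "indep_vars (\<lambda>_. borel)
         (case_sum (\<lambda>(t, j, k, r, c). \<lambda>\<omega>. H t \<omega> $ j $ k $ r $ c)
                   (\<lambda>(t, j, r). \<lambda>\<omega>. Z t \<omega> $ j $ r)) UNIV"
    and channel_law: "\<And>t j k r c. distr \<Omega> borel (\<lambda>\<omega>. H t \<omega> $ j $ k $ r $ c) = \<mu>"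
    and channel_continuous: "\<And>z. emeasure \<mu> {z} = 0"
    and channel_bounds: "0 < hmin" "AE z in \<mu>. hmin \<le> cmod z \<and> cmod z \<le> hmax"
    and noise_law:
      "\<And>t j r. distributed \<Omega> lborel (\<lambda>\<omega>. Z t \<omega> $ j $ r) (\<lambda>z. ennreal (exp (- (cmod z)\<^sup>2) / pi))"

text \<open>
  A block code of length \<open>n\<close>: message \<open>k\<close> ranges over \<open>{..<num_msgs c k}\<close>, transmitter \<open>k\<close> sends
  \<open>encode c k m s t\<close> at time \<open>t < n\<close> and receiver \<open>j\<close> estimates message \<open>k\<close> from its received
  block.  Encoders and decoders know the states \<open>s\<close> of all channels throughout the block.
\<close>

record ('j, 'k, 'm) block_code =
  num_msgs :: "'k \<Rightarrow> nat"
  encode :: "'k \<Rightarrow> nat \<Rightarrow> (nat \<Rightarrow> ('j, 'k, 'm) channel_state) \<Rightarrow> nat \<Rightarrow> complex ^ 'm"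
  decode :: "'j \<Rightarrow> 'k \<Rightarrow> (nat \<Rightarrow> complex ^ 'm) \<Rightarrow> (nat \<Rightarrow> ('j, 'k, 'm) channel_state) \<Rightarrow> nat"

definition measurable_code ::
    "nat \<Rightarrow> ('j::finite, 'k::finite, 'm::finite) block_code \<Rightarrow> bool" where
  "measurable_code n c \<longleftrightarrow>
     (\<forall>k. \<forall>m < num_msgs c k. \<forall>t < n.
        (\<lambda>s. encode c k m s t) \<in> borel_measurable (\<Pi>\<^sub>M t\<in>{..<n}. borel)) \<and>
     (\<forall>j k. (\<lambda>(y, s). decode c j k y s)
        \<in> measurable ((\<Pi>\<^sub>M t\<in>{..<n}. borel) \<Otimes>\<^sub>M (\<Pi>\<^sub>M t\<in>{..<n}. borel)) (count_space UNIV))"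

definition state_block ::
    "(nat \<Rightarrow> 'w \<Rightarrow> ('j::finite, 'k::finite, 'm::finite) channel_state) \<Rightarrow> nat \<Rightarrow> 'w \<Rightarrow>
     nat \<Rightarrow> ('j, 'k, 'm) channel_state" where
  "state_block H n \<omega> = (\<lambda>t\<in>{..<n}. H t \<omega>)"

definition received_block ::
    "(nat \<Rightarrow> 'w \<Rightarrow> ('j::finite, 'k::finite, 'm::finite) channel_state) \<Rightarrow>
     (nat \<Rightarrow> 'w \<Rightarrow> complex ^ 'm ^ 'j) \<Rightarrow> nat \<Rightarrow> ('j, 'k, 'm) block_code \<Rightarrow>
     ('k \<Rightarrow> nat) \<Rightarrow> 'j \<Rightarrow> 'w \<Rightarrow> nat \<Rightarrow> complex ^ 'm" where
  "received_block H Z n c w j \<omega> =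
     (\<lambda>t\<in>{..<n}. (\<Sum>k\<in>UNIV. H t \<omega> $ j $ k *v encode c k (w k) (state_block H n \<omega>) t) + Z t \<omega> $ j)"

text \<open>
  The mean of the transmit power is over the uniformly distributed message and the channel
  states.  It is a nonnegative integral, so that an infinite mean violates the constraint.
\<close>

definition power_constraint ::
    "'w measure \<Rightarrow> (nat \<Rightarrow> 'w \<Rightarrow> ('j::finite, 'k::finite, 'm::finite) channel_state) \<Rightarrow>
     nat \<Rightarrow> ('j, 'k, 'm) block_code \<Rightarrow> real \<Rightarrow> bool" where
  "power_constraint \<Omega> H n c P \<longleftrightarrow>
     (\<forall>k. \<forall>t < n.
        (\<integral>\<^sup>+\<omega>. ennreal ((\<Sum>m < num_msgs c k. (norm (encode c k m (state_block H n \<omega>) t))\<^sup>2)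
                        / real (num_msgs c k)) \<partial>\<Omega>) \<le> ennreal P)"

text \<open>
  The average over independent, uniformly distributed messages of the probability that some
  receiver wrongly decodes one of the messages it requests.
\<close>

definition error_prob ::
    "'w measure \<Rightarrow> (nat \<Rightarrow> 'w \<Rightarrow> ('j::finite, 'k::finite, 'm::finite) channel_state) \<Rightarrow>
     (nat \<Rightarrow> 'w \<Rightarrow> complex ^ 'm ^ 'j) \<Rightarrow> ('j \<Rightarrow> 'k set) \<Rightarrow>
     nat \<Rightarrow> ('j, 'k, 'm) block_code \<Rightarrow> real" where
  "error_prob \<Omega> H Z demand n c =
     (\<Sum>w\<in>(\<Pi>\<^sub>E k\<in>UNIV. {..<num_msgs c k}).
        measure \<Omega> {\<omega> \<in> space \<Omega>. \<exists>j. \<exists>k\<in>demand j.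
          decode c j k (received_block H Z n c w j \<omega>) (state_block H n \<omega>) \<noteq> w k})
     / real (\<Prod>k\<in>UNIV. num_msgs c k)"

text \<open>Rates are measured in bits per channel use.\<close>

definition achievable ::
    "'w measure \<Rightarrow> (nat \<Rightarrow> 'w \<Rightarrow> ('j::finite, 'k::finite, 'm::finite) channel_state) \<Rightarrow>
     (nat \<Rightarrow> 'w \<Rightarrow> complex ^ 'm ^ 'j) \<Rightarrow> ('j \<Rightarrow> 'k set) \<Rightarrow> real \<Rightarrow> real ^ 'k \<Rightarrow> bool" where
  "achievable \<Omega> H Z demand P R \<longleftrightarrow>
     (\<forall>k. 0 \<le> R $ k) \<and>
     (\<exists>c :: nat \<Rightarrow> ('j, 'k, 'm) block_code.
        (\<forall>n. measurable_code n (c n) \<and> power_constraint \<Omega> H n (c n) P \<and>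
             (\<forall>k. num_msgs (c n) k = nat \<lceil>2 powr (real n * R $ k)\<rceil>)) \<and>
        (\<lambda>n. error_prob \<Omega> H Z demand n (c n)) \<longlonglongrightarrow> 0)"

definition capacity_region ::
    "'w measure \<Rightarrow> (nat \<Rightarrow> 'w \<Rightarrow> ('j::finite, 'k::finite, 'm::finite) channel_state) \<Rightarrow>
     (nat \<Rightarrow> 'w \<Rightarrow> complex ^ 'm ^ 'j) \<Rightarrow> ('j \<Rightarrow> 'k set) \<Rightarrow> real \<Rightarrow> (real ^ 'k) set" where
  "capacity_region \<Omega> H Z demand P = closure {R. achievable \<Omega> H Z demand P R}"

definition DoF_region ::
    "'w measure \<Rightarrow> (nat \<Rightarrow> 'w \<Rightarrow> ('j::finite, 'k::finite, 'm::finite) channel_state) \<Rightarrow>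
     (nat \<Rightarrow> 'w \<Rightarrow> complex ^ 'm ^ 'j) \<Rightarrow> ('j \<Rightarrow> 'k set) \<Rightarrow> (real ^ 'k) set" where
  "DoF_region \<Omega> H Z demand =
     {d. (\<forall>k. 0 \<le> d $ k) \<and>
         (\<exists>R :: real \<Rightarrow> real ^ 'k.
            (\<forall>P > 0. R P \<in> capacity_region \<Omega> H Z demand P) \<and>
            (\<forall>k. ((\<lambda>P. R P $ k / log 2 P) \<longlongrightarrow> d $ k) at_top))}"

end

theory Submission
  imports Defs "HOL-Probability.Hoeffding"
begin

text \<open>
  For the inner bound, \<open>T\<close> consecutive channel uses are combined into a block, and every transmitter
  sends its symbols along beams that are monomials in the cross channels, multiplied by deterministic
  seed sequences (Cadambe and Jafar).  Passing through a cross channel raises the degree of a monomial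
  by one, so that at each receive antenna all interference lies in the span of the monomials of
  slightly larger degree.  Wanted beams and interference are linearly independent for almost every
  channel: a polynomial that does not vanish at one point vanishes only on a null set of an
  atomless product measure, and at a suitable point the columns become distinct geometric sequences.
  The symbols are Gaussian integers, which makes hard decisions in a block correct up to a small
  probability that does not depend on the power; an outer Gilbert--Varshamov code over the blocks
  removes these errors, with Hoeffding's inequality bounding the fraction of bad blocks.

  For the outer bound, let receiver \<open>j\<close> decode its messages and let \<open>i\<close> be one more message, decoded
  at receiver \<open>j'\<close>.  Shifting the noise of receiver \<open>j\<close> by a bounded amount, and that of receiver \<open>j'\<close>
  by its image under the channel map from \<open>j\<close> to \<open>j'\<close>, costs only a factor exponential in the block
  length.  The shifted outputs of receiver \<open>j\<close> determine all these messages, hence the sets of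
  shifts that belong to distinct messages are disjoint, and comparing volumes bounds the number of
  messages by roughly \<open>P\<close> to the power \<open>M n\<close>.  At the rare times when the channel
  from \<open>i\<close> to \<open>j\<close> is nearly singular, the output of receiver \<open>j'\<close> is taken as an additional coordinate.
\<close>

section \<open>Polynomial functions and generic invertibility\<close>

text \<open>The law of a channel entry is only known to have no atoms; it may be singular, so
  genericity rests on a polynomial having finitely many roots on each coordinate line. Alignment is
  lossless only asymptotically: with \<open>g\<close> cross coefficients a transmitter uses
  \<open>N^g\<close> monomials per seed while a receiver reserves \<open>(N+1)^g\<close>, and the
  ratio tends to 1. All interferers share the same seeds, so a receiver pays for the largest of them
  and not for their sum; this produces the maximum in the region. The obstacle in the inner bound is
  that the inverse of the channel is not uniformly bounded, while the failure probability of a block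
  must not grow with the power; separation is therefore asked of all Gaussian integer vectors at
  once. In the outer bound, power and error are controlled only on average over messages and states,
  so atypical energy and frequent fades are discarded by Markov's inequality and a positive fraction
  of the weight survives. What is lost is a constant per channel use and an arbitrarily small
  multiple of \<open>log P\<close>, to which the limit is insensitive.\<close>

inductive polyfun :: "(('i \<Rightarrow> complex) \<Rightarrow> complex) \<Rightarrow> bool" where
  const: "polyfun (\<lambda>_. c)"
| coord: "polyfun (\<lambda>h. h i)"
| add: "polyfun F \<Longrightarrow> polyfun G \<Longrightarrow> polyfun (\<lambda>h. F h + G h)"
| mult: "polyfun F \<Longrightarrow> polyfun G \<Longrightarrow> polyfun (\<lambda>h. F h * G h)"

lemma polyfun_diff: "polyfun F \<Longrightarrow> polyfun G \<Longrightarrow> polyfun (\<lambda>h. F h - G h)"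
  using polyfun.add[OF _ polyfun.mult[OF polyfun.const[of "-1"]], of F G] by simp

lemma polyfun_sum: "(\<And>a. a \<in> A \<Longrightarrow> polyfun (F a)) \<Longrightarrow> polyfun (\<lambda>h. \<Sum>a\<in>A. F a h)"
  by (induction A rule: infinite_finite_induct) (auto intro: polyfun.intros)

lemma polyfun_prod: "(\<And>a. a \<in> A \<Longrightarrow> polyfun (F a)) \<Longrightarrow> polyfun (\<lambda>h. \<Prod>a\<in>A. F a h)"
  by (induction A rule: infinite_finite_induct) (auto intro: polyfun.intros)

lemma polyfun_power: "polyfun F \<Longrightarrow> polyfun (\<lambda>h. F h ^ n)"
  by (induction n) (auto intro: polyfun.intros)

lemmas polyfun_intros = polyfun.intros polyfun_diff polyfun_sum polyfun_prod polyfun_power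

lemma polyfun_bounded:
  assumes "polyfun F"
  shows "\<exists>C. \<forall>h. (\<forall>i. cmod (h i) \<le> b) \<longrightarrow> cmod (F h) \<le> C"
  using assms
proof induction
  case (const c)
  then show ?case by blast
next
  case (coord i)
  then show ?case by blast
next
  case (add F G)
  then obtain C D where "\<And>h. (\<forall>i. cmod (h i) \<le> b) \<Longrightarrow> cmod (F h) \<le> C"
    "\<And>h. (\<forall>i. cmod (h i) \<le> b) \<Longrightarrow> cmod (G h) \<le> D" by blast
  then show ?case
    by (intro exI[of _ "C + D"]) (meson add_mono norm_triangle_le)
next
  case (mult F G)
  then obtain C D where "\<And>h. (\<forall>i. cmod (h i) \<le> b) \<Longrightarrow> cmod (F h) \<le> C"
    "\<And>h. (\<forall>i. cmod (h i) \<le> b) \<Longrightarrow> cmod (G h) \<le> D" by blast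
  then show ?case
    by (intro exI[of _ "C * D"]) (metis mult_mono' norm_ge_zero norm_mult)
qed

lemma polyfun_measurable:
  assumes "polyfun F" and "\<And>i. (\<lambda>\<omega>. f \<omega> i) \<in> borel_measurable M"
  shows "(\<lambda>\<omega>. F (f \<omega>)) \<in> borel_measurable M"
  using assms(1) by induction (auto intro: assms(2))

lemma polyfun_univariate:
  assumes "polyfun F"
  shows "\<exists>p. \<forall>x. F (h(i := x)) = poly p x"
  using assms
proof induction
  case (const c)
  then show ?case by (intro exI[of _ "[:c:]"]) simp
next
  case (coord j)
  show ?case
  proof (cases "j = i")
    case True
    then show ?thesis by (intro exI[of _ "[:0, 1:]"]) simp
  next
    case False
    then show ?thesis by (intro exI[of _ "[:h j:]"]) simp
  qed
next
  case (add F G)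
  then show ?case by (metis poly_add)
next
  case (mult F G)
  then show ?case by (metis poly_mult)
qed

text \<open>Induct on \<open>I\<close>, replacing the coordinates of \<open>h0\<close> by random
  ones one at a time. On the line through a good \<open>x\<close> the function is a nonzero
  polynomial in the new coordinate, with finitely many roots, a null set for an atomless law; Fubini
  glues the lines. Coordinates outside \<open>I\<close> stay at \<open>h0\<close>, so the index type
  may be infinite.\<close>

lemma polyfun_AE_nonzero:
  fixes \<mu> :: "'i \<Rightarrow> complex measure" and I :: "'i set"
  assumes prob: "\<And>i. prob_space (\<mu> i)" and sets_eq [measurable_cong]: "\<And>i. sets (\<mu> i) = sets borel"
    and atomless: "\<And>i z. emeasure (\<mu> i) {z} = 0"
    and F: "polyfun F" and fin: "finite I" and nz: "F h0 \<noteq> 0"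
  shows "AE x in PiM I \<mu>. F (\<lambda>i. if i \<in> I then x i else h0 i) \<noteq> 0"
  using fin
proof (induction I)
  case empty
  show ?case using nz by simp
next
  case (insert i I)
  interpret product_sigma_finite \<mu>
    using prob by (simp add: product_sigma_finite_def prob_space_imp_sigma_finite)
  let ?ov = "\<lambda>I x i. if i \<in> I then x i else h0 i"
  have meas: "(\<lambda>x. F (?ov J x)) \<in> borel_measurable (PiM J \<mu>)" for J
  proof (rule polyfun_measurable[OF F])
    fix i show "(\<lambda>x. if i \<in> J then x i else h0 i) \<in> borel_measurable (PiM J \<mu>)"
      by (cases "i \<in> J") auto
  qed
  let ?bad = "\<lambda>J. {x \<in> space (PiM J \<mu>). \<not> F (?ov J x) \<noteq> 0}"
  have bad_sets [measurable]: "?bad J \<in> sets (PiM J \<mu>)" for J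
    using meas[of J] by measurable
  have inner: "AE x in PiM I \<mu>. (\<integral>\<^sup>+y. indicator (?bad (insert i I)) (x(i := y)) \<partial>\<mu> i) = 0"
    using insert.IH
  proof eventually_elim
    case (elim x)
    obtain p where p: "\<And>y. F ((?ov I x)(i := y)) = poly p y"
      using polyfun_univariate[OF F] by metis
    \<comment> \<open>The line meets the previous point at \<open>h0 i\<close>, where
      \<open>F\<close> does not vanish; hence \<open>p\<close> is not the zero polynomial.\<close>
    have "F ((?ov I x)(i := h0 i)) = F (?ov I x)"
      using insert.hyps by (intro arg_cong[of _ _ F]) auto
    hence "p \<noteq> 0" using elim p[of "h0 i"] by auto
    hence fin: "finite {y. poly p y = 0}" by (rule poly_roots_finite)
    have "emeasure (\<mu> i) {y. poly p y = 0} = (\<Sum>y\<in>{y. poly p y = 0}. emeasure (\<mu> i) {y})"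
      by (rule emeasure_eq_sum_singleton[OF fin]) (simp add: sets_eq)
    hence null: "emeasure (\<mu> i) {y. poly p y = 0} = 0" by (simp add: atomless)
    have "(\<integral>\<^sup>+y. indicator (?bad (insert i I)) (x(i := y)) \<partial>\<mu> i)
        \<le> (\<integral>\<^sup>+y. indicator {y. poly p y = 0} y \<partial>\<mu> i)"
    proof (rule nn_integral_mono)
      fix y
      have "?ov (insert i I) (x(i := y)) = (?ov I x)(i := y)"
        using insert.hyps by auto
      thus "indicator (?bad (insert i I)) (x(i := y)) \<le> (indicator {y. poly p y = 0} y :: ennreal)"
        by (auto simp: indicator_def p)
    qed
    also have "\<dots> = emeasure (\<mu> i) {y. poly p y = 0}"
      using fin by (intro nn_integral_indicator) (simp add: sets_eq finite_imp_closed)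
    finally show ?case using null by simp
  qed
  have "(\<integral>\<^sup>+x. indicator (?bad (insert i I)) x \<partial>PiM (insert i I) \<mu>)
      = (\<integral>\<^sup>+x. \<integral>\<^sup>+y. indicator (?bad (insert i I)) (x(i := y)) \<partial>\<mu> i \<partial>PiM I \<mu>)"
    using insert.hyps by (intro product_nn_integral_insert borel_measurable_indicator bad_sets) auto
  also have "\<dots> = (\<integral>\<^sup>+x. 0 \<partial>PiM I \<mu>)"
    by (rule nn_integral_cong_AE[OF inner])
  finally have "emeasure (PiM (insert i I) \<mu>) (?bad (insert i I)) = 0"
    by (simp only: nn_integral_indicator[OF bad_sets]) simp
  thus ?case by (intro AE_I[OF subset_refl _ bad_sets])
qed


text \<open>Gaussian elimination without division, with every pivot nonzero at \<open>h0\<close> but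
  kept as a polynomial in \<open>h\<close>. Injectivity at the single point \<open>h0\<close> thus
  yields a left inverse \<open>L / F\<close> with polynomial numerators, valid wherever
  \<open>F\<close> is nonzero, and no square submatrix has to be selected.\<close>

lemma generic_left_inverse:
  fixes A :: "('i \<Rightarrow> complex) \<Rightarrow> 'r \<Rightarrow> 'c \<Rightarrow> complex"
  assumes "finite Col" and "finite Row"
    and "\<And>r c. r \<in> Row \<Longrightarrow> c \<in> Col \<Longrightarrow> polyfun (\<lambda>h. A h r c)"
    and "\<And>v. (\<And>r. r \<in> Row \<Longrightarrow> (\<Sum>c\<in>Col. A h0 r c * v c) = 0) \<Longrightarrow> \<forall>c\<in>Col. v c = 0"
  shows "\<exists>F L. polyfun F \<and> F h0 \<noteq> 0 \<and> (\<forall>c\<in>Col. \<forall>r\<in>Row. polyfun (\<lambda>h. L h c r)) \<and>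
           (\<forall>h v. \<forall>c\<in>Col. F h * v c = (\<Sum>r\<in>Row. L h c r * (\<Sum>c'\<in>Col. A h r c' * v c')))"
  using assms
proof (induction Col arbitrary: Row A rule: finite_induct)
  case empty
  show ?case
    by (rule exI[of _ "\<lambda>_. 1"]) (auto intro: polyfun_intros)
next
  case (insert k Col)
  have "\<exists>r\<in>Row. A h0 r k \<noteq> 0"
  proof (rule ccontr)
    assume "\<not> (\<exists>r\<in>Row. A h0 r k \<noteq> 0)"
    hence "(\<Sum>c\<in>insert k Col. A h0 r c * (if c = k then 1 else 0)) = 0" if "r \<in> Row" for r
      using that by (intro sum.neutral) auto
    from insert.prems(3)[of "\<lambda>c. if c = k then 1 else 0", OF this] show False by simp
  qed
  then obtain p where p: "p \<in> Row" "A h0 p k \<noteq> 0" by blast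
  define Row' where "Row' = Row - {p}"
  have Row: "Row = insert p Row'" "p \<notin> Row'" "finite Row'"
    using p insert.prems(1) by (auto simp: Row'_def)
  \<comment> \<open>Cross-multiplied elimination of column \<open>k\<close> by row \<open>p\<close>:
    the entries are the 2x2 minors through the pivot, and column \<open>k\<close> cancels
    identically in \<open>h\<close>.\<close>
  define A' where "A' = (\<lambda>h r c. A h p k * A h r c - A h r k * A h p c)"
  have elim: "(\<Sum>c\<in>Col. A' h r c * v c)
      = A h p k * (\<Sum>c\<in>insert k Col. A h r c * v c) - A h r k * (\<Sum>c\<in>insert k Col. A h p c * v c)"
    for h r v
    using insert.hyps
    by (simp add: A'_def sum_distrib_left sum_subtractf algebra_simps)
  have "\<exists>F L. polyfun F \<and> F h0 \<noteq> 0 \<and> (\<forall>c\<in>Col. \<forall>r\<in>Row'. polyfun (\<lambda>h. L h c r)) \<and>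
           (\<forall>h v. \<forall>c\<in>Col. F h * v c = (\<Sum>r\<in>Row'. L h c r * (\<Sum>c'\<in>Col. A' h r c' * v c')))"
  proof (rule insert.IH)
    show "finite Row'" by (fact Row(3))
    show "polyfun (\<lambda>h. A' h r c)" if "r \<in> Row'" "c \<in> Col" for r c
      unfolding A'_def using that p Row insert.prems(2) by (intro polyfun_intros) auto
    fix v assume v: "\<And>r. r \<in> Row' \<Longrightarrow> (\<Sum>c\<in>Col. A' h0 r c * v c) = 0"
    \<comment> \<open>A kernel vector of the reduced system is extended to column \<open>k\<close>
      by solving the pivot row, so injectivity of \<open>A h0\<close> passes to
      \<open>A' h0\<close>.\<close>
    define w where "w = (\<lambda>c. if c = k then - (\<Sum>c\<in>Col. A h0 p c * v c) / A h0 p k else v c)"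
    have wv: "(\<Sum>c\<in>Col. a c * w c) = (\<Sum>c\<in>Col. a c * v c)" for a
      using insert.hyps by (intro sum.cong) (auto simp: w_def)
    have wp: "(\<Sum>c\<in>insert k Col. A h0 p c * w c) = 0"
      using insert.hyps p by (simp add: wv) (simp add: w_def)
    have "(\<Sum>c\<in>insert k Col. A h0 r c * w c) = 0" if "r \<in> Row" for r
    proof (cases "r = p")
      case False
      hence "(\<Sum>c\<in>Col. A' h0 r c * w c) = 0" using v[of r] that Row wv by auto
      thus ?thesis using elim[of h0 r w] wp p by simp
    qed (simp add: wp)
    from insert.prems(3)[OF this] have "\<forall>c\<in>Col. w c = 0" by simp
    moreover have "\<forall>c\<in>Col. w c = v c" using insert.hyps by (auto simp: w_def)
    ultimately show "\<forall>c\<in>Col. v c = 0" by simp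
  qed
  then obtain F L where F: "polyfun F" "F h0 \<noteq> 0"
    and L: "\<And>c r. c \<in> Col \<Longrightarrow> r \<in> Row' \<Longrightarrow> polyfun (\<lambda>h. L h c r)"
    and FL: "\<And>h v c. c \<in> Col \<Longrightarrow> F h * v c = (\<Sum>r\<in>Row'. L h c r * (\<Sum>c'\<in>Col. A' h r c' * v c'))"
    by blast
  define F2 where "F2 = (\<lambda>h. A h p k * F h)"
  \<comment> \<open>\<open>L1\<close> rewrites the reduced left inverse in the original rows,
    collecting the subtracted multiples at row \<open>p\<close>. \<open>L2\<close> recovers column
    \<open>k\<close> by back substitution in row \<open>p\<close>, which costs one more factor
    \<open>A h p k\<close>.\<close>
  define L1 where "L1 = (\<lambda>h c r. if r = p then - (\<Sum>r'\<in>Row'. L h c r' * A h r' k)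
                                else A h p k * L h c r)"
  define L2 where "L2 = (\<lambda>h c r. if c = k then (if r = p then F h else 0) - (\<Sum>c'\<in>Col. A h p c' * L1 h c' r)
                                else A h p k * L1 h c r)"
  let ?y = "\<lambda>h v r. \<Sum>c\<in>insert k Col. A h r c * v c"
  have L1: "F h * v c = (\<Sum>r\<in>Row. L1 h c r * ?y h v r)" if "c \<in> Col" for h v c
  proof -
    have "F h * v c = (\<Sum>r\<in>Row'. L h c r * (A h p k * ?y h v r - A h r k * ?y h v p))"
      using FL[OF that] by (simp only: elim)
    also have "\<dots> = (\<Sum>r\<in>Row'. A h p k * L h c r * ?y h v r) - (\<Sum>r\<in>Row'. L h c r * A h r k) * ?y h v p"
      by (simp add: sum_subtractf sum_distrib_left sum_distrib_right algebra_simps del: sum.insert)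
    also have "(\<Sum>r\<in>Row'. A h p k * L h c r * ?y h v r) = (\<Sum>r\<in>Row'. L1 h c r * ?y h v r)"
      using Row by (intro sum.cong) (auto simp: L1_def)
    finally show ?thesis using Row insert.hyps by (simp add: L1_def)
  qed
  have polyL1: "polyfun (\<lambda>h. L1 h c r)" if "c \<in> Col" "r \<in> Row" for c r
  proof (cases "r = p")
    case True
    have "polyfun (\<lambda>h. 0 - (\<Sum>r'\<in>Row'. L h c r' * A h r' k))"
      using that Row insert.prems(2) by (intro polyfun_intros L) auto
    thus ?thesis using True by (simp add: L1_def)
  next
    case False
    thus ?thesis using that Row insert.prems(2) by (auto simp: L1_def intro!: polyfun_intros L)
  qed
  have "polyfun (\<lambda>h. L2 h c r)" if "c \<in> insert k Col" "r \<in> Row" for c r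
  proof (cases "c = k")
    case True
    have "polyfun (\<lambda>h. (if r = p then F h else 0) - (\<Sum>c'\<in>Col. A h p c' * L1 h c' r))"
    proof (rule polyfun_diff)
      show "polyfun (\<lambda>h. if r = p then F h else 0)"
        using F by (cases "r = p") (auto intro: polyfun_intros)
    qed (use that p insert.prems(2) in \<open>auto intro!: polyfun_intros polyL1\<close>)
    thus ?thesis using True by (simp add: L2_def)
  next
    case False
    thus ?thesis using that p insert.prems(2) by (auto simp: L2_def intro!: polyfun_intros polyL1)
  qed
  moreover have "F2 h * v c = (\<Sum>r\<in>Row. L2 h c r * ?y h v r)" if "c \<in> insert k Col" for h v c
  proof (cases "c = k")
    case False
    hence "c \<in> Col" using that by simp
    from L1[OF this, of h v] False show ?thesis
      by (simp add: F2_def L2_def sum_distrib_left mult.assoc)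
  next
    case True
    have "(\<Sum>r\<in>Row. L2 h k r * ?y h v r)
        = (\<Sum>r\<in>Row. (if r = p then F h else 0) * ?y h v r)
          - (\<Sum>r\<in>Row. \<Sum>c'\<in>Col. A h p c' * (L1 h c' r * ?y h v r))"
      by (simp add: L2_def left_diff_distrib sum_subtractf sum_distrib_right mult.assoc del: sum.insert)
    also have "(\<Sum>r\<in>Row. (if r = p then F h else 0) * ?y h v r) = F h * ?y h v p"
      using p insert.prems(1) by (simp add: if_distrib[of "\<lambda>x. x * _"] sum.delta cong: if_cong del: sum.insert)
    also have "(\<Sum>r\<in>Row. \<Sum>c'\<in>Col. A h p c' * (L1 h c' r * ?y h v r))
        = (\<Sum>c'\<in>Col. A h p c' * (\<Sum>r\<in>Row. L1 h c' r * ?y h v r))"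
      by (subst sum.swap) (simp add: sum_distrib_left del: sum.insert)
    also have "\<dots> = (\<Sum>c'\<in>Col. A h p c' * (F h * v c'))"
      by (intro sum.cong refl) (simp only: L1)
    also have "F h * ?y h v p - \<dots> = F2 h * v k"
      using insert.hyps by (simp add: F2_def sum_distrib_left algebra_simps)
    finally show ?thesis using True by simp
  qed
  moreover have "polyfun F2" "F2 h0 \<noteq> 0"
    using F p insert.prems(2) by (auto simp: F2_def intro!: polyfun_intros)
  ultimately show ?case by blast
qed

section \<open>Vandermonde systems and unique exponents\<close>

lemma geometric_sequences_independent:
  fixes y v :: "'c \<Rightarrow> complex"
  assumes fin: "finite Col" and inj: "inj_on y Col" and T: "card Col \<le> T"
    and zero: "\<And>t. t < T \<Longrightarrow> (\<Sum>c\<in>Col. v c * y c ^ t) = 0"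
  shows "\<forall>c\<in>Col. v c = 0"
proof
  fix c assume c: "c \<in> Col"
  \<comment> \<open>Lagrange's polynomial: it vanishes at every node except \<open>y c\<close>, and
    its degree \<open>card Col - 1\<close> is below \<open>T\<close>, so a combination of the given
    equations isolates \<open>v c\<close>.\<close>
  define p where "p = (\<Prod>c'\<in>Col - {c}. [:- y c', 1:])"
  have "degree p = card Col - 1"
    using fin c by (simp add: p_def degree_prod_eq_sum_degree)
  moreover have "card Col > 0" using fin c by (auto simp: card_gt_0_iff)
  ultimately have deg: "degree p < T" using T by simp
  have "(\<Sum>c'\<in>Col. v c' * poly p (y c')) = (\<Sum>c'\<in>Col. \<Sum>t\<le>degree p. coeff p t * (v c' * y c' ^ t))"
    by (simp add: poly_altdef sum_distrib_left mult_ac)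
  also have "\<dots> = (\<Sum>t\<le>degree p. coeff p t * (\<Sum>c'\<in>Col. v c' * y c' ^ t))"
    by (subst sum.swap) (simp add: sum_distrib_left)
  also have "\<dots> = 0" using deg zero by (intro sum.neutral) auto
  finally have "(\<Sum>c'\<in>Col. v c' * poly p (y c')) = 0" .
  also have "(\<Sum>c'\<in>Col. v c' * poly p (y c')) = (\<Sum>c'\<in>Col. if c' = c then v c * poly p (y c) else 0)"
    using fin by (intro sum.cong) (auto simp: p_def poly_prod)
  finally have "v c * poly p (y c) = 0" using fin c by simp
  moreover have "poly p (y c) \<noteq> 0"
    using inj c fin by (auto simp: p_def poly_prod inj_on_def)
  ultimately show "v c = 0" by simp
qed

text \<open>Mixed radix notation: each new weight exceeds every sum that the earlier digits can
  produce. Powers of 2 with these exponents later play the part of algebraically independent values,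
  for monomials of bounded degree.\<close>

lemma exponent_code:
  assumes "finite G"
  shows "\<exists>e :: 'g \<Rightarrow> nat. inj_on (\<lambda>\<alpha>. \<Sum>g\<in>G. \<alpha> g * e g) (PiE G (\<lambda>_. {..N::nat}))"
  using assms
proof induction
  case empty
  show ?case by simp
next
  case (insert g G)
  then obtain e where e: "inj_on (\<lambda>\<alpha>. \<Sum>g\<in>G. \<alpha> g * e g) (PiE G (\<lambda>_. {..N}))" by blast
  define b where "b = Suc (\<Sum>g\<in>G. N * e g)"
  define e' where "e' = e(g := b)"
  have lt: "(\<Sum>g\<in>G. \<alpha> g * e g) < b" if "\<alpha> \<in> PiE (insert g G) (\<lambda>_. {..N})" for \<alpha>
    unfolding b_def less_Suc_eq_le using that by (intro sum_mono mult_right_mono) (auto simp: PiE_iff)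
  have split: "(\<Sum>g\<in>insert g G. \<alpha> g * e' g) = (\<Sum>g\<in>G. \<alpha> g * e g) + b * \<alpha> g" for \<alpha>
  proof -
    have "(\<Sum>g\<in>G. \<alpha> g * e' g) = (\<Sum>g\<in>G. \<alpha> g * e g)"
      using insert.hyps by (intro sum.cong) (auto simp: e'_def)
    thus ?thesis using insert.hyps by (simp add: e'_def)
  qed
  have "inj_on (\<lambda>\<alpha>. \<Sum>g\<in>insert g G. \<alpha> g * e' g) (PiE (insert g G) (\<lambda>_. {..N}))"
  proof (rule inj_onI)
    fix \<alpha> \<beta> assume ab: "\<alpha> \<in> PiE (insert g G) (\<lambda>_. {..N})" "\<beta> \<in> PiE (insert g G) (\<lambda>_. {..N})"
      and eq: "(\<Sum>g\<in>insert g G. \<alpha> g * e' g) = (\<Sum>g\<in>insert g G. \<beta> g * e' g)"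
    have "b > 0" by (simp add: b_def)
    hence "\<alpha> g = \<beta> g"
      using arg_cong[OF eq, of "\<lambda>x. x div b"] lt[OF ab(1)] lt[OF ab(2)] by (simp add: split)
    moreover have "(\<Sum>g\<in>G. \<alpha> g * e g) = (\<Sum>g\<in>G. \<beta> g * e g)"
      using eq \<open>\<alpha> g = \<beta> g\<close> by (simp add: split)
    hence "restrict \<alpha> G = restrict \<beta> G"
      using ab by (intro inj_onD[OF e]) (auto simp: PiE_iff)
    hence "\<And>x. x \<in> G \<Longrightarrow> \<alpha> x = \<beta> x" by (metis restrict_apply')
    ultimately show "\<alpha> = \<beta>"
      using ab by (intro extensionalityI[of _ "insert g G"]) (auto simp: PiE_iff)
  qed
  thus ?case by blast
qed

section \<open>Gilbert--Varshamov codes\<close>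

text \<open>A word of the ball is fixed by the set where it differs from \<open>u\<close> and by its
  values there. Counting \<open>2 ^ B\<close> sets instead of using binomials costs one bit per
  position, a constant compared with the growing size of the letters.\<close>

lemma card_hamming_ball:
  fixes X :: "'a set"
  assumes X: "finite X" "X \<noteq> {}" and u: "u \<in> PiE {..<B} (\<lambda>_. X)"
  shows "card {v \<in> PiE {..<B} (\<lambda>_. X). card {b \<in> {..<B}. v b \<noteq> u b} \<le> r} \<le> 2 ^ B * card X ^ r"
proof -
  let ?W = "PiE {..<B} (\<lambda>_. X)"
  let ?S = "\<lambda>D. (\<lambda>f. restrict (\<lambda>b. if b \<in> D then f b else u b) {..<B}) ` PiE D (\<lambda>_. X)"
  let ?Ds = "{D \<in> Pow {..<B::nat}. card D \<le> r}"
  have sub: "{v \<in> ?W. card {b \<in> {..<B}. v b \<noteq> u b} \<le> r} \<subseteq> (\<Union>D\<in>?Ds. ?S D)"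
  proof
    fix v assume v: "v \<in> {v \<in> ?W. card {b \<in> {..<B}. v b \<noteq> u b} \<le> r}"
    let ?D = "{b \<in> {..<B}. v b \<noteq> u b}"
    have "v = restrict (\<lambda>b. if b \<in> ?D then restrict v ?D b else u b) {..<B}"
      using v by (intro extensionalityI[of _ "{..<B}"]) (auto simp: PiE_iff)
    moreover have "restrict v ?D \<in> PiE ?D (\<lambda>_. X)" using v by auto
    ultimately have "v \<in> ?S ?D" by blast
    moreover have "?D \<in> ?Ds" using v by auto
    ultimately show "v \<in> (\<Union>D\<in>?Ds. ?S D)" by (rule UN_I[rotated])
  qed
  have cardS: "card (?S D) \<le> card X ^ r" if D: "D \<in> ?Ds" for D
  proof -
    have finD: "finite D" using D finite_subset by auto
    have "card (?S D) \<le> card (PiE D (\<lambda>_. X))"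
      by (intro card_image_le finite_PiE finD X)
    also have "\<dots> = card X ^ card D" by (simp add: card_PiE finD)
    also have "\<dots> \<le> card X ^ r"
      using D X by (intro power_increasing) (auto simp: Suc_le_eq card_gt_0_iff)
    finally show ?thesis .
  qed
  have fin: "finite ?Ds" "\<And>D. D \<in> ?Ds \<Longrightarrow> finite (?S D)"
    using X by (auto intro!: finite_imageI finite_PiE intro: finite_subset)
  have "card {v \<in> ?W. card {b \<in> {..<B}. v b \<noteq> u b} \<le> r} \<le> card (\<Union>D\<in>?Ds. ?S D)"
    using fin by (intro card_mono sub) blast
  also have "\<dots> \<le> (\<Sum>D\<in>?Ds. card (?S D))" by (rule card_UN_le[OF fin(1)])
  also have "\<dots> \<le> (\<Sum>D\<in>?Ds. card X ^ r)" by (intro sum_mono cardS)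
  also have "\<dots> = card ?Ds * card X ^ r" by simp
  also have "card ?Ds \<le> card (Pow {..<B})" by (intro card_mono) auto
  also have "\<dots> = 2 ^ B" by (simp add: card_Pow)
  finally show ?thesis by simp
qed

text \<open>Greedy choice: by the size condition the balls around the words chosen so far do not
  cover the space. In the application \<open>r\<close> is twice the number of tolerated wrong
  letters.\<close>

lemma gilbert_varshamov:
  fixes X :: "'a set"
  assumes X: "finite X" "X \<noteq> {}" and size: "num * (2 ^ B * card X ^ r) \<le> card X ^ B"
  shows "\<exists>cw :: nat \<Rightarrow> nat \<Rightarrow> 'a. (\<forall>m<num. cw m \<in> PiE {..<B} (\<lambda>_. X)) \<and>
           (\<forall>m<num. \<forall>m'<num. m \<noteq> m' \<longrightarrow> r < card {b \<in> {..<B}. cw m b \<noteq> cw m' b})"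
  using size
proof (induction num)
  case 0
  show ?case by simp
next
  case (Suc num)
  let ?W = "PiE {..<B} (\<lambda>_. X)"
  have "num * (2 ^ B * card X ^ r) \<le> card X ^ B" using Suc.prems by simp
  from Suc.IH[OF this] obtain cw where cw': "\<forall>m<num. cw m \<in> ?W"
    and dist': "\<forall>m<num. \<forall>m'<num. m \<noteq> m' \<longrightarrow> r < card {b \<in> {..<B}. cw m b \<noteq> cw m' b}"
    by (elim exE conjE)
  have cw: "cw m \<in> ?W" if "m < num" for m
    using cw' that by blast
  have dist: "r < card {b \<in> {..<B}. cw m b \<noteq> cw m' b}" if "m < num" "m' < num" "m \<noteq> m'" for m m'
    using dist' that by blast
  let ?ball = "\<lambda>m. {v \<in> ?W. card {b \<in> {..<B}. v b \<noteq> cw m b} \<le> r}"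
  have finW: "finite ?W" using X by (intro finite_PiE) auto
  have "card (\<Union>m<num. ?ball m) \<le> (\<Sum>m<num. card (?ball m))" by (intro card_UN_le) simp
  also have "\<dots> \<le> (\<Sum>m<num. 2 ^ B * card X ^ r)" by (intro sum_mono card_hamming_ball[OF X] cw) auto
  also have "\<dots> = num * (2 ^ B * card X ^ r)" by simp
  also have "\<dots> < Suc num * (2 ^ B * card X ^ r)"
    using X by (simp add: card_gt_0_iff)
  also have "\<dots> \<le> card ?W" using Suc.prems by (simp add: card_PiE)
  finally have "\<not> ?W \<subseteq> (\<Union>m<num. ?ball m)"
    using card_mono[of "\<Union>m<num. ?ball m" ?W] finW by (auto simp del: UN_simps)
  then obtain v where v1: "v \<in> ?W" and v2: "v \<notin> (\<Union>m<num. ?ball m)" by blast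
  have v: "r < card {b \<in> {..<B}. v b \<noteq> cw m b}" if "m < num" for m
  proof (rule ccontr)
    assume "\<not> r < card {b \<in> {..<B}. v b \<noteq> cw m b}"
    hence "v \<in> ?ball m" using v1 by simp
    thus False using v2 that by blast
  qed
  have "\<forall>m<Suc num. \<forall>m'<Suc num. m \<noteq> m' \<longrightarrow>
      r < card {b \<in> {..<B}. (cw(num := v)) m b \<noteq> (cw(num := v)) m' b}"
  proof (intro allI impI)
    fix m m' assume "m < Suc num" "m' < Suc num" "m \<noteq> m'"
    moreover have "{b \<in> {..<B}. cw m b \<noteq> v b} = {b \<in> {..<B}. v b \<noteq> cw m b}" by auto
    ultimately show "r < card {b \<in> {..<B}. (cw(num := v)) m b \<noteq> (cw(num := v)) m' b}"
      using dist[of m m'] v[of m] v[of m'] by (cases "m = num"; cases "m' = num") (simp_all add: less_Suc_eq)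
  qed
  moreover have "\<forall>m<Suc num. (cw(num := v)) m \<in> ?W" using cw v1 by (auto simp: less_Suc_eq)
  ultimately show ?case by blast
qed

lemma hamming_unique:
  fixes v :: "nat \<Rightarrow> 'a"
  assumes "2 * e < card {b \<in> {..<B::nat}. u b \<noteq> u' b}" and "card {b \<in> {..<B}. v b \<noteq> u b} \<le> e"
  shows "\<not> card {b \<in> {..<B}. v b \<noteq> u' b} \<le> e"
proof -
  have "card {b \<in> {..<B}. u b \<noteq> u' b} \<le> card ({b \<in> {..<B}. v b \<noteq> u b} \<union> {b \<in> {..<B}. v b \<noteq> u' b})"
    by (intro card_mono) auto
  also have "\<dots> \<le> card {b \<in> {..<B}. v b \<noteq> u b} + card {b \<in> {..<B}. v b \<noteq> u' b}"
    by (rule card_Un_le)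
  finally show ?thesis using assms by linarith
qed

text \<open>Hoeffding for the indicators of badness. Their means are at most
  \<open>\<epsilon>\<close>, so the threshold \<open>2 * \<epsilon>\<close> leaves a deviation of
  \<open>\<epsilon>\<close> per block.\<close>

lemma (in prob_space) many_bad_events:
  assumes indep: "indep_vars (\<lambda>_. N) V UNIV" and law: "\<And>b::nat. distr M N (V b) = D"
    and bad: "bad \<in> sets N" and small: "measure D bad \<le> \<epsilon>" and pos: "0 < \<epsilon>"
  shows "prob {\<omega> \<in> space M. 2 * \<epsilon> * real B \<le> real (card {b \<in> {..<B}. V b \<omega> \<in> bad})}
           \<le> exp (- 2 * \<epsilon>\<^sup>2 * real B)"
proof (cases "B = 0")
  case True
  thus ?thesis by simp
next
  case False
  have rv [measurable]: "random_variable N (V b)" for b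
    using indep by (simp add: indep_vars_def)
  let ?Y = "\<lambda>b \<omega>. indicator bad (V b \<omega>) :: real"
  have "indep_vars (\<lambda>_. borel) (\<lambda>b. indicat_real bad \<circ> V b) {..<B}"
    using bad by (intro indep_vars_compose[OF indep_vars_subset[OF indep]]) auto
  hence "indep_vars (\<lambda>_. borel) ?Y {..<B}" by (simp add: comp_def)
  then interpret Hoeffding_ineq M "{..<B}" ?Y "\<lambda>_. 0" "\<lambda>_. 1" "\<Sum>b<B. expectation (?Y b)"
    by unfold_locales (auto simp: indicator_def)
  have E: "expectation (?Y b) \<le> \<epsilon>" for b
  proof -
    have "expectation (?Y b) = expectation (indicator (V b -` bad \<inter> space M))"
      by (intro Bochner_Integration.integral_cong) (auto simp: indicator_def)
    also have "\<dots> = prob (V b -` bad \<inter> space M)"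
      using measurable_sets[OF rv bad] by simp
    also have "\<dots> = measure D bad" using measure_distr[OF rv bad] law by simp
    finally show ?thesis using small by simp
  qed
  have eq: "real (card {b \<in> {..<B}. V b \<omega> \<in> bad}) = (\<Sum>b<B. ?Y b \<omega>)" for \<omega>
    by (simp add: indicator_def sum.If_cases Int_def conj_commute)
  have mean: "(\<Sum>b<B. expectation (?Y b)) \<le> real B * \<epsilon>"
    using sum_mono[of "{..<B}" "\<lambda>b. expectation (?Y b)" "\<lambda>_. \<epsilon>", OF E] by simp
  have "prob {\<omega> \<in> space M. 2 * \<epsilon> * real B \<le> real (card {b \<in> {..<B}. V b \<omega> \<in> bad})}
      \<le> prob {\<omega> \<in> space M. (\<Sum>b<B. ?Y b \<omega>) \<ge> (\<Sum>b<B. expectation (?Y b)) + \<epsilon> * real B}"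
  proof (rule finite_measure_mono)
    show "{\<omega> \<in> space M. (\<Sum>b<B. ?Y b \<omega>) \<ge> (\<Sum>b<B. expectation (?Y b)) + \<epsilon> * real B} \<in> events"
      using bad by measurable
    show "{\<omega> \<in> space M. 2 * \<epsilon> * real B \<le> real (card {b \<in> {..<B}. V b \<omega> \<in> bad})}
        \<subseteq> {\<omega> \<in> space M. (\<Sum>b<B. ?Y b \<omega>) \<ge> (\<Sum>b<B. expectation (?Y b)) + \<epsilon> * real B}"
      unfolding eq using mean by (auto simp: algebra_simps)
  qed
  also have "\<dots> \<le> exp (- 2 * (\<epsilon> * real B)\<^sup>2 / (\<Sum>b<B. (1 - 0)\<^sup>2))"
    using False pos by (intro Hoeffding_ineq_ge) auto
  also have "- 2 * (\<epsilon> * real B)\<^sup>2 / (\<Sum>b<B. (1 - 0)\<^sup>2) = - 2 * \<epsilon>\<^sup>2 * real B"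
    using False by (simp add: power2_eq_square)
  finally show ?thesis .
qed

section \<open>Laws of the channel and of the noise\<close>

lemma borel_measurable_vec_nth [measurable]:
  fixes f :: "'a \<Rightarrow> 'b::euclidean_space ^ 'n::finite"
  assumes "f \<in> borel_measurable M"
  shows "(\<lambda>x. f x $ i) \<in> borel_measurable M"
proof -
  have "(\<lambda>v :: 'b ^ 'n. v $ i) \<in> borel_measurable borel"
    by (intro borel_measurable_continuous_onI continuous_intros)
  thus ?thesis using assms by (rule measurable_compose[rotated])
qed

lemma borel_measurable_vec_lambda:
  fixes f :: "'a \<Rightarrow> 'n::finite \<Rightarrow> 'b::euclidean_space"
  assumes "\<And>i. (\<lambda>x. f x i) \<in> borel_measurable M"
  shows "(\<lambda>x. \<chi> i. f x i) \<in> borel_measurable M"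
proof (subst borel_measurable_euclidean_space, rule ballI)
  fix b :: "'b ^ 'n" assume "b \<in> Basis"
  then obtain i u where "b = axis i u" by (auto simp: Basis_vec_def)
  thus "(\<lambda>x. (\<chi> i. f x i) \<bullet> b) \<in> borel_measurable M"
    using assms[of i] by (simp add: inner_axis)
qed

text \<open>One index type for all scalar random variables, channel entries on the left and noise
  entries on the right, matching the family in the independence assumption; all joint laws become
  products over it.\<close>

type_synonym ('j, 'k, 'm) entry = "(nat \<times> 'j \<times> 'k \<times> 'm \<times> 'm) + (nat \<times> 'j \<times> 'm)"

fun entry_time :: "('j, 'k, 'm) entry \<Rightarrow> nat" where
  "entry_time (Inl (t, _)) = t"
| "entry_time (Inr (t, _)) = t"

text \<open>Moving the time index identifies any block with the one that starts at time 0, so that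
  all blocks live on one product space.\<close>

fun shift_entry :: "nat \<Rightarrow> ('j, 'k, 'm) entry \<Rightarrow> ('j, 'k, 'm) entry" where
  "shift_entry s (Inl (t, p)) = Inl (s + t, p)"
| "shift_entry s (Inr (t, p)) = Inr (s + t, p)"

lemma entry_time_shift [simp]: "entry_time (shift_entry s i) = s + entry_time i"
  by (cases "(s, i)" rule: shift_entry.cases) auto

lemma inj_shift_entry: "inj_on (shift_entry s) A"
proof (rule inj_onI)
  fix i i' assume "shift_entry s i = shift_entry s i'"
  thus "i = i'"
    by (cases "(s, i)" rule: shift_entry.cases; cases "(s, i')" rule: shift_entry.cases) auto
qed

definition entries :: "nat \<Rightarrow> ('j, 'k, 'm) entry set" where
  "entries n = {i. entry_time i < n}"

lemma finite_entries [simp, intro]: "finite (entries n :: ('j::finite, 'k::finite, 'm::finite) entry set)"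
proof -
  have "entries n \<subseteq> (Inl ` ({..<n} \<times> UNIV) \<union> Inr ` ({..<n} \<times> UNIV) :: ('j, 'k, 'm) entry set)"
  proof
    fix i :: "('j, 'k, 'm) entry" assume "i \<in> entries n"
    thus "i \<in> Inl ` ({..<n} \<times> UNIV) \<union> Inr ` ({..<n} \<times> UNIV)"
      by (cases i rule: entry_time.cases) (auto simp: entries_def)
  qed
  thus ?thesis by (rule finite_subset) auto
qed

definition CN :: "complex measure" where
  "CN = density lborel (\<lambda>z. ennreal (exp (- (cmod z)\<^sup>2) / pi))"

lemma sets_CN [measurable_cong, simp]: "sets CN = sets borel" and space_CN [simp]: "space CN = UNIV"
  by (simp_all add: CN_def)

section \<open>Joint laws of entries and time blocks\<close>

context interference_channel
begin

definition X :: "('j, 'k, 'm) entry \<Rightarrow> 'w \<Rightarrow> complex" where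
  "X = case_sum (\<lambda>(t, j, k, r, c). \<lambda>\<omega>. H t \<omega> $ j $ k $ r $ c) (\<lambda>(t, j, r). \<lambda>\<omega>. Z t \<omega> $ j $ r)"

lemma X_simps [simp]:
  "X (Inl (t, j, k, r, c)) \<omega> = H t \<omega> $ j $ k $ r $ c" "X (Inr (t, j, r)) \<omega> = Z t \<omega> $ j $ r"
  by (simp_all add: X_def)

definition entry_law :: "('j, 'k, 'm) entry \<Rightarrow> complex measure" where
  "entry_law i = (case i of Inl _ \<Rightarrow> \<mu> | Inr _ \<Rightarrow> CN)"

lemma indep_X: "indep_vars (\<lambda>_. borel) X UNIV"
  using indep by (simp add: X_def)

lemma X_measurable [measurable]: "X i \<in> borel_measurable \<Omega>"
  using indep_X by (simp add: indep_vars_def)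

lemma H_entry_measurable [measurable]: "(\<lambda>\<omega>. H t \<omega> $ j $ k $ r $ c) \<in> borel_measurable \<Omega>"
  using X_measurable[of "Inl (t, j, k, r, c)"] by (simp add: X_def)

lemma Z_entry_measurable [measurable]: "(\<lambda>\<omega>. Z t \<omega> $ j $ r) \<in> borel_measurable \<Omega>"
  using X_measurable[of "Inr (t, j, r)"] by (simp add: X_def)

lemma H_measurable [measurable]: "H t \<in> borel_measurable \<Omega>"
proof -
  have "(\<lambda>\<omega>. \<chi> j k r c. H t \<omega> $ j $ k $ r $ c) \<in> borel_measurable \<Omega>"
    by (intro borel_measurable_vec_lambda H_entry_measurable)
  thus ?thesis by (simp add: vec_nth_inverse)
qed

lemma X_law: "distr \<Omega> borel (X i) = entry_law i"
proof (cases i)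
  case (Inl a)
  thus ?thesis by (cases a) (simp add: entry_law_def channel_law X_def)
next
  case (Inr a)
  obtain t j r where a: "a = (t, j, r)" by (cases a)
  have "distr \<Omega> lborel (\<lambda>\<omega>. Z t \<omega> $ j $ r) = CN"
    using noise_law[of t j r] by (simp add: distributed_def CN_def)
  moreover have "distr \<Omega> borel (\<lambda>\<omega>. Z t \<omega> $ j $ r) = distr \<Omega> lborel (\<lambda>\<omega>. Z t \<omega> $ j $ r)"
    by (rule distr_cong) auto
  ultimately show ?thesis using Inr a by (simp add: entry_law_def X_def)
qed

lemma sets_entry_law [measurable_cong, simp]: "sets (entry_law i) = sets borel"
  by (metis X_law sets_distr)

lemma prob_entry_law: "prob_space (entry_law i)"
  using prob_space_distr[OF X_measurable[of i]] by (simp add: X_law)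

lemma sets_mu [measurable_cong, simp]: "sets \<mu> = sets borel"
  using sets_entry_law[of "Inl undefined"] by (simp add: entry_law_def)

lemma prob_mu: "prob_space \<mu>"
  using prob_entry_law[of "Inl undefined"] by (simp add: entry_law_def)

lemma prob_CN: "prob_space CN"
  using prob_entry_law[of "Inr undefined"] by (simp add: entry_law_def)

lemma X_joint_law:
  assumes "K \<noteq> {}"
  shows "distr \<Omega> (PiM K (\<lambda>_. borel)) (\<lambda>\<omega>. \<lambda>i\<in>K. X i \<omega>) = PiM K entry_law"
  using indep_vars_subset[OF indep_X, of K] assms indep_vars_iff_distr_eq_PiM'[of K X "\<lambda>_. borel"]
  by (simp add: X_law)

definition block :: "nat \<Rightarrow> nat \<Rightarrow> 'w \<Rightarrow> ('j, 'k, 'm) entry \<Rightarrow> complex" where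
  "block T b \<omega> = (\<lambda>i\<in>entries T. X (shift_entry (b * T) i) \<omega>)"

definition block_law :: "nat \<Rightarrow> (('j, 'k, 'm) entry \<Rightarrow> complex) measure" where
  "block_law T = PiM (entries T) entry_law"

lemma sets_block_law [measurable_cong, simp]: "sets (block_law T) = sets (PiM (entries T) (\<lambda>_. borel))"
  unfolding block_law_def by (intro sets_PiM_cong) auto

lemma prob_block_law: "prob_space (block_law T)"
  unfolding block_law_def by (intro prob_space_PiM prob_entry_law)

lemma shift_entry_law: "entry_law (shift_entry s i) = entry_law i"
  by (cases "(s, i)" rule: shift_entry.cases) (auto simp: entry_law_def)

text \<open>Reindexing a product measure along the injective shift gives a product again, and the
  factors agree because the law of an entry does not depend on its time.\<close>

lemma distr_block: "distr \<Omega> (PiM (entries T) (\<lambda>_. borel)) (block T b) = block_law T"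
proof -
  have rv: "(\<lambda>\<omega>. \<lambda>i\<in>UNIV. X i \<omega>) \<in> \<Omega> \<rightarrow>\<^sub>M PiM UNIV (\<lambda>_. borel)"
    by (intro measurable_restrict X_measurable)
  have "distr \<Omega> (PiM (entries T) (\<lambda>_. borel)) (block T b)
      = distr (distr \<Omega> (PiM UNIV (\<lambda>_. borel)) (\<lambda>\<omega>. \<lambda>i\<in>UNIV. X i \<omega>)) (PiM (entries T) (\<lambda>_. borel))
          (\<lambda>f. \<lambda>i\<in>entries T. f (shift_entry (b * T) i))"
    by (subst distr_distr[OF _ rv]) (auto simp: block_def[abs_def] comp_def
          intro!: measurable_restrict distr_cong)
  also have "\<dots> = distr (PiM UNIV entry_law) (PiM (entries T) (\<lambda>i. entry_law (shift_entry (b * T) i)))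
          (\<lambda>f. \<lambda>i\<in>entries T. f (shift_entry (b * T) i))"
    by (simp only: X_joint_law[OF UNIV_not_empty]) (intro distr_cong sets_PiM_cong refl, auto)
  also have "\<dots> = PiM (entries T) (\<lambda>i. entry_law (shift_entry (b * T) i))"
    by (rule distr_PiM_reindex[OF prob_entry_law inj_shift_entry]) auto
  finally show ?thesis by (simp add: shift_entry_law block_law_def)
qed

text \<open>Different blocks use disjoint sets of entries, told apart by
  \<open>entry_time i div T\<close>.\<close>

lemma indep_blocks:
  "indep_vars (\<lambda>_. PiM (entries T) (\<lambda>_. borel)) (block T) UNIV"
proof -
  let ?K = "\<lambda>b. shift_entry (b * T) ` (entries T :: ('j, 'k, 'm) entry set)"
  have disj: "disjoint_family_on ?K UNIV"
  proof (unfold disjoint_family_on_def, intro ballI impI)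
    fix b b' :: nat assume "b \<noteq> b'"
    have False if i: "i \<in> ?K b" "i \<in> ?K b'" for i
    proof -
      have "entry_time i div T = b" if "i \<in> ?K b" for b
        using that by (force simp: entries_def)
      from this[OF i(1)] this[OF i(2)] show False using \<open>b \<noteq> b'\<close> by simp
    qed
    thus "?K b \<inter> ?K b' = {}" by blast
  qed
  have "indep_vars (\<lambda>b. PiM (?K b) (\<lambda>_. borel)) (\<lambda>b \<omega>. \<lambda>i\<in>?K b. X i \<omega>) UNIV"
    by (intro indep_vars_restrict[OF indep_X _ disj]) auto
  hence "indep_vars (\<lambda>_. PiM (entries T) (\<lambda>_. borel))
     (\<lambda>b. (\<lambda>f. \<lambda>i\<in>entries T. f (shift_entry (b * T) i)) \<circ> (\<lambda>\<omega>. \<lambda>i\<in>?K b. X i \<omega>)) UNIV"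
  proof (rule indep_vars_compose)
    fix b
    show "(\<lambda>f. \<lambda>i\<in>entries T. f (shift_entry (b * T) i))
        \<in> PiM (?K b) (\<lambda>_. borel) \<rightarrow>\<^sub>M PiM (entries T) (\<lambda>_. borel :: complex measure)"
      by (intro measurable_restrict measurable_component_singleton) auto
  qed
  also have "(\<lambda>b. (\<lambda>f. \<lambda>i\<in>entries T. f (shift_entry (b * T) i)) \<circ> (\<lambda>\<omega>. \<lambda>i\<in>?K b. X i \<omega>)) = block T"
    by (auto simp: block_def fun_eq_iff restrict_def)
  finally show ?thesis .
qed

definition chan_entries :: "nat \<Rightarrow> ('j, 'k, 'm) entry set" where
  "chan_entries n = entries n \<inter> range Inl"

definition noise_entries :: "nat \<Rightarrow> ('j, 'k, 'm) entry set" where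
  "noise_entries n = entries n \<inter> range Inr"

text \<open>Separates channel and noise, so that the outer bound can fix a channel state and
  integrate over Gaussian noise alone. Positive \<open>n\<close> makes both index sets nonempty, as
  \<open>X_joint_law\<close> requires.\<close>

lemma channel_noise_law:
  assumes "n > 0"
  shows "distr \<Omega> (PiM (chan_entries n) (\<lambda>_. borel) \<Otimes>\<^sub>M PiM (noise_entries n) (\<lambda>_. borel))
           (\<lambda>\<omega>. (\<lambda>i\<in>chan_entries n. X i \<omega>, \<lambda>i\<in>noise_entries n. X i \<omega>))
       = PiM (chan_entries n) (\<lambda>_. \<mu>) \<Otimes>\<^sub>M PiM (noise_entries n) (\<lambda>_. CN)"
proof -
  have "indep_var (PiM (chan_entries n) (\<lambda>_. borel)) (\<lambda>\<omega>. \<lambda>i\<in>chan_entries n. X i \<omega>)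
          (PiM (noise_entries n) (\<lambda>_. borel)) (\<lambda>\<omega>. \<lambda>i\<in>noise_entries n. X i \<omega>)"
    by (rule indep_var_restrict[OF indep_X]) (auto simp: chan_entries_def noise_entries_def)
  moreover have "Inl (0, undefined) \<in> chan_entries n" "Inr (0, undefined) \<in> noise_entries n"
    using assms by (auto simp: chan_entries_def noise_entries_def entries_def)
  hence "chan_entries n \<noteq> {}" "noise_entries n \<noteq> {}" by auto
  moreover have "PiM (chan_entries n) entry_law = PiM (chan_entries n) (\<lambda>_. \<mu>)"
    "PiM (noise_entries n) entry_law = PiM (noise_entries n) (\<lambda>_. CN)"
    by (intro PiM_cong; auto simp: chan_entries_def noise_entries_def entry_law_def)+
  ultimately show ?thesis
    by (simp add: indep_var_distribution_eq X_joint_law)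
qed

lemma channel_entry_bounds: "AE \<omega> in \<Omega>. \<forall>t j k r c. cmod (H t \<omega> $ j $ k $ r $ c) \<le> hmax"
proof -
  have "AE \<omega> in \<Omega>. cmod (H t \<omega> $ j $ k $ r $ c) \<le> hmax" for t j k r c
  proof -
    have "AE z in distr \<Omega> borel (\<lambda>\<omega>. H t \<omega> $ j $ k $ r $ c). cmod z \<le> hmax"
      unfolding channel_law using channel_bounds(2) by eventually_elim simp
    thus ?thesis by (subst (asm) AE_distr_iff) auto
  qed
  thus ?thesis by (simp add: AE_all_countable)
qed

end

section \<open>Interference alignment\<close>

lemma emeasure_CN_singleton [simp]: "emeasure CN {z} = 0"
proof -
  have "AE x in lborel. x \<noteq> z" by (rule AE_lborel_singleton)
  thus ?thesis unfolding CN_def by (subst emeasure_density) (auto simp: nn_integral_0_iff_AE indicator_def)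
qed

text \<open>Transmitter \<open>k\<close> uses \<open>m k\<close> seeds on each antenna, with degrees
  below \<open>N\<close> in every cross coefficient. The exponents \<open>e\<close> belong to the
  explicit channel at which independence is checked: \<open>Inl p\<close> for a cross coefficient,
  \<open>Inr (Some k)\<close> for the wanted channels of message \<open>k\<close>,
  \<open>Inr None\<close> for the seeds.\<close>

locale beams =
  fixes demand :: "'j::finite \<Rightarrow> 'k::finite set" and m :: "'k \<Rightarrow> nat"
    and N Q :: nat and e :: "('j \<times> 'k \<times> 'm::finite \<times> 'm) + 'k option \<Rightarrow> nat"
  assumes code: "inj_on (\<lambda>\<alpha>. \<Sum>g\<in>UNIV. \<alpha> g * e g) (PiE UNIV (\<lambda>_. {..N + Q + 1}))"
begin

definition cross :: "('j \<times> 'k \<times> 'm \<times> 'm) set" where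
  "cross = {(j, k, r, c). k \<notin> demand j}"

definition mon :: "(('j \<times> 'k \<times> 'm \<times> 'm) \<Rightarrow> nat) \<Rightarrow> (('j \<times> 'k \<times> 'm \<times> 'm) \<Rightarrow> complex) \<Rightarrow> complex" where
  "mon \<alpha> g = (\<Prod>p\<in>cross. g p ^ \<alpha> p)"

definition degs :: "nat \<Rightarrow> (('j \<times> 'k \<times> 'm \<times> 'm) \<Rightarrow> nat) set" where
  "degs n = PiE cross (\<lambda>_. {..<n})"

text \<open>Geometric in the time \<open>\<tau>\<close>, so that at the explicit channel a whole
  column becomes a geometric sequence.\<close>

definition seed :: "nat \<Rightarrow> nat \<Rightarrow> complex" where
  "seed \<tau> l = 2 ^ (\<tau> * (l * e (Inr None)))"

definition mx :: "'j \<Rightarrow> nat" where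
  "mx j = Max (insert 0 (m ` (- demand j)))"

definition streams :: "'k \<Rightarrow> ('m \<times> nat \<times> (('j \<times> 'k \<times> 'm \<times> 'm) \<Rightarrow> nat)) set" where
  "streams k = UNIV \<times> {..<m k} \<times> degs N"

definition wanted where
  "wanted j = (SIGMA k:demand j. streams k)"

text \<open>The beams reserved for interference. Seeds run up to the largest \<open>m i\<close> of
  an interferer because all transmitters draw on the same seeds; degrees run up to \<open>N\<close>
  inclusive, to leave room for the factor gained in the cross channel.\<close>

definition unwanted :: "'j \<Rightarrow> ('m \<times> nat \<times> (('j \<times> 'k \<times> 'm \<times> 'm) \<Rightarrow> nat)) set" where
  "unwanted j = UNIV \<times> {..<mx j} \<times> degs (Suc N)"

definition cols where
  "cols j = Inl ` wanted j \<union> Inr ` unwanted j"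

text \<open>Matrix of the aligned system. A wanted stream keeps a column of its own, weighted by the
  channel it passes through; interference is described directly at the receive antenna, with the
  channel already absorbed into the monomial.\<close>

definition row :: "'j \<Rightarrow> nat \<Rightarrow> (('j \<times> 'k \<times> 'm \<times> 'm) \<Rightarrow> complex) \<Rightarrow> 'm \<Rightarrow>
    ('k \<times> 'm \<times> nat \<times> (('j \<times> 'k \<times> 'm \<times> 'm) \<Rightarrow> nat)) + ('m \<times> nat \<times> (('j \<times> 'k \<times> 'm \<times> 'm) \<Rightarrow> nat)) \<Rightarrow> complex" where
  "row j \<tau> g r col = (case col of
       Inl (k, c, l, \<alpha>) \<Rightarrow> g (j, k, r, c) * seed \<tau> l * mon \<alpha> g
     | Inr (r', l, \<alpha>) \<Rightarrow> if r' = r then seed \<tau> l * mon \<alpha> g else 0)"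

lemma finite_cross [simp, intro]: "finite cross"
  by (rule finite_subset[of _ UNIV]) auto

lemma finite_degs [simp, intro]: "finite (degs n)"
  unfolding degs_def by (intro finite_PiE) auto

lemma card_degs: "card (degs n) = n ^ card cross"
  by (simp add: degs_def card_PiE)

lemma finite_streams [simp, intro]: "finite (streams k)"
  unfolding streams_def by auto

lemma card_streams: "card (streams k) = CARD('m) * m k * N ^ card cross"
  by (simp add: streams_def card_cartesian_product card_degs)

lemma finite_wanted [simp, intro]: "finite (wanted j)"
  unfolding wanted_def by auto

lemma finite_unwanted [simp, intro]: "finite (unwanted j)"
  unfolding unwanted_def by auto

lemma finite_cols [simp, intro]: "finite (cols j)"
  unfolding cols_def by auto

lemma le_mx: "i \<notin> demand j \<Longrightarrow> m i \<le> mx j"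
  unfolding mx_def by (intro Max_ge) auto

lemma sum_cols: "(\<Sum>col\<in>cols j. f col) = (\<Sum>col\<in>wanted j. f (Inl col)) + (\<Sum>col\<in>unwanted j. f (Inr col))"
  unfolding cols_def
  by (subst sum.union_disjoint) (auto simp: sum.reindex)

lemma polyfun_mon: "polyfun (\<lambda>h. mon \<alpha> (\<lambda>p. h (f p)))"
  unfolding mon_def by (intro polyfun_intros)

lemma polyfun_row: "polyfun (\<lambda>h. row j \<tau> (\<lambda>p. h (f p)) r col)"
proof (cases col)
  case (Inl a)
  thus ?thesis by (cases a) (auto simp: row_def intro!: polyfun_intros polyfun_mon)
next
  case (Inr a)
  obtain r' l \<alpha> where "a = (r', l, \<alpha>)" by (cases a)
  thus ?thesis using Inr by (cases "r' = r") (auto simp: row_def intro!: polyfun_intros polyfun_mon)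
qed

definition bump where
  "bump p \<alpha> = \<alpha>(p := Suc (\<alpha> p))"

lemma mon_bump: "p \<in> cross \<Longrightarrow> mon (bump p \<alpha>) g = g p * mon \<alpha> g"
proof -
  assume p: "p \<in> cross"
  have "mon (bump p \<alpha>) g = g p ^ Suc (\<alpha> p) * (\<Prod>q\<in>cross - {p}. g q ^ \<alpha> q)"
    unfolding mon_def by (subst prod.remove[OF finite_cross p]) (auto simp: bump_def intro!: prod.cong)
  also have "\<dots> = g p * mon \<alpha> g"
    unfolding mon_def prod.remove[OF finite_cross p, of "\<lambda>p. g p ^ \<alpha> p"] by simp
  finally show ?thesis .
qed

lemma bump_degs: "p \<in> cross \<Longrightarrow> \<alpha> \<in> degs N \<Longrightarrow> bump p \<alpha> \<in> degs (Suc N)"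
  unfolding degs_def bump_def by (force simp: PiE_iff extensional_def less_Suc_eq)

definition interferers where
  "interferers j = (SIGMA k:- demand j. streams k)"

lemma finite_interferers [simp, intro]: "finite (interferers j)"
  unfolding interferers_def by auto

definition aligned where
  "aligned j r = (\<lambda>(k, c, l, \<alpha>). (r, l, bump (j, k, r, c) \<alpha>))"

text \<open>Interfering streams that land on the same beam cannot be told apart, so their column
  carries the sum of their symbols. Such a sum is still a Gaussian integer, and this is all that the
  receiver relies on.\<close>

definition symbols where
  "symbols j \<sigma> col = (case col of
       Inl (k, x) \<Rightarrow> \<sigma> k x
     | Inr (r, l, \<alpha>) \<Rightarrow> \<Sum>(k, x) | (k, x) \<in> interferers j \<and> aligned j r (k, x) = (r, l, \<alpha>). \<sigma> k x)"

lemma aligned_unwanted: "x \<in> interferers j \<Longrightarrow> aligned j r x \<in> unwanted j"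
proof -
  assume x: "x \<in> interferers j"
  obtain k c l \<alpha> where eq: "x = (k, c, l, \<alpha>)" by (cases x)
  have k: "k \<notin> demand j" "l < m k" "\<alpha> \<in> degs N"
    using x by (auto simp: eq interferers_def streams_def)
  hence "l < mx j" using le_mx by (metis less_le_trans)
  moreover have "bump (j, k, r, c) \<alpha> \<in> degs (Suc N)"
    using k by (intro bump_degs) (auto simp: cross_def)
  ultimately show ?thesis by (simp add: eq aligned_def unwanted_def)
qed

text \<open>Multiplication by a cross channel only raises the degree of the monomial, so all
  interference falls into the span of the beams indexed by \<^term>\<open>unwanted j\<close>.\<close>

lemma alignment:
  "(\<Sum>k\<in>UNIV. \<Sum>c\<in>UNIV. g (j, k, r, c) * (\<Sum>(l, \<alpha>)\<in>{..<m k} \<times> degs N. seed \<tau> l * mon \<alpha> g * \<sigma> k (c, l, \<alpha>)))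
     = (\<Sum>col\<in>cols j. row j \<tau> g r col * symbols j \<sigma> col)"
proof -
  let ?h = "\<lambda>(k, c, l, \<alpha>). g (j, k, r, c) * (seed \<tau> l * mon \<alpha> g * \<sigma> k (c, l, \<alpha>))"
  have "(\<Sum>c\<in>UNIV. g (j, k, r, c) * (\<Sum>(l, \<alpha>)\<in>{..<m k} \<times> degs N. seed \<tau> l * mon \<alpha> g * \<sigma> k (c, l, \<alpha>)))
      = (\<Sum>x\<in>streams k. ?h (k, x))" for k
    unfolding streams_def
    by (simp add: sum.cartesian_product' sum_distrib_left)
  hence "(\<Sum>k\<in>UNIV. \<Sum>c\<in>UNIV. g (j, k, r, c) * (\<Sum>(l, \<alpha>)\<in>{..<m k} \<times> degs N. seed \<tau> l * mon \<alpha> g * \<sigma> k (c, l, \<alpha>)))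
      = (\<Sum>k\<in>demand j \<union> - demand j. \<Sum>x\<in>streams k. ?h (k, x))"
    by (simp add: Un_commute)
  also have "\<dots> = (\<Sum>k\<in>demand j. \<Sum>x\<in>streams k. ?h (k, x)) + (\<Sum>k\<in>- demand j. \<Sum>x\<in>streams k. ?h (k, x))"
    by (rule sum.union_disjoint) auto
  also have "(\<Sum>k\<in>demand j. \<Sum>x\<in>streams k. ?h (k, x)) = (\<Sum>x\<in>wanted j. ?h x)"
    unfolding wanted_def by (subst sum.Sigma) (auto simp: split_def)
  also have "\<dots> = (\<Sum>col\<in>wanted j. row j \<tau> g r (Inl col) * symbols j \<sigma> (Inl col))"
    by (intro sum.cong) (auto simp: row_def symbols_def)
  also have "(\<Sum>k\<in>- demand j. \<Sum>x\<in>streams k. ?h (k, x)) = (\<Sum>x\<in>interferers j. ?h x)"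
    unfolding interferers_def by (subst sum.Sigma) (auto simp: split_def)
  also have "\<dots> = (\<Sum>x\<in>interferers j. row j \<tau> g r (Inr (aligned j r x)) * (case x of (k, y) \<Rightarrow> \<sigma> k y))"
  proof (rule sum.cong[OF refl], clarify)
    fix k c l \<alpha> assume "(k, c, l, \<alpha>) \<in> interferers j"
    hence "(j, k, r, c) \<in> cross" by (auto simp: interferers_def cross_def)
    thus "g (j, k, r, c) * (seed \<tau> l * mon \<alpha> g * \<sigma> k (c, l, \<alpha>)) =
       row j \<tau> g r (Inr (aligned j r (k, c, l, \<alpha>))) * \<sigma> k (c, l, \<alpha>)"
      by (simp add: aligned_def row_def mon_bump)
  qed
  also have "\<dots> = (\<Sum>col\<in>unwanted j. \<Sum>x | x \<in> interferers j \<and> aligned j r x = col.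
      row j \<tau> g r (Inr (aligned j r x)) * (case x of (k, y) \<Rightarrow> \<sigma> k y))"
    by (rule sum.group[symmetric]) (use aligned_unwanted in \<open>auto simp del: split_paired_All\<close>)
  also have "\<dots> = (\<Sum>col\<in>unwanted j. row j \<tau> g r (Inr col) * symbols j \<sigma> (Inr col))"
  proof (rule sum.cong[OF refl])
    fix col assume "col \<in> unwanted j"
    obtain r' l \<alpha> where col: "col = (r', l, \<alpha>)" by (cases col)
    have "(\<Sum>x | x \<in> interferers j \<and> aligned j r x = col.
        row j \<tau> g r (Inr (aligned j r x)) * (case x of (k, y) \<Rightarrow> \<sigma> k y))
      = row j \<tau> g r (Inr col) * (\<Sum>x | x \<in> interferers j \<and> aligned j r x = col. (case x of (k, y) \<Rightarrow> \<sigma> k y))"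
      by (subst sum_distrib_left) (intro sum.cong, auto)
    also have "\<dots> = row j \<tau> g r (Inr col) * symbols j \<sigma> (Inr col)"
      by (cases "r' = r") (auto simp: col row_def symbols_def split_def)
    finally show "(\<Sum>x | x \<in> interferers j \<and> aligned j r x = col.
        row j \<tau> g r (Inr (aligned j r x)) * (case x of (k, y) \<Rightarrow> \<sigma> k y))
      = row j \<tau> g r (Inr col) * symbols j \<sigma> (Inr col)" .
  qed
  finally show ?thesis by (simp add: sum_cols)
qed

text \<open>At this point every receiver sees its wanted streams separated by antenna, and every
  remaining column is a geometric sequence in time.\<close>

definition probe :: "nat \<Rightarrow> ('j \<times> 'k \<times> 'm \<times> 'm) \<Rightarrow> complex" where
  "probe \<tau> = (\<lambda>(j, k, r, c). if k \<notin> demand j then 2 ^ (\<tau> * e (Inl (j, k, r, c)))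
     else if r = c then 2 ^ (\<tau> * e (Inr (Some k))) else 0)"

text \<open>The digits of a column at the probe: degrees in the cross coefficients, seed index, and
  a marker for the wanted message. The marker separates wanted columns from interference and from
  those of other wanted messages.\<close>

definition col_exps where
  "col_exps col = (case col of
       Inl (k, c, l, \<alpha>) \<Rightarrow> (\<lambda>v. case v of Inl p \<Rightarrow> if p \<in> cross then \<alpha> p else 0
          | Inr None \<Rightarrow> l | Inr (Some k') \<Rightarrow> if k' = k then 1 else 0)
     | Inr (r, l, \<alpha>) \<Rightarrow> (\<lambda>v. case v of Inl p \<Rightarrow> if p \<in> cross then \<alpha> p else 0
          | Inr None \<Rightarrow> l | Inr (Some k') \<Rightarrow> 0))"

definition node :: "_ \<Rightarrow> complex" where
  "node col = 2 ^ (\<Sum>v\<in>UNIV. col_exps col v * e v)"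

definition antenna where
  "antenna col = (case col of Inl (k, c, l, \<alpha>) \<Rightarrow> c | Inr (r, l, \<alpha>) \<Rightarrow> r)"

lemma mon_probe: "mon \<alpha> (probe \<tau>) = 2 ^ (\<tau> * (\<Sum>p\<in>cross. \<alpha> p * e (Inl p)))"
proof -
  have "mon \<alpha> (probe \<tau>) = (\<Prod>p\<in>cross. 2 ^ (\<tau> * (\<alpha> p * e (Inl p))))"
    unfolding mon_def
    by (intro prod.cong) (auto simp: probe_def cross_def power_mult[symmetric] mult_ac)
  thus ?thesis by (simp add: power_sum sum_distrib_left)
qed

lemma sum_exps:
  fixes a :: "'k option \<Rightarrow> nat"
  shows "(\<Sum>v\<in>UNIV. (case v of Inl p \<Rightarrow> if p \<in> cross then \<alpha> p else 0 | Inr x \<Rightarrow> a x) * e v)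
    = (\<Sum>p\<in>cross. \<alpha> p * e (Inl p)) + (\<Sum>x\<in>UNIV. a x * e (Inr x))"
proof -
  have "(\<Sum>v\<in>UNIV. f v) = (\<Sum>p\<in>UNIV. f (Inl p)) + (\<Sum>x\<in>UNIV. f (Inr x))"
    for f :: "('j \<times> 'k \<times> 'm \<times> 'm) + 'k option \<Rightarrow> nat"
    by (subst UNIV_sum, subst sum.union_disjoint) (auto simp: sum.reindex)
  moreover have "(\<Sum>p\<in>UNIV. (if p \<in> cross then \<alpha> p else 0) * e (Inl p)) = (\<Sum>p\<in>cross. \<alpha> p * e (Inl p))"
    by (rule sum.mono_neutral_cong_right) auto
  ultimately show ?thesis by simp
qed

text \<open>The probe makes wanted channels diagonal, so the rows of a receive antenna meet only the
  columns of that antenna and the system splits into Vandermonde blocks.\<close>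

lemma row_probe:
  assumes "col \<in> cols j"
  shows "row j \<tau> (probe \<tau>) r col = (if antenna col = r then node col ^ \<tau> else 0)"
proof (cases col)
  case (Inl a)
  obtain k c l \<alpha> where a: "a = (k, c, l, \<alpha>)" by (cases a)
  have k: "k \<in> demand j" using assms by (auto simp: Inl a cols_def wanted_def)
  have "col_exps col = (\<lambda>v. case v of Inl p \<Rightarrow> if p \<in> cross then \<alpha> p else 0
      | Inr x \<Rightarrow> (case x of None \<Rightarrow> l | Some k' \<Rightarrow> if k' = k then 1 else 0))"
    by (auto simp: col_exps_def Inl a fun_eq_iff split: sum.splits option.splits)
  hence "(\<Sum>v\<in>UNIV. col_exps col v * e v) = (\<Sum>p\<in>cross. \<alpha> p * e (Inl p))
      + (\<Sum>x\<in>UNIV. (case x of None \<Rightarrow> l | Some k' \<Rightarrow> if k' = k then 1 else 0) * e (Inr x))"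
    by (simp only: sum_exps)
  also have "(\<Sum>x\<in>UNIV. (case x of None \<Rightarrow> l | Some k' \<Rightarrow> if k' = k then 1 else 0) * e (Inr x))
      = l * e (Inr None) + e (Inr (Some k))"
    by (simp add: UNIV_option_conv sum.reindex if_distrib[of "\<lambda>x. x * _"] sum.delta' cong: if_cong)
  finally show ?thesis using k
    by (auto simp: row_def Inl a probe_def mon_probe[unfolded probe_def] antenna_def node_def seed_def
        power_mult[symmetric] power_add[symmetric] algebra_simps)
next
  case (Inr a)
  obtain r' l \<alpha> where a: "a = (r', l, \<alpha>)" by (cases a)
  have "col_exps col = (\<lambda>v. case v of Inl p \<Rightarrow> if p \<in> cross then \<alpha> p else 0
      | Inr x \<Rightarrow> (case x of None \<Rightarrow> l | Some k' \<Rightarrow> 0))"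
    by (auto simp: col_exps_def Inr a fun_eq_iff split: sum.splits option.splits)
  hence "(\<Sum>v\<in>UNIV. col_exps col v * e v) = (\<Sum>p\<in>cross. \<alpha> p * e (Inl p))
      + (\<Sum>x\<in>UNIV. (case x of None \<Rightarrow> l | Some k' \<Rightarrow> 0) * e (Inr x))"
    by (simp only: sum_exps)
  also have "(\<Sum>x\<in>UNIV. (case x of None \<Rightarrow> l | Some k' \<Rightarrow> 0) * e (Inr x)) = l * e (Inr None)"
    by (simp add: UNIV_option_conv sum.reindex)
  finally show ?thesis
    by (auto simp: row_def Inr a mon_probe antenna_def node_def seed_def
        power_mult[symmetric] power_add[symmetric] algebra_simps)
qed

text \<open>Equal nodes have equal digits, and the digits recover everything about a column except
  its antenna; hence the restriction to a single antenna.\<close>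

lemma inj_node:
  assumes mQ: "\<And>k. m k \<le> Q"
  shows "inj_on node {col \<in> cols j. antenna col = r}"
proof (rule inj_onI)
  fix x y assume x: "x \<in> {col \<in> cols j. antenna col = r}" and y: "y \<in> {col \<in> cols j. antenna col = r}"
    and eq: "node x = node y"
  have mxQ: "mx j \<le> Q" unfolding mx_def using mQ by simp
  \<comment> \<open>Degrees are at most \<open>N\<close>, seed indices below \<open>Q\<close> and
    markers at most 1; the digit bound \<open>N + Q + 1\<close> covers all of them.\<close>
  have range: "col_exps z \<in> PiE UNIV (\<lambda>_. {..N + Q + 1})" if z: "z \<in> cols j" for z
  proof (cases z)
    case (Inl a)
    obtain k c l \<alpha> where a: "a = (k, c, l, \<alpha>)" by (cases a)
    have "l < m k" "\<alpha> \<in> degs N" using z by (auto simp: Inl a cols_def wanted_def streams_def)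
    hence "l \<le> N + Q + 1" "\<And>p. p \<in> cross \<Longrightarrow> \<alpha> p \<le> N + Q + 1"
      using mQ[of k] by (auto simp: degs_def PiE_iff less_imp_le trans_le_add1)
    thus ?thesis by (auto simp: col_exps_def Inl a split: sum.splits option.splits)
  next
    case (Inr a)
    obtain r' l \<alpha> where a: "a = (r', l, \<alpha>)" by (cases a)
    have "l < mx j" "\<alpha> \<in> degs (Suc N)" using z by (auto simp: Inr a cols_def unwanted_def)
    hence "l \<le> N + Q + 1" "\<And>p. p \<in> cross \<Longrightarrow> \<alpha> p \<le> N + Q + 1"
      using mxQ by (auto simp: degs_def PiE_iff less_Suc_eq_le trans_le_add1)
    thus ?thesis by (auto simp: col_exps_def Inr a split: sum.splits option.splits)
  qed
  have "(of_nat (2 ^ (\<Sum>v\<in>UNIV. col_exps x v * e v)) :: complex) = of_nat (2 ^ (\<Sum>v\<in>UNIV. col_exps y v * e v))"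
    using eq by (simp add: node_def)
  hence "(\<Sum>v\<in>UNIV. col_exps x v * e v) = (\<Sum>v\<in>UNIV. col_exps y v * e v)"
    by (simp only: of_nat_eq_iff) (simp add: power_inject_exp)
  hence exps: "col_exps x = col_exps y"
    using x y by (intro inj_onD[OF code _ range range]) auto
  have degs_eq: "\<alpha> = \<beta>" if "\<alpha> \<in> degs n" "\<beta> \<in> degs n'" "\<And>p. p \<in> cross \<Longrightarrow> \<alpha> p = \<beta> p" for \<alpha> \<beta> n n'
    using that by (intro extensionalityI[of _ cross]) (auto simp: degs_def PiE_iff)
  obtain k c l \<alpha> where x': "x = Inl (k, c, l, \<alpha>) \<or> x = Inr (c, l, \<alpha>)"
    by (metis old.sum.exhaust prod_cases3 prod_cases4)
  obtain k' c' l' \<beta> where y': "y = Inl (k', c', l', \<beta>) \<or> y = Inr (c', l', \<beta>)"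
    by (metis old.sum.exhaust prod_cases3 prod_cases4)
  have "\<alpha> = \<beta>"
  proof (rule degs_eq)
    show "\<alpha> \<in> degs (if isl x then N else Suc N)" "\<beta> \<in> degs (if isl y then N else Suc N)"
      using x x' y y' by (auto simp: cols_def wanted_def streams_def unwanted_def)
    show "\<alpha> p = \<beta> p" if "p \<in> cross" for p
      using that fun_cong[OF exps, of "Inl p"] x' y' by (auto simp: col_exps_def)
  qed
  moreover have "l = l'"
    using fun_cong[OF exps, of "Inr None"] x' y' by (auto simp: col_exps_def)
  moreover have "c = c'" using x y x' y' by (auto simp: antenna_def)
  moreover have "x = y" if "c = c'" "l = l'" "\<alpha> = \<beta>"
    using x' y'
  proof (elim disjE)
    assume xy: "x = Inl (k, c, l, \<alpha>)" "y = Inl (k', c', l', \<beta>)"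
    have "k = k'"
      using fun_cong[OF exps, of "Inr (Some k)"] by (simp add: xy col_exps_def split: if_splits)
    thus ?thesis using that xy by simp
  next
    assume xy: "x = Inl (k, c, l, \<alpha>)" "y = Inr (c', l', \<beta>)"
    show ?thesis using fun_cong[OF exps, of "Inr (Some k)"] by (simp add: xy col_exps_def)
  next
    assume xy: "x = Inr (c, l, \<alpha>)" "y = Inl (k', c', l', \<beta>)"
    show ?thesis using fun_cong[OF exps, of "Inr (Some k')"] by (simp add: xy col_exps_def)
  qed (use that in simp)
  ultimately show "x = y" by blast
qed

text \<open>This count fixes the block length: one receive antenna must separate at most
  \<open>Q\<close> seeds times \<open>(N+1)^g\<close> monomials, \<open>g\<close> being
  \<open>card cross\<close>, and needs that many times.\<close>

lemma card_cols_antenna: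
  assumes dim: "(\<Sum>k\<in>demand j. m k) + mx j \<le> Q"
  shows "card {col \<in> cols j. antenna col = r} \<le> Q * Suc N ^ card cross"
proof -
  let ?a = "SIGMA k:demand j. {r} \<times> {..<m k} \<times> degs N" and ?b = "{r} \<times> {..<mx j} \<times> degs (Suc N)"
  have "{col \<in> cols j. antenna col = r} \<subseteq> Inl ` ?a \<union> Inr ` ?b"
    by (auto simp: cols_def wanted_def streams_def unwanted_def antenna_def)
  hence "card {col \<in> cols j. antenna col = r} \<le> card (Inl ` ?a \<union> Inr ` ?b)"
    by (intro card_mono) auto
  also have "\<dots> \<le> card ?a + card ?b"
    by (rule order.trans[OF card_Un_le]) (intro add_mono card_image_le, auto)
  also have "card ?a = (\<Sum>k\<in>demand j. m k * N ^ card cross)"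
    by (subst card_SigmaI) (auto simp: card_cartesian_product card_degs)
  also have "\<dots> \<le> (\<Sum>k\<in>demand j. m k * Suc N ^ card cross)"
    by (intro sum_mono mult_left_mono power_mono) auto
  also have "card ?b = mx j * Suc N ^ card cross"
    by (simp only: card_cartesian_product card_degs) simp
  also have "(\<Sum>k\<in>demand j. m k * Suc N ^ card cross) + mx j * Suc N ^ card cross
      = ((\<Sum>k\<in>demand j. m k) + mx j) * Suc N ^ card cross"
    by (simp add: sum_distrib_right distrib_right del: power_Suc)
  also have "\<dots> \<le> Q * Suc N ^ card cross" by (intro mult_right_mono dim) simp
  finally show ?thesis by simp
qed

lemma probe_injective:
  assumes mQ: "\<And>k. m k \<le> Q" and dim: "(\<Sum>k\<in>demand j. m k) + mx j \<le> Q"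
    and zero: "\<And>\<tau> r. \<tau> < Q * Suc N ^ card cross \<Longrightarrow> (\<Sum>col\<in>cols j. row j \<tau> (probe \<tau>) r col * v col) = 0"
  shows "\<forall>col\<in>cols j. v col = 0"
proof
  fix col assume col: "col \<in> cols j"
  let ?C = "{x \<in> cols j. antenna x = antenna col}"
  have "\<forall>x\<in>?C. v x = 0"
  proof (rule geometric_sequences_independent[OF _ inj_node[OF mQ] card_cols_antenna[OF dim]])
    fix t assume t: "t < Q * Suc N ^ card cross"
    have "(\<Sum>x\<in>?C. v x * node x ^ t) = (\<Sum>x\<in>cols j. row j t (probe t) (antenna col) x * v x)"
      by (rule sum.mono_neutral_cong_left) (auto simp: row_probe)
    thus "(\<Sum>x\<in>?C. v x * node x ^ t) = 0" using zero[OF t] by simp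
  qed auto
  thus "v col = 0" using col by simp
qed

end

section \<open>Good blocks\<close>

definition gauss :: "complex set" where
  "gauss = {z. Re z \<in> \<int> \<and> Im z \<in> \<int>}"

lemma countable_gauss: "countable gauss"
proof -
  have "gauss \<subseteq> (\<lambda>(a, b). Complex (of_int a) (of_int b)) ` (UNIV :: (int \<times> int) set)"
    by (auto simp: gauss_def complex_eq_iff image_iff elim!: Ints_cases)
  thus ?thesis by (rule countable_subset) auto
qed

lemma gauss_diff: "x \<in> gauss \<Longrightarrow> y \<in> gauss \<Longrightarrow> x - y \<in> gauss"
  by (auto simp: gauss_def)

lemma gauss_sum: "(\<And>a. a \<in> A \<Longrightarrow> f a \<in> gauss) \<Longrightarrow> sum f A \<in> gauss"
  by (auto simp: gauss_def intro!: Ints_sum)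

text \<open>The discreteness that turns a left inverse into a minimum distance.\<close>

lemma gauss_norm_ge_1: "x \<in> gauss \<Longrightarrow> x \<noteq> 0 \<Longrightarrow> 1 \<le> cmod x"
proof -
  assume x: "x \<in> gauss" "x \<noteq> 0"
  hence "Re x \<noteq> 0 \<or> Im x \<noteq> 0" by (auto simp: complex_eq_iff)
  hence "1 \<le> \<bar>Re x\<bar> \<or> 1 \<le> \<bar>Im x\<bar>"
    using x Ints_nonzero_abs_ge1 by (auto simp: gauss_def)
  thus ?thesis using abs_Re_le_cmod[of x] abs_Im_le_cmod[of x] by linarith
qed

lemma pred_bex_finite:
  assumes "finite I" and "\<And>i. i \<in> I \<Longrightarrow> Measurable.pred M (P i)"
  shows "Measurable.pred M (\<lambda>x. \<exists>i\<in>I. P i x)"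
  using assms by (rule pred_intros_finite)

lemma pred_ball_countable:
  assumes "countable I" and "\<And>i. i \<in> I \<Longrightarrow> Measurable.pred M (P i)"
  shows "Measurable.pred M (\<lambda>x. \<forall>i\<in>I. P i x)"
  using assms by (simp add: pred_intros_countable_bounded)

lemma pred_le_norm:
  fixes f :: "'a \<Rightarrow> 'b::{second_countable_topology, real_normed_vector}"
  assumes [measurable]: "f \<in> borel_measurable M"
  shows "Measurable.pred M (\<lambda>x. c \<le> norm (f x))"
  by measurable

lemma (in interference_channel) entry_law_atomless: "emeasure (entry_law i) {z} = 0"
  by (cases i) (simp_all add: entry_law_def channel_continuous)

text \<open>Adds the integer form of the region, with \<open>Q\<close> in the role of the number of
  antennas.\<close>

locale coded_channel = interference_channel \<Omega> H Z \<mu> hmin hmax + beams demand m N Q e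
  for \<Omega> :: "'w measure"
    and H :: "nat \<Rightarrow> 'w \<Rightarrow> ('j::finite, 'k::finite, 'm::finite) channel_state"
    and Z :: "nat \<Rightarrow> 'w \<Rightarrow> complex ^ 'm ^ 'j"
    and \<mu> :: "complex measure" and hmin hmax :: real
    and demand :: "'j \<Rightarrow> 'k set" and m :: "'k \<Rightarrow> nat" and N Q :: nat
    and e :: "('j \<times> 'k \<times> 'm \<times> 'm) + 'k option \<Rightarrow> nat" +
  assumes Q_pos: "Q > 0" and m_le_Q: "\<And>k. m k \<le> Q"
    and dims: "\<And>j. (\<Sum>k\<in>demand j. m k) + mx j \<le> Q"
begin

definition T :: nat where
  "T = Q * Suc N ^ card cross"

lemma T_pos: "T > 0"
  using Q_pos by (simp add: T_def)

definition gain :: "(('j, 'k, 'm) entry \<Rightarrow> complex) \<Rightarrow> nat \<Rightarrow> 'j \<times> 'k \<times> 'm \<times> 'm \<Rightarrow> complex" where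
  "gain v \<tau> = (\<lambda>p. v (Inl (\<tau>, p)))"

text \<open>Injectivity at the probe spreads to almost every channel. The left inverse comes without
  a uniform bound; the blocks where it is large are put into \<open>bad\<close>.\<close>

lemma AE_left_inverse:
  "AE v in block_law T. \<forall>j. \<exists>L. \<forall>x. \<forall>col\<in>cols j. x col = (\<Sum>(\<tau>, r)\<in>{..<T} \<times> UNIV.
      L col (\<tau>, r) * (\<Sum>col'\<in>cols j. row j \<tau> (gain v \<tau>) r col' * x col'))"
proof (subst AE_all_countable, rule allI)
  fix j
  \<comment> \<open>The point where injectivity is known: the probe at every time, completed by
    \<open>0\<close> at the noise entries.\<close>
  define h0 :: "('j, 'k, 'm) entry \<Rightarrow> complex"
    where "h0 = (\<lambda>i. case i of Inl (\<tau>, p) \<Rightarrow> probe \<tau> p | Inr _ \<Rightarrow> 0)"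
  have gain_h0: "gain h0 \<tau> = probe \<tau>" for \<tau>
    by (simp add: gain_def h0_def)
  let ?A = "\<lambda>h (\<tau>, r) col. row j \<tau> (gain h \<tau>) r col"
  have "\<exists>F L. polyfun F \<and> F h0 \<noteq> 0 \<and> (\<forall>c\<in>cols j. \<forall>r\<in>{..<T} \<times> UNIV. polyfun (\<lambda>h. L h c r)) \<and>
      (\<forall>h v. \<forall>c\<in>cols j. F h * v c = (\<Sum>r\<in>{..<T} \<times> UNIV. L h c r * (\<Sum>c'\<in>cols j. ?A h r c' * v c')))"
  proof (rule generic_left_inverse)
    show "polyfun (\<lambda>h. ?A h r c)" for r :: "nat \<times> 'm" and c
      unfolding gain_def split_def by (rule polyfun_row)
    show "\<forall>c\<in>cols j. v c = 0"
      if "\<And>r. r \<in> {..<T} \<times> UNIV \<Longrightarrow> (\<Sum>c\<in>cols j. ?A h0 r c * v c) = 0" for v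
    proof (rule probe_injective[OF m_le_Q dims])
      fix \<tau> r assume "\<tau> < Q * Suc N ^ card cross"
      thus "(\<Sum>col\<in>cols j. row j \<tau> (probe \<tau>) r col * v col) = 0"
        using that[of "(\<tau>, r)"] by (simp add: T_def gain_h0)
    qed
  qed auto
  then obtain F L where F: "polyfun F" "F h0 \<noteq> 0"
    and FL: "\<And>h v c. c \<in> cols j \<Longrightarrow>
      F h * v c = (\<Sum>r\<in>{..<T} \<times> UNIV. L h c r * (\<Sum>c'\<in>cols j. ?A h r c' * v c'))"
    by blast
  have "AE v in block_law T. F (\<lambda>i. if i \<in> entries T then v i else h0 i) \<noteq> 0"
    unfolding block_law_def
    using polyfun_AE_nonzero[of entry_law F "entries T" h0] prob_entry_law sets_entry_law entry_law_atomless F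
      finite_entries by blast
  thus "AE v in block_law T. \<exists>L. \<forall>x. \<forall>col\<in>cols j. x col = (\<Sum>(\<tau>, r)\<in>{..<T} \<times> UNIV.
      L col (\<tau>, r) * (\<Sum>col'\<in>cols j. row j \<tau> (gain v \<tau>) r col' * x col'))"
  proof eventually_elim
    case (elim v)
    let ?h = "\<lambda>i. if i \<in> entries T then v i else h0 i"
    have g: "gain ?h \<tau> = gain v \<tau>" if "\<tau> < T" for \<tau>
      by (rule ext) (simp add: gain_def entries_def that)
    show ?case
    proof (rule exI[of _ "\<lambda>c r. L ?h c r / F ?h"], intro allI ballI)
      fix x col assume col: "col \<in> cols j"
      have "x col = F ?h * x col / F ?h" using elim by simp
      also have "\<dots> = (\<Sum>r\<in>{..<T} \<times> UNIV. L ?h col r / F ?h * (\<Sum>c'\<in>cols j. ?A ?h r c' * x c'))"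
        by (simp only: FL[OF col] sum_divide_distrib) simp
      also have "\<dots> = (\<Sum>(\<tau>, r)\<in>{..<T} \<times> UNIV. L ?h col (\<tau>, r) / F ?h *
          (\<Sum>col'\<in>cols j. row j \<tau> (gain v \<tau>) r col' * x col'))"
        by (intro sum.cong) (auto simp: g)
      finally show "x col = (\<Sum>(\<tau>, r)\<in>{..<T} \<times> UNIV. L ?h col (\<tau>, r) / F ?h *
          (\<Sum>col'\<in>cols j. row j \<tau> (gain v \<tau>) r col' * x col'))" .
    qed
  qed
qed

text \<open>Quantifies over all Gaussian integer vectors, so that the event depends neither on the
  alphabet nor on the power. Only the wanted part has to be nonzero: distinct wanted symbols must
  stay apart whatever interference accompanies them.\<close>

definition separated :: "real \<Rightarrow> (('j, 'k, 'm) entry \<Rightarrow> complex) \<Rightarrow> bool" where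
  "separated \<kappa> v \<longleftrightarrow> (\<forall>j. \<forall>x\<in>PiE (cols j) (\<lambda>_. gauss). (\<exists>col\<in>wanted j. x (Inl col) \<noteq> 0) \<longrightarrow>
     (\<exists>\<tau><T. \<exists>r. \<kappa> \<le> cmod (\<Sum>col\<in>cols j. row j \<tau> (gain v \<tau>) r col * x col)))"

text \<open>A single scale \<open>s\<close> governs distance and noise: at amplitude
  \<open>s^2\<close> the separation \<open>1 / s\<close> becomes \<open>s\<close>, twice the noise
  bound \<open>s / 2\<close>.\<close>

definition bad :: "real \<Rightarrow> (('j, 'k, 'm) entry \<Rightarrow> complex) set" where
  "bad s = {v \<in> space (PiM (entries T) (\<lambda>_. borel)).
     \<not> separated (1 / s) v \<or> (\<exists>\<tau><T. \<exists>j r. s / 2 \<le> cmod (v (Inr (\<tau>, j, r))))}"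

lemma row_measurable:
  assumes "\<And>p. (\<lambda>x. g x p) \<in> borel_measurable M"
  shows "(\<lambda>x. row j \<tau> (g x) r col) \<in> borel_measurable M"
  by (rule polyfun_measurable[OF polyfun_row[where f = "\<lambda>p. p"] assms])

lemma gain_measurable [measurable]:
  "\<tau> < T \<Longrightarrow> (\<lambda>v. gain v \<tau> p) \<in> borel_measurable (PiM (entries T) (\<lambda>_. borel))"
  unfolding gain_def by (intro measurable_component_singleton) (cases p, auto simp: entries_def)

lemma bad_sets [measurable]: "bad s \<in> sets (PiM (entries T) (\<lambda>_. borel))"
proof -
  let ?M = "PiM (entries T) (\<lambda>_. borel) :: (('j, 'k, 'm) entry \<Rightarrow> complex) measure"
  have c: "countable (PiE (cols j) (\<lambda>_. gauss))" for j
    by (intro countable_PiE countable_gauss) auto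
  have meas: "(\<lambda>v. \<Sum>col\<in>cols j. row j \<tau> (gain v \<tau>) r col * x col) \<in> borel_measurable ?M"
    if "\<tau> < T" for j \<tau> r x
    by (intro borel_measurable_sum borel_measurable_times row_measurable gain_measurable that
          borel_measurable_const)
  have p: "Measurable.pred ?M (\<lambda>v. \<exists>\<tau><T. \<exists>r. 1 / s \<le> cmod (\<Sum>col\<in>cols j. row j \<tau> (gain v \<tau>) r col * x col))" for j x
  proof -
    have "Measurable.pred ?M (\<lambda>v. \<exists>\<tau>\<in>{..<T}. \<exists>r\<in>UNIV. 1 / s \<le> cmod (\<Sum>col\<in>cols j. row j \<tau> (gain v \<tau>) r col * x col))"
    proof (intro pred_bex_finite finite)
      fix \<tau> r assume "\<tau> \<in> {..<T}"
      thus "Measurable.pred ?M (\<lambda>v. 1 / s \<le> cmod (\<Sum>col\<in>cols j. row j \<tau> (gain v \<tau>) r col * x col))"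
        by (intro pred_le_norm meas) simp
    qed simp
    thus ?thesis by (simp only: Bex_def lessThan_iff UNIV_I simp_thms)
  qed
  have sep: "Measurable.pred ?M (separated (1 / s))"
    unfolding separated_def
  proof (rule pred_intros_countable(1), rule pred_ball_countable[OF c])
    fix j x
    show "Measurable.pred ?M (\<lambda>v. (\<exists>col\<in>wanted j. x (Inl col) \<noteq> 0) \<longrightarrow>
        (\<exists>\<tau><T. \<exists>r. 1 / s \<le> cmod (\<Sum>col\<in>cols j. row j \<tau> (gain v \<tau>) r col * x col)))"
      by (rule pred_intros_imp') (rule p)
  qed
  have noise: "Measurable.pred ?M (\<lambda>v. \<exists>\<tau><T. \<exists>j r. s / 2 \<le> cmod (v (Inr (\<tau>, j, r))))"
  proof -
    have n1: "(\<lambda>v. v (Inr (\<tau>, j, r))) \<in> borel_measurable ?M" if "\<tau> < T" for \<tau> j r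
      using that by (intro measurable_component_singleton) (auto simp: entries_def)
    have "Measurable.pred ?M (\<lambda>v. \<exists>\<tau>\<in>{..<T}. \<exists>j\<in>UNIV. \<exists>r\<in>UNIV. s / 2 \<le> cmod (v (Inr (\<tau>, j, r))))"
    proof (intro pred_bex_finite finite)
      fix \<tau> j r assume "\<tau> \<in> {..<T}"
      thus "Measurable.pred ?M (\<lambda>v. s / 2 \<le> cmod (v (Inr (\<tau>, j, r))))"
        by (intro pred_le_norm n1) simp
    qed simp
    thus ?thesis by (simp only: Bex_def lessThan_iff UNIV_I simp_thms)
  qed
  have "Measurable.pred ?M (\<lambda>v. \<not> separated (1 / s) v \<or> (\<exists>\<tau><T. \<exists>j r. s / 2 \<le> cmod (v (Inr (\<tau>, j, r)))))"
    by (intro pred_intros_logic sep noise)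
  thus ?thesis by (simp only: bad_def pred_def)
qed

text \<open>Along \<open>s = real (Suc n)\<close> the bad sets decrease. Wherever a left inverse
  exists it bounds a nonzero integer coordinate by the received values, so almost every block leaves
  these sets; continuity from above concludes.\<close>

lemma bad_small:
  assumes "\<epsilon> > 0"
  shows "\<exists>s>0. measure (block_law T) (bad s) \<le> \<epsilon>"
proof -
  interpret B: prob_space "block_law T" by (rule prob_block_law)
  have sets_eq: "bad s \<in> sets (block_law T)" for s using bad_sets by simp
  let ?b = "\<lambda>n. bad (real (Suc n))"
  have mono: "decseq ?b"
  proof (rule decseq_SucI, rule subsetI)
    fix n v assume v: "v \<in> bad (real (Suc (Suc n)))"
    have "separated (1 / real (Suc (Suc n))) v" if "separated (1 / real (Suc n)) v"
      unfolding separated_def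
    proof (intro allI ballI impI)
      fix j x assume "x \<in> PiE (cols j) (\<lambda>_. gauss)" "\<exists>col\<in>wanted j. x (Inl col) \<noteq> 0"
      with that obtain \<tau> r where tr: "\<tau> < T"
        "1 / real (Suc n) \<le> cmod (\<Sum>col\<in>cols j. row j \<tau> (gain v \<tau>) r col * x col)"
        unfolding separated_def by (elim allE ballE impE exE conjE) auto
      have "1 / real (Suc (Suc n)) \<le> 1 / real (Suc n)" by (simp add: field_simps)
      also note tr(2)
      finally show "\<exists>\<tau><T. \<exists>r. 1 / real (Suc (Suc n)) \<le>
          cmod (\<Sum>col\<in>cols j. row j \<tau> (gain v \<tau>) r col * x col)"
        using tr(1) by (intro exI[of _ \<tau>] exI[of _ r] conjI)
    qed
    note sep = this
    have noise: "(\<exists>\<tau><T. \<exists>j r. real (Suc n) / 2 \<le> cmod (v (Inr (\<tau>, j, r))))"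
      if "(\<exists>\<tau><T. \<exists>j r. real (Suc (Suc n)) / 2 \<le> cmod (v (Inr (\<tau>, j, r))))"
    proof -
      from that obtain \<tau> j r where t: "\<tau> < T" "real (Suc (Suc n)) / 2 \<le> cmod (v (Inr (\<tau>, j, r)))"
        by (elim exE conjE)
      hence "real (Suc n) / 2 \<le> cmod (v (Inr (\<tau>, j, r)))" by simp
      thus ?thesis using t(1) by (intro exI conjI)
    qed
    have "v \<in> space (PiM (entries T) (\<lambda>_. borel))"
      "\<not> separated (1 / real (Suc (Suc n))) v \<or> (\<exists>\<tau><T. \<exists>j r. real (Suc (Suc n)) / 2 \<le> cmod (v (Inr (\<tau>, j, r))))"
      using v by (simp_all only: bad_def mem_Collect_eq)
    thus "v \<in> bad (real (Suc n))"
      unfolding bad_def mem_Collect_eq using sep noise by argo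
  qed
  have "AE v in block_law T. v \<notin> (\<Inter>n. ?b n)"
    using AE_left_inverse
  proof eventually_elim
    case (elim v)
    from choice[OF elim] obtain L where L: "\<And>j x col. col \<in> cols j \<Longrightarrow> x col = (\<Sum>(\<tau>, r)\<in>{..<T} \<times> UNIV.
      L j col (\<tau>, r) * (\<Sum>col'\<in>cols j. row j \<tau> (gain v \<tau>) r col' * x col'))" by blast
    \<comment> \<open>\<open>K1\<close> bounds the left inverses of all receivers and
      \<open>K2\<close> the noise. Once \<open>n > K1 + 2 * K2\<close>, neither
      \<open>1 \<le> K1 / (n+1)\<close> nor a noise value of size \<open>(n+1) / 2\<close> is
      possible.\<close>
    define K1 where "K1 = (\<Sum>j\<in>UNIV. \<Sum>col\<in>cols j. \<Sum>y\<in>{..<T} \<times> UNIV. cmod (L j col y))"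
    define K2 where "K2 = (\<Sum>y\<in>{..<T} \<times> UNIV \<times> UNIV. cmod (v (Inr y)))"
    obtain n where n: "K1 + 2 * K2 < real n" using reals_Archimedean2 by blast
    have K: "K1 \<ge> 0" "K2 \<ge> 0" unfolding K1_def K2_def by (auto intro!: sum_nonneg)
    have "separated (1 / real (Suc n)) v"
      unfolding separated_def
    proof (intro allI ballI impI)
      fix j x assume x: "x \<in> PiE (cols j) (\<lambda>_. gauss)" and "\<exists>col\<in>wanted j. x (Inl col) \<noteq> 0"
      then obtain col where col: "col \<in> cols j" "x col \<noteq> 0" by (auto simp: cols_def)
      show "\<exists>\<tau><T. \<exists>r. 1 / real (Suc n) \<le> cmod (\<Sum>col\<in>cols j. row j \<tau> (gain v \<tau>) r col * x col)"
      proof (rule ccontr)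
        assume "\<not> (\<exists>\<tau><T. \<exists>r. 1 / real (Suc n) \<le> cmod (\<Sum>col\<in>cols j. row j \<tau> (gain v \<tau>) r col * x col))"
        hence small: "cmod (\<Sum>col\<in>cols j. row j \<tau> (gain v \<tau>) r col * x col) \<le> 1 / real (Suc n)"
          if "\<tau> < T" for \<tau> r using that by (meson linear)
        have "1 \<le> cmod (x col)" using x col by (intro gauss_norm_ge_1) auto
        also have "\<dots> = cmod (\<Sum>(\<tau>, r)\<in>{..<T} \<times> UNIV.
            L j col (\<tau>, r) * (\<Sum>col'\<in>cols j. row j \<tau> (gain v \<tau>) r col' * x col'))"
          by (rule arg_cong[OF L[OF col(1)]])
        also have "\<dots> \<le> (\<Sum>(\<tau>, r)\<in>{..<T} \<times> UNIV. cmod (L j col (\<tau>, r)) * (1 / real (Suc n)))"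
          unfolding split_def
        proof (rule order.trans[OF norm_sum], rule sum_mono)
          fix y assume "y \<in> {..<T} \<times> (UNIV :: 'm set)"
          thus "cmod (L j col (fst y, snd y) * (\<Sum>col'\<in>cols j. row j (fst y) (gain v (fst y)) (snd y) col' * x col'))
              \<le> cmod (L j col (fst y, snd y)) * (1 / real (Suc n))"
            unfolding norm_mult by (intro mult_left_mono small) auto
        qed
        also have "\<dots> = (\<Sum>y\<in>{..<T} \<times> UNIV. cmod (L j col y)) / real (Suc n)"
          by (simp add: split_def sum_divide_distrib)
        also have "(\<Sum>y\<in>{..<T} \<times> UNIV. cmod (L j col y)) \<le> (\<Sum>col\<in>cols j. \<Sum>y\<in>{..<T} \<times> UNIV. cmod (L j col y))"
          by (rule member_le_sum[OF col(1)]) (auto intro!: sum_nonneg)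
        also have "\<dots> \<le> K1"
          unfolding K1_def by (rule member_le_sum) (auto intro!: sum_nonneg)
        finally have "1 \<le> K1 / real (Suc n)" by (simp add: divide_right_mono)
        thus False using n K by (simp add: field_simps)
      qed
    qed
    moreover have "\<not> real (Suc n) / 2 \<le> cmod (v (Inr (\<tau>, j, r)))" if "\<tau> < T" for \<tau> j r
    proof -
      have "cmod (v (Inr (\<tau>, j, r))) \<le> K2"
        unfolding K2_def using that by (intro member_le_sum) auto
      thus ?thesis using n K by simp
    qed
    ultimately have "v \<notin> ?b n" by (auto simp: bad_def)
    thus ?case by blast
  qed
  moreover have "(\<Inter>n. ?b n) \<in> sets (block_law T)"
    using sets_eq by (intro sets.countable_INT) auto
  ultimately have "measure (block_law T) (\<Inter>n. ?b n) = 0"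
    by (simp only: B.prob_eq_0)
  moreover have "(\<lambda>n. measure (block_law T) (?b n)) \<longlonglongrightarrow> measure (block_law T) (\<Inter>n. ?b n)"
    using sets_eq by (intro B.finite_Lim_measure_decseq mono) auto
  ultimately have "(\<lambda>n. measure (block_law T) (?b n)) \<longlonglongrightarrow> 0" by (simp only:)
  from order_tendstoD(2)[OF this assms]
  have "\<forall>\<^sub>F n in sequentially. measure (block_law T) (?b n) < \<epsilon>" .
  then obtain n where "measure (block_law T) (?b n) < \<epsilon>"
    by (auto simp: eventually_sequentially)
  thus ?thesis by (intro exI[of _ "real (Suc n)"]) simp
qed

end

section \<open>The concatenated code\<close>

text \<open>Decoders pick their output by \<open>SOME\<close>, but the choice depends only on which
  of finitely many measurable tests succeed, and any function of this finite pattern is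
  measurable.\<close>

lemma measurable_finite_decision:
  assumes fin: "finite I" and P: "\<And>i. i \<in> I \<Longrightarrow> Measurable.pred M (P i)"
  shows "(\<lambda>x. f {i \<in> I. P i x}) \<in> M \<rightarrow>\<^sub>M count_space UNIV"
proof -
  have "(\<lambda>x. {i \<in> I. P i x}) \<in> M \<rightarrow>\<^sub>M count_space (Pow I)"
  proof (subst measurable_count_space_eq2)
    have "(\<lambda>x. {i \<in> I. P i x}) -` {S} \<inter> space M \<in> sets M" if "S \<in> Pow I" for S
    proof -
      have "(\<lambda>x. {i \<in> I. P i x}) -` {S} \<inter> space M = {x \<in> space M. \<forall>i\<in>I. P i x = (i \<in> S)}"
        using that by auto
      moreover have "Measurable.pred M (\<lambda>x. \<forall>i\<in>I. P i x = (i \<in> S))"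
        using P by (intro pred_ball_countable countable_finite fin) auto
      ultimately show ?thesis by (simp add: pred_def)
    qed
    thus "(\<lambda>x. {i \<in> I. P i x}) \<in> space M \<rightarrow> Pow I \<and>
        (\<forall>a\<in>Pow I. (\<lambda>x. {i \<in> I. P i x}) -` {a} \<inter> space M \<in> sets M)"
      by auto
  qed (use fin in auto)
  thus ?thesis by (rule measurable_compose) simp
qed

lemma pred_bex_countable:
  assumes "countable I" and "\<And>i. i \<in> I \<Longrightarrow> Measurable.pred M (P i)"
  shows "Measurable.pred M (\<lambda>x. \<exists>i\<in>I. P i x)"
  using assms by (simp add: pred_intros_countable_bounded)

text \<open>A \<open>q\<close> by \<open>q\<close> square of Gaussian integers: with
  \<open>q\<close> of order \<open>sqrt P\<close> a symbol carries about \<open>log 2 P\<close>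
  bits.\<close>

definition alphabet :: "nat \<Rightarrow> complex set" where
  "alphabet q = (\<lambda>(a, b). Complex (real a) (real b)) ` ({..<q} \<times> {..<q})"

lemma finite_alphabet [simp, intro]: "finite (alphabet q)"
  by (simp add: alphabet_def)

lemma card_alphabet: "card (alphabet q) = q\<^sup>2"
  unfolding alphabet_def
  by (subst card_image) (auto simp: inj_on_def card_cartesian_product power2_eq_square)

lemma alphabet_gauss: "alphabet q \<subseteq> gauss"
  by (auto simp: alphabet_def gauss_def)

lemma alphabet_norm: "x \<in> alphabet q \<Longrightarrow> cmod x \<le> 2 * real q"
proof -
  assume "x \<in> alphabet q"
  then obtain a b where x: "x = Complex (real a) (real b)" "a < q" "b < q"
    by (auto simp: alphabet_def)
  have "cmod x \<le> \<bar>Re x\<bar> + \<bar>Im x\<bar>" by (rule cmod_le)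
  thus ?thesis using x by simp
qed

definition chan :: "('j, 'k, 'm) channel_state \<Rightarrow> 'j::finite \<times> 'k::finite \<times> 'm::finite \<times> 'm \<Rightarrow> complex" where
  "chan S = (\<lambda>(j, k, r, c). S $ j $ k $ r $ c)"

lemma chan_measurable:
  assumes "f \<in> borel_measurable M"
  shows "(\<lambda>x. chan (f x) p) \<in> borel_measurable M"
  using assms by (cases p) (simp add: chan_def)

context coded_channel
begin

text \<open>A letter of the outer code consists of all symbols that transmitter \<open>k\<close>
  sends in one block.\<close>

definition letters :: "nat \<Rightarrow> 'k \<Rightarrow> ('m \<times> nat \<times> ('j \<times> 'k \<times> 'm \<times> 'm \<Rightarrow> nat) \<Rightarrow> complex) set" where
  "letters q k = PiE (streams k) (\<lambda>_. alphabet q)"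

lemma finite_letters [simp, intro]: "finite (letters q k)"
  unfolding letters_def by (intro finite_PiE) auto

lemma card_letters: "card (letters q k) = q ^ (2 * card (streams k))"
  unfolding letters_def by (subst card_PiE) (simp_all add: card_alphabet power_mult)

text \<open>Letter \<open>t div T\<close> of the codeword is modulated at offset
  \<open>t mod T\<close>. Times from \<open>B * T\<close> on do not fill a block and stay
  silent.\<close>

definition enc where
  "enc s B cw k w st t = (\<chi> c. if t < B * T then of_real (s\<^sup>2) *
     (\<Sum>(l, \<alpha>)\<in>{..<m k} \<times> degs N. seed (t mod T) l * mon \<alpha> (chan (st t)) * cw k w (t div T) (c, l, \<alpha>))
     else 0)"

text \<open>The interference symbols range over all Gaussian integers, since the receiver knows no
  more about them; a candidate explains the received block up to the noise bound.\<close>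

definition candidate where
  "candidate s j b x y st \<longleftrightarrow> (\<exists>X\<in>PiE (cols j) (\<lambda>_. gauss).
     (\<forall>k\<in>demand j. \<forall>z\<in>streams k. X (Inl (k, z)) = x k z) \<and>
     (\<forall>\<tau>\<in>{..<T}. \<forall>r\<in>UNIV. cmod (y (b * T + \<tau>) $ r - of_real (s\<^sup>2) *
        (\<Sum>col\<in>cols j. row j \<tau> (chan (st (b * T + \<tau>))) r col * X col)) < s / 2))"

definition hard where
  "hard q j D b = (SOME x. x \<in> PiE (demand j) (letters q) \<and> (b, x) \<in> D)"

definition decide where
  "decide q B err num cw j k D =
     (SOME w. w < num k \<and> card {b \<in> {..<B::nat}. hard q j D b k \<noteq> cw k w b} \<le> err)"

definition dec where
  "dec s q B err num cw j k y st = decide q B err num cw j k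
     {(b, x) \<in> {..<B} \<times> PiE (demand j) (letters q). candidate s j b x y st}"

definition the_code where
  "the_code s q B err num cw = \<lparr>num_msgs = num, encode = enc s B cw, decode = dec s q B err num cw\<rparr>"

lemma mon_measurable:
  assumes "\<And>p. (\<lambda>x. g x p) \<in> borel_measurable M"
  shows "(\<lambda>x. mon \<alpha> (g x)) \<in> borel_measurable M"
  by (rule polyfun_measurable[OF polyfun_mon[where f = "\<lambda>p. p"] assms])

lemma measurable_the_code:
  assumes n: "B * T \<le> n"
  shows "measurable_code n (the_code s q B err num cw)"
  unfolding measurable_code_def
proof (intro conjI allI impI)
  fix k w t assume t: "t < n"
  have "(\<lambda>st. st t) \<in> borel_measurable (PiM {..<n} (\<lambda>_. borel :: ('j, 'k, 'm) channel_state measure))"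
    using t by (intro measurable_component_singleton) simp
  note ch = chan_measurable[OF this]
  show "(\<lambda>st. encode (the_code s q B err num cw) k w st t) \<in> borel_measurable (PiM {..<n} (\<lambda>_. borel))"
    unfolding the_code_def enc_def block_code.simps
  proof (rule borel_measurable_vec_lambda)
    fix c
    show "(\<lambda>st. if t < B * T then of_real (s\<^sup>2) *
        (\<Sum>(l, \<alpha>)\<in>{..<m k} \<times> degs N. seed (t mod T) l * mon \<alpha> (chan (st t)) * cw k w (t div T) (c, l, \<alpha>))
        else 0) \<in> borel_measurable (PiM {..<n} (\<lambda>_. borel :: ('j, 'k, 'm) channel_state measure))"
      unfolding split_def
      by (cases "t < B * T") (auto intro!: borel_measurable_times borel_measurable_sum mon_measurable ch)
  qed
next
  fix j k
  let ?M = "PiM {..<n} (\<lambda>_. borel :: (complex ^ 'm) measure) \<Otimes>\<^sub>M PiM {..<n} (\<lambda>_. borel :: ('j, 'k, 'm) channel_state measure)"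
  have "(\<lambda>p. decide q B err num cw j k
      {i \<in> {..<B} \<times> PiE (demand j) (letters q). candidate s j (fst i) (snd i) (fst p) (snd p)})
      \<in> ?M \<rightarrow>\<^sub>M count_space UNIV"
  proof (rule measurable_finite_decision)
    show "finite ({..<B} \<times> PiE (demand j) (letters q))" by (auto intro!: finite_PiE)
    fix i assume i: "i \<in> {..<B} \<times> PiE (demand j) (letters q)"
    have c: "countable (PiE (cols j) (\<lambda>_. gauss))"
      by (intro countable_PiE countable_gauss) auto
    have lt: "fst i * T + \<tau> < n" if "\<tau> < T" for \<tau>
    proof -
      have "fst i * T + \<tau> < Suc (fst i) * T" using that by simp
      also have "\<dots> \<le> B * T" using i by (intro mult_right_mono) auto
      finally show ?thesis using n by simp
    qed
    have f: "(\<lambda>p. fst p (fst i * T + \<tau>) $ r - of_real (s\<^sup>2) *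
        (\<Sum>col\<in>cols j. row j \<tau> (chan (snd p (fst i * T + \<tau>))) r col * X col)) \<in> borel_measurable ?M"
      if "\<tau> < T" for \<tau> r X
    proof -
      have "(\<lambda>y. y (fst i * T + \<tau>)) \<in> borel_measurable (PiM {..<n} (\<lambda>_. borel :: (complex ^ 'm) measure))"
        using lt[OF that] by (intro measurable_component_singleton) simp
      from measurable_compose[OF measurable_fst this]
      have y: "(\<lambda>p. fst p (fst i * T + \<tau>)) \<in> borel_measurable ?M" .
      have "(\<lambda>st. st (fst i * T + \<tau>)) \<in> borel_measurable (PiM {..<n} (\<lambda>_. borel :: ('j, 'k, 'm) channel_state measure))"
        using lt[OF that] by (intro measurable_component_singleton) simp
      from measurable_compose[OF measurable_snd this]
      have st: "(\<lambda>p. snd p (fst i * T + \<tau>)) \<in> borel_measurable ?M" .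
      show ?thesis
        by (intro borel_measurable_diff borel_measurable_vec_nth y borel_measurable_times
            borel_measurable_sum borel_measurable_const row_measurable chan_measurable st)
    qed
    have lt_pred: "Measurable.pred ?M (\<lambda>p. cmod (g p) < a)" if "g \<in> borel_measurable ?M"
      for g :: "_ \<Rightarrow> complex" and a
      using that by measurable
    have "Measurable.pred ?M (\<lambda>p. \<exists>X\<in>PiE (cols j) (\<lambda>_. gauss).
      (\<forall>k\<in>demand j. \<forall>z\<in>streams k. X (Inl (k, z)) = snd i k z) \<and>
     (\<forall>\<tau>\<in>{..<T}. \<forall>r\<in>UNIV. cmod (fst p (fst i * T + \<tau>) $ r - of_real (s\<^sup>2) *
        (\<Sum>col\<in>cols j. row j \<tau> (chan (snd p (fst i * T + \<tau>))) r col * X col)) < s / 2))"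
      by (intro pred_bex_countable c pred_intros_conj1' pred_ball_countable countable_finite finite
          finite_lessThan lt_pred f) auto
    thus "Measurable.pred ?M (\<lambda>p. candidate s j (fst i) (snd i) (fst p) (snd p))"
      by (simp only: candidate_def)
  qed
  thus "(\<lambda>(y, st). decode (the_code s q B err num cw) j k y st) \<in> ?M \<rightarrow>\<^sub>M count_space UNIV"
    by (simp add: the_code_def dec_def split_def mem_Times_iff conj_assoc)
qed

lemma gain_block: "\<tau> < T \<Longrightarrow> gain (block T b \<omega>) \<tau> = chan (H (b * T + \<tau>) \<omega>)"
  by (rule ext) (auto simp: gain_def block_def entries_def chan_def split_def)

lemma received_the_code:
  assumes n: "B * T \<le> n" and b: "b < B" and \<tau>: "\<tau> < T"
  shows "received_block H Z n (the_code s q B err num cw) w j \<omega> (b * T + \<tau>) $ r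
     = of_real (s\<^sup>2) * (\<Sum>col\<in>cols j. row j \<tau> (chan (H (b * T + \<tau>) \<omega>)) r col *
         symbols j (\<lambda>k. cw k (w k) b) col) + Z (b * T + \<tau>) \<omega> $ j $ r"
    and "b * T + \<tau> < n"
proof -
  let ?t = "b * T + \<tau>"
  have "?t < Suc b * T" using \<tau> by simp
  also have "\<dots> \<le> B * T" using b by (intro mult_right_mono) auto
  finally have tB: "?t < B * T" .
  thus tn: "?t < n" using n by simp
  have div: "?t div T = b" "?t mod T = \<tau>" using \<tau> by simp_all
  have "received_block H Z n (the_code s q B err num cw) w j \<omega> ?t $ r
     = (\<Sum>k\<in>UNIV. \<Sum>c\<in>UNIV. H ?t \<omega> $ j $ k $ r $ c * (of_real (s\<^sup>2) *
        (\<Sum>(l, \<alpha>)\<in>{..<m k} \<times> degs N. seed \<tau> l * mon \<alpha> (chan (H ?t \<omega>)) * cw k (w k) b (c, l, \<alpha>))))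
        + Z ?t \<omega> $ j $ r"
    using tn tB by (simp add: received_block_def the_code_def enc_def state_block_def matrix_vector_mult_def div \<tau>)
  also have "(\<Sum>k\<in>UNIV. \<Sum>c\<in>UNIV. H ?t \<omega> $ j $ k $ r $ c * (of_real (s\<^sup>2) *
        (\<Sum>(l, \<alpha>)\<in>{..<m k} \<times> degs N. seed \<tau> l * mon \<alpha> (chan (H ?t \<omega>)) * cw k (w k) b (c, l, \<alpha>))))
     = of_real (s\<^sup>2) * (\<Sum>k\<in>UNIV. \<Sum>c\<in>UNIV. chan (H ?t \<omega>) (j, k, r, c) *
        (\<Sum>(l, \<alpha>)\<in>{..<m k} \<times> degs N. seed \<tau> l * mon \<alpha> (chan (H ?t \<omega>)) * cw k (w k) b (c, l, \<alpha>)))"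
    by (simp only: sum_distrib_left mult.left_commute[of "of_real (s\<^sup>2)"]) (simp add: chan_def mult_ac)
  also have "\<dots> = of_real (s\<^sup>2) * (\<Sum>col\<in>cols j. row j \<tau> (chan (H ?t \<omega>)) r col *
         symbols j (\<lambda>k. cw k (w k) b) col)"
    by (subst alignment) (rule refl)
  finally show "received_block H Z n (the_code s q B err num cw) w j \<omega> ?t $ r
     = of_real (s\<^sup>2) * (\<Sum>col\<in>cols j. row j \<tau> (chan (H ?t \<omega>)) r col *
         symbols j (\<lambda>k. cw k (w k) b) col) + Z ?t \<omega> $ j $ r" .
qed

text \<open>Two explanations of one block differ by a Gaussian integer vector with nonzero wanted
  part. Outside \<open>bad s\<close> its image, scaled by \<open>s^2\<close>, has modulus at least
  \<open>s\<close> somewhere, more than two noise terms below \<open>s / 2\<close> can bridge; the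
  true symbols do pass the test.\<close>

lemma hard_decision:
  assumes n: "B * T \<le> n" and b: "b < B" and s: "s > 0"
    and cw: "\<And>k. cw k (w k) b \<in> letters q k" and good: "block T b \<omega> \<notin> bad s"
  shows "hard q j {(b, x) \<in> {..<B} \<times> PiE (demand j) (letters q). candidate s j b x
       (received_block H Z n (the_code s q B err num cw) w j \<omega>) (state_block H n \<omega>)} b
     = (\<lambda>k\<in>demand j. cw k (w k) b)"
proof -
  let ?y = "received_block H Z n (the_code s q B err num cw) w j \<omega>"
  let ?\<sigma> = "\<lambda>k. cw k (w k) b"
  let ?x = "\<lambda>k\<in>demand j. ?\<sigma> k"
  let ?X = "restrict (symbols j ?\<sigma>) (cols j)"
  let ?R = "\<lambda>\<tau> r X. \<Sum>col\<in>cols j. row j \<tau> (chan (H (b * T + \<tau>) \<omega>)) r col * X col"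
  have st: "state_block H n \<omega> (b * T + \<tau>) = H (b * T + \<tau>) \<omega>" if "\<tau> < T" for \<tau>
    using received_the_code(2)[OF n b that] by (simp add: state_block_def)
  have y: "?y (b * T + \<tau>) $ r = of_real (s\<^sup>2) * ?R \<tau> r ?X + Z (b * T + \<tau>) \<omega> $ j $ r" if "\<tau> < T" for \<tau> r
    by (subst received_the_code(1)[OF n b that]) simp
  have gs: "?\<sigma> k z \<in> gauss" if "z \<in> streams k" for k z
    using cw[of k] that alphabet_gauss by (auto simp: letters_def PiE_iff)
  have X: "?X \<in> PiE (cols j) (\<lambda>_. gauss)"
  proof (intro restrict_PiE_iff[THEN iffD2] ballI)
    fix col assume "col \<in> cols j"
    thus "symbols j ?\<sigma> col \<in> gauss"
      by (auto simp: cols_def wanted_def symbols_def interferers_def split_def intro!: gs gauss_sum)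
  qed
  have "block T b \<omega> \<in> space (PiM (entries T) (\<lambda>_. borel))"
    by (simp add: block_def space_PiM)
  hence sep: "separated (1 / s) (block T b \<omega>)" and noise: "cmod (Z (b * T + \<tau>) \<omega> $ j $ r) < s / 2"
    if "\<tau> < T" for \<tau> r
    using good that unfolding bad_def by (auto simp: not_le block_def entries_def)
  have unique: "x = ?x" if x: "x \<in> PiE (demand j) (letters q)" and cand: "candidate s j b x ?y (state_block H n \<omega>)" for x
  proof (rule ccontr)
    assume ne: "x \<noteq> ?x"
    obtain X' where X': "X' \<in> PiE (cols j) (\<lambda>_. gauss)"
      and xX': "\<And>k z. k \<in> demand j \<Longrightarrow> z \<in> streams k \<Longrightarrow> X' (Inl (k, z)) = x k z"
      and close: "\<And>\<tau> r. \<tau> < T \<Longrightarrow> cmod (?y (b * T + \<tau>) $ r - of_real (s\<^sup>2) *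
        (\<Sum>col\<in>cols j. row j \<tau> (chan (state_block H n \<omega> (b * T + \<tau>))) r col * X' col)) < s / 2"
      using cand unfolding candidate_def by auto
    obtain k where k: "k \<in> demand j" "x k \<noteq> ?\<sigma> k"
      using ne x extensionalityI[of x "demand j" ?x] by (auto simp: PiE_iff)
    have "x k \<in> letters q k" using x k by auto
    then obtain z where z: "z \<in> streams k" "x k z \<noteq> ?\<sigma> k z"
      using k(2) cw[of k] extensionalityI[of "x k" "streams k" "?\<sigma> k"] by (auto simp: letters_def PiE_iff)
    let ?D = "\<lambda>col\<in>cols j. ?X col - X' col"
    have "?D \<in> PiE (cols j) (\<lambda>_. gauss)"
      using X X' by (auto intro!: gauss_diff simp: PiE_iff)
    moreover have kz: "(k, z) \<in> wanted j" using k z by (auto simp: wanted_def)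
    hence "?D (Inl (k, z)) \<noteq> 0"
      using z xX'[OF k(1) z(1)] by (auto simp: cols_def symbols_def)
    ultimately obtain \<tau> r where \<tau>: "\<tau> < T" and ge: "1 / s \<le> cmod (\<Sum>col\<in>cols j. row j \<tau> (gain (block T b \<omega>) \<tau>) r col * ?D col)"
      using sep[OF T_pos] kz unfolding separated_def by meson
    have "(\<Sum>col\<in>cols j. row j \<tau> (gain (block T b \<omega>) \<tau>) r col * ?D col) = ?R \<tau> r ?X - ?R \<tau> r X'"
      by (simp add: gain_block[OF \<tau>] sum_subtractf[symmetric] right_diff_distrib)
    hence "s\<^sup>2 * (1 / s) \<le> s\<^sup>2 * cmod (?R \<tau> r ?X - ?R \<tau> r X')"
      using ge by (intro mult_left_mono) auto
    also have "\<dots> = cmod (of_real (s\<^sup>2) * ?R \<tau> r ?X - of_real (s\<^sup>2) * ?R \<tau> r X')"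
      by (simp only: right_diff_distrib[symmetric] norm_mult norm_of_real) simp
    also have "\<dots> = cmod ((?y (b * T + \<tau>) $ r - of_real (s\<^sup>2) * ?R \<tau> r X') - Z (b * T + \<tau>) \<omega> $ j $ r)"
      by (simp only: y[OF \<tau>]) (simp add: algebra_simps)
    also have "\<dots> \<le> cmod (?y (b * T + \<tau>) $ r - of_real (s\<^sup>2) * ?R \<tau> r X') + cmod (Z (b * T + \<tau>) \<omega> $ j $ r)"
      by (rule norm_triangle_ineq4)
    also have "\<dots> < s / 2 + s / 2"
      using close[OF \<tau>, of r] noise[OF \<tau>, of r] unfolding st[OF \<tau>] by linarith
    finally show False using s by (simp add: power2_eq_square)
  qed
  have "candidate s j b ?x ?y (state_block H n \<omega>)"
    unfolding candidate_def
  proof (intro bexI[OF _ X] conjI ballI)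
    fix k z assume "k \<in> demand j" "z \<in> streams k"
    thus "?X (Inl (k, z)) = ?x k z" by (auto simp: cols_def wanted_def symbols_def)
  next
    fix \<tau> r assume "\<tau> \<in> {..<T}"
    hence \<tau>: "\<tau> < T" by simp
    show "cmod (?y (b * T + \<tau>) $ r - of_real (s\<^sup>2) *
        (\<Sum>col\<in>cols j. row j \<tau> (chan (state_block H n \<omega> (b * T + \<tau>))) r col * ?X col)) < s / 2"
      unfolding st[OF \<tau>] y[OF \<tau>] using noise[OF \<tau>, of r] by simp
  qed
  moreover have "?x \<in> PiE (demand j) (letters q)" using cw by auto
  ultimately show ?thesis
    unfolding hard_def using b unique by (intro some_equality) auto
qed

text \<open>Badness of a block concerns channel and noise only and covers all receivers at once, so
  good blocks are decided correctly everywhere. The at most \<open>err\<close> wrong letters lie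
  within half of the code distance.\<close>

lemma decode_correct:
  assumes n: "B * T \<le> n" and s: "s > 0"
    and cw: "\<And>k u. u < num k \<Longrightarrow> cw k u \<in> PiE {..<B} (\<lambda>_. letters q k)"
    and dist: "\<And>k u u'. u < num k \<Longrightarrow> u' < num k \<Longrightarrow> u \<noteq> u' \<Longrightarrow> 2 * err < card {b \<in> {..<B}. cw k u b \<noteq> cw k u' b}"
    and w: "\<And>k. w k < num k" and few: "card {b \<in> {..<B}. block T b \<omega> \<in> bad s} \<le> err" and k: "k \<in> demand j"
  shows "decode (the_code s q B err num cw) j k
      (received_block H Z n (the_code s q B err num cw) w j \<omega>) (state_block H n \<omega>) = w k"
proof -
  let ?D = "{(b, x) \<in> {..<B} \<times> PiE (demand j) (letters q). candidate s j b x
       (received_block H Z n (the_code s q B err num cw) w j \<omega>) (state_block H n \<omega>)}"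
  have "{b \<in> {..<B}. hard q j ?D b k \<noteq> cw k (w k) b} \<subseteq> {b \<in> {..<B}. block T b \<omega> \<in> bad s}"
  proof (rule subsetI, rule ccontr)
    fix b assume b: "b \<in> {b \<in> {..<B}. hard q j ?D b k \<noteq> cw k (w k) b}" "b \<notin> {b \<in> {..<B}. block T b \<omega> \<in> bad s}"
    have "hard q j ?D b = (\<lambda>k\<in>demand j. cw k (w k) b)"
      using b cw w by (intro hard_decision n s) auto
    thus False using b k by simp
  qed
  hence "card {b \<in> {..<B}. hard q j ?D b k \<noteq> cw k (w k) b} \<le> card {b \<in> {..<B}. block T b \<omega> \<in> bad s}"
    by (intro card_mono) auto
  hence close: "card {b \<in> {..<B}. hard q j ?D b k \<noteq> cw k (w k) b} \<le> err" using few by simp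
  have "decide q B err num cw j k ?D = w k"
    unfolding decide_def
  proof (rule some_equality)
    fix u assume u: "u < num k \<and> card {b \<in> {..<B}. hard q j ?D b k \<noteq> cw k u b} \<le> err"
    show "u = w k"
      using u dist[of "w k" k u] w[of k] hamming_unique[OF _ close, of "cw k u"] by fastforce
  qed (use close w in auto)
  thus ?thesis by (simp add: the_code_def dec_def)
qed

text \<open>The event of too many bad blocks does not depend on the messages, so its probability
  bounds every term of the average.\<close>

lemma error_prob_the_code:
  assumes n: "B * T \<le> n" and s: "s > 0" and \<epsilon>: "\<epsilon> > 0" "measure (block_law T) (bad s) \<le> \<epsilon>"
    and cw: "\<And>k u. u < num k \<Longrightarrow> cw k u \<in> PiE {..<B} (\<lambda>_. letters q k)"
    and dist: "\<And>k u u'. u < num k \<Longrightarrow> u' < num k \<Longrightarrow> u \<noteq> u' \<Longrightarrow>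
        2 * nat \<lfloor>2 * \<epsilon> * real B\<rfloor> < card {b \<in> {..<B}. cw k u b \<noteq> cw k u' b}"
  shows "error_prob \<Omega> H Z demand n (the_code s q B (nat \<lfloor>2 * \<epsilon> * real B\<rfloor>) num cw) \<le> exp (- 2 * \<epsilon>\<^sup>2 * real B)"
proof -
  let ?err = "nat \<lfloor>2 * \<epsilon> * real B\<rfloor>"
  let ?c = "the_code s q B ?err num cw"
  let ?bad = "{\<omega> \<in> space \<Omega>. 2 * \<epsilon> * real B \<le> real (card {b \<in> {..<B}. block T b \<omega> \<in> bad s})}"
  have rv [measurable]: "block T b \<in> \<Omega> \<rightarrow>\<^sub>M PiM (entries T) (\<lambda>_. borel)" for b
    using indep_blocks[of T] by (simp add: indep_vars_def)
  have bad_ev: "?bad \<in> events"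
  proof -
    have "real (card {b \<in> {..<B}. block T b \<omega> \<in> bad s}) = (\<Sum>b<B. indicator (bad s) (block T b \<omega>))" for \<omega>
      by (simp add: indicator_def sum.If_cases Int_def conj_commute)
    thus ?thesis by simp
  qed
  have one: "measure \<Omega> {\<omega> \<in> space \<Omega>. \<exists>j. \<exists>k\<in>demand j.
          decode ?c j k (received_block H Z n ?c w j \<omega>) (state_block H n \<omega>) \<noteq> w k} \<le> exp (- 2 * \<epsilon>\<^sup>2 * real B)"
    if w: "w \<in> PiE UNIV (\<lambda>k. {..<num k})" for w
  proof -
    have "{\<omega> \<in> space \<Omega>. \<exists>j. \<exists>k\<in>demand j.
          decode ?c j k (received_block H Z n ?c w j \<omega>) (state_block H n \<omega>) \<noteq> w k} \<subseteq> ?bad"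
    proof (rule subsetI, rule ccontr)
      fix \<omega> assume \<omega>: "\<omega> \<in> {\<omega> \<in> space \<Omega>. \<exists>j. \<exists>k\<in>demand j.
          decode ?c j k (received_block H Z n ?c w j \<omega>) (state_block H n \<omega>) \<noteq> w k}" "\<omega> \<notin> ?bad"
      have "real (card {b \<in> {..<B}. block T b \<omega> \<in> bad s}) \<le> 2 * \<epsilon> * real B" using \<omega> by auto
      hence few: "card {b \<in> {..<B}. block T b \<omega> \<in> bad s} \<le> ?err" by (simp add: le_nat_floor)
      have wk: "w k < num k" for k using w by auto
      have "\<And>j k. k \<in> demand j \<Longrightarrow> decode ?c j k (received_block H Z n ?c w j \<omega>) (state_block H n \<omega>) = w k"
        by (rule decode_correct[OF n s cw dist wk few])
      thus False using \<omega> by blast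
    qed
    hence "measure \<Omega> {\<omega> \<in> space \<Omega>. \<exists>j. \<exists>k\<in>demand j.
          decode ?c j k (received_block H Z n ?c w j \<omega>) (state_block H n \<omega>) \<noteq> w k} \<le> measure \<Omega> ?bad"
      by (rule finite_measure_mono[OF _ bad_ev])
    also have "\<dots> \<le> exp (- 2 * \<epsilon>\<^sup>2 * real B)"
      by (rule many_bad_events[OF indep_blocks distr_block bad_sets \<epsilon>(2,1)])
    finally show ?thesis .
  qed
  have "error_prob \<Omega> H Z demand n ?c \<le>
      (\<Sum>w\<in>(\<Pi>\<^sub>E k\<in>UNIV. {..<num k}). exp (- 2 * \<epsilon>\<^sup>2 * real B)) / real (\<Prod>k\<in>UNIV. num k)"
    unfolding error_prob_def
    by (simp only: the_code_def block_code.simps)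
       (intro divide_right_mono sum_mono one[unfolded the_code_def block_code.simps] of_nat_0_le_iff, auto)
  also have "\<dots> \<le> exp (- 2 * \<epsilon>\<^sup>2 * real B)"
    by (simp add: card_PiE)
  finally show ?thesis .
qed

end

section \<open>Achievable rates\<close>

context coded_channel
begin

text \<open>The monomials are bounded on bounded channels and the seeds over the finitely many
  offsets of a block; the resulting constant does not involve the alphabet.\<close>

lemma beam_bound:
  "\<exists>C\<ge>0. \<forall>\<tau><T. \<forall>k g. (\<forall>p. cmod (g p) \<le> hmax) \<longrightarrow>
     (\<Sum>(l, \<alpha>)\<in>{..<m k} \<times> degs N. cmod (seed \<tau> l * mon \<alpha> g)) \<le> C"
proof -
  have "\<forall>\<alpha>. \<exists>C. \<forall>g. (\<forall>p. cmod (g p) \<le> hmax) \<longrightarrow> cmod (mon \<alpha> g) \<le> C"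
    using polyfun_bounded[OF polyfun_mon[where f = "\<lambda>p. p"], of hmax] by blast
  from choice[OF this] obtain C where C: "\<And>\<alpha> g. (\<forall>p. cmod (g p) \<le> hmax) \<Longrightarrow> cmod (mon \<alpha> g) \<le> C \<alpha>"
    by blast
  let ?f = "\<lambda>\<tau> k. \<Sum>(l, \<alpha>)\<in>{..<m k} \<times> degs N. cmod (seed \<tau> l) * max 0 (C \<alpha>)"
  have nonneg: "?f \<tau> k \<ge> 0" for \<tau> k
    by (rule sum_nonneg) auto
  show ?thesis
  proof (intro exI[of _ "\<Sum>\<tau><T. \<Sum>k\<in>UNIV. ?f \<tau> k"] conjI allI impI)
    show "0 \<le> (\<Sum>\<tau><T. \<Sum>k\<in>UNIV. ?f \<tau> k)" by (intro sum_nonneg nonneg)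
    fix \<tau> k and g :: "'j \<times> 'k \<times> 'm \<times> 'm \<Rightarrow> complex" assume \<tau>: "\<tau> < T" and g: "\<forall>p. cmod (g p) \<le> hmax"
    have "(\<Sum>(l, \<alpha>)\<in>{..<m k} \<times> degs N. cmod (seed \<tau> l * mon \<alpha> g)) \<le> ?f \<tau> k"
      unfolding split_def norm_mult
      by (intro sum_mono mult_left_mono) (auto intro: order.trans[OF C[OF g]])
    also have "\<dots> \<le> (\<Sum>k\<in>UNIV. ?f \<tau> k)"
      by (rule member_le_sum[of k UNIV "?f \<tau>"]) (simp_all only: nonneg UNIV_I finite)
    also have "\<dots> \<le> (\<Sum>\<tau><T. \<Sum>k\<in>UNIV. ?f \<tau> k)"
      using \<tau> by (intro member_le_sum[of \<tau> "{..<T}" "\<lambda>\<tau>. \<Sum>k\<in>UNIV. ?f \<tau> k"] sum_nonneg nonneg) auto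
    finally show "(\<Sum>(l, \<alpha>)\<in>{..<m k} \<times> degs N. cmod (seed \<tau> l * mon \<alpha> g)) \<le> (\<Sum>\<tau><T. \<Sum>k\<in>UNIV. ?f \<tau> k)" .
  qed
qed

text \<open>\<open>K\<close> depends on the beams but not on \<open>s\<close>, \<open>q\<close> or
  the codebooks. With \<open>s\<close> held fixed, \<open>q\<close> may therefore grow like the
  square root of the power. The bound holds for every message almost surely, hence for the
  mean.\<close>

lemma power_the_code:
  "\<exists>K>0. \<forall>s q B err num cw n P. 0 < s \<longrightarrow> (\<forall>k. \<forall>u<num k. cw k u \<in> PiE {..<B} (\<lambda>_. letters q k)) \<longrightarrow>
     (K * s\<^sup>2 * real q)\<^sup>2 \<le> P \<longrightarrow> power_constraint \<Omega> H n (the_code s q B err num cw) P"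
proof -
  obtain C where C0: "C \<ge> 0" and C: "\<And>\<tau> k g. \<tau> < T \<Longrightarrow> (\<And>p. cmod (g p) \<le> hmax) \<Longrightarrow>
      (\<Sum>(l, \<alpha>)\<in>{..<m k} \<times> degs N. cmod (seed \<tau> l * mon \<alpha> g)) \<le> C"
    using beam_bound by blast
  define K where "K = real CARD('m) * (C * 2) + 1"
  have K: "K > 0" unfolding K_def using C0 by (intro add_nonneg_pos mult_nonneg_nonneg) auto
  show ?thesis
  proof (intro exI[of _ K] conjI allI impI K)
    fix s :: real and q B err n :: nat and num :: "'k \<Rightarrow> nat" and P :: real
      and cw :: "'k \<Rightarrow> nat \<Rightarrow> nat \<Rightarrow> 'm \<times> nat \<times> ('j \<times> 'k \<times> 'm \<times> 'm \<Rightarrow> nat) \<Rightarrow> complex"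
    assume s: "0 < s" and cw: "\<forall>k. \<forall>u<num k. cw k u \<in> PiE {..<B} (\<lambda>_. letters q k)"
      and P: "(K * s\<^sup>2 * real q)\<^sup>2 \<le> P"
    have entry: "cmod (enc s B cw k u st t $ c) \<le> s\<^sup>2 * (C * (2 * real q))"
      if u: "u < num k" and st: "\<And>p. cmod (chan (st t) p) \<le> hmax" for k u st t c
    proof (cases "t < B * T")
      case True
      hence b: "t div T < B" and \<tau>: "t mod T < T"
        using T_pos by (auto simp: less_mult_imp_div_less)
      have "cw k u (t div T) \<in> letters q k" using cw u b by auto
      hence sym: "cmod (cw k u (t div T) z) \<le> 2 * real q" if "z \<in> streams k" for z
        using that by (intro alphabet_norm) (auto simp: letters_def PiE_iff)
      have "cmod (\<Sum>(l, \<alpha>)\<in>{..<m k} \<times> degs N. seed (t mod T) l * mon \<alpha> (chan (st t)) * cw k u (t div T) (c, l, \<alpha>))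
          \<le> (\<Sum>(l, \<alpha>)\<in>{..<m k} \<times> degs N. cmod (seed (t mod T) l * mon \<alpha> (chan (st t))) * (2 * real q))"
        unfolding split_def
        by (intro order.trans[OF norm_sum] sum_mono) (auto simp: norm_mult streams_def intro!: mult_left_mono sym)
      also have "\<dots> = (\<Sum>(l, \<alpha>)\<in>{..<m k} \<times> degs N. cmod (seed (t mod T) l * mon \<alpha> (chan (st t)))) * (2 * real q)"
        by (simp add: split_def sum_distrib_right)
      also have "\<dots> \<le> C * (2 * real q)"
        by (intro mult_right_mono C \<tau> st) auto
      finally show ?thesis
        using True by (simp add: enc_def norm_mult norm_power mult_left_mono)
    qed (use C0 in \<open>simp add: enc_def\<close>)
    have norm_enc: "(norm (enc s B cw k u st t))\<^sup>2 \<le> P"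
      if "u < num k" and "\<And>p. cmod (chan (st t) p) \<le> hmax" for k u st t
    proof -
      have "norm (enc s B cw k u st t) \<le> (\<Sum>c\<in>UNIV. cmod (enc s B cw k u st t $ c))"
        unfolding norm_vec_def by (rule L2_set_le_sum) auto
      also have "\<dots> \<le> (\<Sum>c\<in>(UNIV::'m set). s\<^sup>2 * (C * (2 * real q)))"
        by (intro sum_mono entry that)
      also have "\<dots> = (real CARD('m) * (C * 2)) * (s\<^sup>2 * real q)" by simp
      also have "\<dots> \<le> K * (s\<^sup>2 * real q)"
        unfolding K_def by (intro mult_right_mono) auto
      finally have "norm (enc s B cw k u st t) \<le> K * s\<^sup>2 * real q" by (simp add: mult_ac)
      hence "(norm (enc s B cw k u st t))\<^sup>2 \<le> (K * s\<^sup>2 * real q)\<^sup>2" by (intro power_mono) auto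
      thus ?thesis using P by simp
    qed
    have P0: "P \<ge> 0" using P by (rule order.trans[OF zero_le_power2])
    show "power_constraint \<Omega> H n (the_code s q B err num cw) P"
      unfolding power_constraint_def
    proof (intro allI impI)
      fix k t assume t: "t < n"
      have "(\<integral>\<^sup>+\<omega>. ennreal ((\<Sum>u<num k. (norm (enc s B cw k u (state_block H n \<omega>) t))\<^sup>2) / real (num k)) \<partial>\<Omega>)
          \<le> (\<integral>\<^sup>+\<omega>. ennreal P \<partial>\<Omega>)"
      proof (rule nn_integral_mono_AE)
        show "AE \<omega> in \<Omega>. ennreal ((\<Sum>u<num k. (norm (enc s B cw k u (state_block H n \<omega>) t))\<^sup>2) / real (num k)) \<le> ennreal P"
          using channel_entry_bounds
        proof eventually_elim
          case (elim \<omega>)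
          have ch: "cmod (chan (state_block H n \<omega> t) p) \<le> hmax" for p
            using elim t by (cases p) (simp add: chan_def state_block_def)
          have "(\<Sum>u<num k. (norm (enc s B cw k u (state_block H n \<omega>) t))\<^sup>2) \<le> (\<Sum>u<num k. P)"
            by (intro sum_mono norm_enc ch) auto
          hence "(\<Sum>u<num k. (norm (enc s B cw k u (state_block H n \<omega>) t))\<^sup>2) / real (num k) \<le> P"
            using P0 by (cases "num k = 0") (simp_all add: divide_le_eq mult.commute)
          thus ?case by (rule ennreal_leI)
        qed
      qed
      also have "\<dots> = ennreal P" by (simp add: emeasure_space_1)
      finally show "(\<integral>\<^sup>+\<omega>. ennreal ((\<Sum>u < num_msgs (the_code s q B err num cw) k.
          (norm (encode (the_code s q B err num cw) k u (state_block H n \<omega>) t))\<^sup>2)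
            / real (num_msgs (the_code s q B err num cw) k)) \<partial>\<Omega>) \<le> ennreal P"
        by (simp add: the_code_def)
    qed
  qed
qed

definition codebook where
  "codebook q B err n' cwk k \<longleftrightarrow> (\<forall>u<n'. cwk u \<in> PiE {..<B::nat} (\<lambda>_. letters q k)) \<and>
     (\<forall>u<n'. \<forall>u'<n'. u \<noteq> u' \<longrightarrow> 2 * err < card {b \<in> {..<B}. cwk u b \<noteq> cwk u' b})"

text \<open>\<open>T * R\<close> is the number of bits per block, the summand 1 pays for the factor
  \<open>2 ^ B\<close> in the size of Hamming balls, and \<open>4 * \<epsilon>\<close> is the
  fraction of letters spent on the distance, as \<open>2 * err \<le> 4 * \<epsilon> * B\<close>. A
  transmitter without streams has a single letter, enough for the single message at rate 0.\<close>

lemma codebook_exists: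
  fixes R :: real
  assumes q: "q \<ge> 1" and \<epsilon>: "\<epsilon> > 0" and R: "0 \<le> R"
    and rate: "(streams k = {} \<and> R = 0) \<or>
      real T * R + 1 < (1 - 4 * \<epsilon>) * real (2 * card (streams k)) * log 2 (real q)"
  shows "\<forall>\<^sub>F n in sequentially. \<exists>cwk. codebook q (n div T) (nat \<lfloor>2 * \<epsilon> * real (n div T)\<rfloor>)
           (nat \<lceil>2 powr (real n * R)\<rceil>) cwk k"
  using rate
proof
  assume 0: "streams k = {} \<and> R = 0"
  hence "letters q k = {\<lambda>_. undefined}"
    by (simp add: letters_def)
  hence "codebook q B err (nat \<lceil>2 powr (real n * R)\<rceil>) (\<lambda>u. \<lambda>b\<in>{..<B}. \<lambda>_. undefined) k" for B err n
    using 0 by (auto simp: codebook_def)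
  thus ?thesis by (intro always_eventually allI exI)
next
  assume rate: "real T * R + 1 < (1 - 4 * \<epsilon>) * real (2 * card (streams k)) * log 2 (real q)"
  define x where "x = q ^ (2 * card (streams k))"
  define lx where "lx = log 2 (real x)"
  have x: "x \<ge> 1" using q by (simp add: x_def)
  have lx: "lx = real (2 * card (streams k)) * log 2 (real q)" and lx0: "lx \<ge> 0"
    using q x by (simp_all add: lx_def x_def log_nat_power)
  have x_pow: "real x ^ p = 2 powr (real p * lx)" for p
    using x by (simp add: lx_def powr_realpow[symmetric] powr_powr[symmetric] mult.commute[of "real p"])
  \<comment> \<open>Spare bits per block. They eventually outweigh the fixed cost
    \<open>T * R + 1\<close> of the incomplete last block and of rounding up the number of
    messages.\<close>
  define gap where "gap = (1 - 4 * \<epsilon>) * lx - (real T * R + 1)"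
  have gap: "gap > 0" using rate by (simp add: gap_def lx mult.assoc)
  have "filterlim (\<lambda>n. real (n div T) * gap) at_top sequentially"
    using gap T_pos
    by (intro filterlim_at_top_mult_tendsto_pos[OF tendsto_const] filterlim_compose[OF filterlim_real_sequentially]
        filterlim_at_top_div_const_nat)
  hence "\<forall>\<^sub>F n in sequentially. real T * R + 1 \<le> real (n div T) * gap"
    by (simp add: filterlim_at_top)
  thus ?thesis
  proof eventually_elim
    case (elim n)
    define B where "B = n div T"
    define err where "err = nat \<lfloor>2 * \<epsilon> * real B\<rfloor>"
    define num where "num = nat \<lceil>2 powr (real n * R)\<rceil>"
    have err: "real err \<le> 2 * \<epsilon> * real B" unfolding err_def using \<epsilon> by simp
    have "n = B * T + n mod T" by (simp add: B_def)
    moreover have "n mod T < T" using T_pos by simp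
    ultimately have nB: "real n \<le> real B * real T + real T"
      by (metis add_left_mono less_imp_le of_nat_add of_nat_le_iff of_nat_mult)
    have one: "1 \<le> 2 powr (real n * R)" using R by (intro ge_one_powr_ge_zero) auto
    hence "0 \<le> \<lceil>2 powr (real n * R)\<rceil>" by linarith
    hence "real num = of_int \<lceil>2 powr (real n * R)\<rceil>" by (simp add: num_def)
    hence "real num \<le> 2 powr (real n * R) + 1" by linarith
    with one have "real num \<le> 2 powr (real n * R + 1)" by (simp add: powr_add)
    also have "\<dots> \<le> 2 powr ((real B * real T + real T) * R + 1)"
      using nB R by (intro powr_mono add_right_mono mult_right_mono) auto
    finally have "real (num * (2 ^ B * x ^ (2 * err)))
        \<le> 2 powr ((real B * real T + real T) * R + 1) * (2 powr real B * 2 powr (real (2 * err) * lx))"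
      by (simp add: x_pow powr_realpow mult_right_mono)
    also have "\<dots> = 2 powr ((real B * real T + real T) * R + 1 + (real B + real (2 * err) * lx))"
      by (simp add: powr_add)
    also have "\<dots> \<le> 2 powr (real B * lx)"
    proof (rule powr_mono)
      have "real (2 * err) * lx \<le> (4 * \<epsilon> * real B) * lx"
        using err lx0 by (intro mult_right_mono) auto
      moreover have "(real B * real T + real T) * R + 1 + (real B + (4 * \<epsilon> * real B) * lx)
          = real B * lx + (real T * R + 1) - real B * gap"
        by (simp add: gap_def algebra_simps)
      ultimately show "(real B * real T + real T) * R + 1 + (real B + real (2 * err) * lx) \<le> real B * lx"
        using elim[folded B_def] by linarith
    qed simp
    also have "\<dots> = real (x ^ B)" by (simp add: x_pow)
    finally have "num * (2 ^ B * card (letters q k) ^ (2 * err)) \<le> card (letters q k) ^ B"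
      by (simp only: of_nat_le_iff card_letters x_def)
    moreover have "letters q k \<noteq> {}"
      using x card_letters[of q k] by (intro notI) (simp add: x_def[symmetric])
    ultimately obtain cwk where "codebook q B err num cwk k"
      using gilbert_varshamov[OF finite_letters, of q k num B "2 * err"] unfolding codebook_def by blast
    thus ?case unfolding B_def err_def num_def by blast
  qed
qed

lemma achievable_rates:
  assumes q: "q \<ge> 1" and s: "s > 0" and \<epsilon>: "\<epsilon> > 0" "measure (block_law T) (bad s) \<le> \<epsilon>"
    and power: "\<And>B err num cw n. (\<forall>k. \<forall>u<num k. cw k u \<in> PiE {..<B} (\<lambda>_. letters q k)) \<Longrightarrow>
      power_constraint \<Omega> H n (the_code s q B err num cw) P"
    and R: "\<And>k. 0 \<le> R $ k"
    and rate: "\<And>k. (streams k = {} \<and> R $ k = 0) \<or>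
      real T * R $ k + 1 < (1 - 4 * \<epsilon>) * real (2 * card (streams k)) * log 2 (real q)"
  shows "achievable \<Omega> H Z demand P R"
proof -
  define num where "num n k = nat \<lceil>2 powr (real n * R $ k)\<rceil>" for n k
  define err where "err n = nat \<lfloor>2 * \<epsilon> * real (n div T)\<rfloor>" for n
  define ok where "ok n cw \<longleftrightarrow> (\<forall>k. codebook q (n div T) (err n) (num n k) (cw k) k)" for n cw
  define cw where "cw n = (SOME cw. ok n cw)" for n
  \<comment> \<open>Achievability asks for a code at every length, also where no codebook is
    available. With zero blocks the encoders are silent, so the power constraint holds for any
    number of messages.\<close>
  define dummy where "dummy = (\<lambda>k::'k. \<lambda>u::nat. \<lambda>b\<in>{..<0::nat}. (undefined :: 'm \<times> nat \<times> ('j \<times> 'k \<times> 'm \<times> 'm \<Rightarrow> nat) \<Rightarrow> complex))"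
  define c where "c n = (if \<exists>cw. ok n cw then the_code s q (n div T) (err n) (num n) (cw n)
      else the_code s q 0 0 (num n) dummy)" for n
  have ok_cw: "ok n (cw n)" if "\<exists>cw. ok n cw" for n
    using that unfolding cw_def by (rule someI_ex)
  have fits: "n div T * T \<le> n" for n by (simp add: div_times_less_eq_dividend)
  have meas: "measurable_code n (c n)" for n
    unfolding c_def using measurable_the_code fits by simp
  have pow: "power_constraint \<Omega> H n (c n) P" for n
  proof (cases "\<exists>cw. ok n cw")
    case True
    thus ?thesis using ok_cw[OF True] by (auto simp: c_def ok_def codebook_def intro!: power)
  next
    case False
    thus ?thesis by (auto simp: c_def dummy_def intro!: power)
  qed
  have msgs: "num_msgs (c n) k = nat \<lceil>2 powr (real n * R $ k)\<rceil>" for n k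
    by (simp add: c_def the_code_def num_def)
  have "\<forall>\<^sub>F n in sequentially. \<forall>k\<in>UNIV. \<exists>cwk. codebook q (n div T) (err n) (num n k) cwk k"
    unfolding num_def err_def
    by (intro eventually_ball_finite finite ballI codebook_exists q \<epsilon> R rate)
  hence up: "\<forall>\<^sub>F n in sequentially. error_prob \<Omega> H Z demand n (c n) \<le> exp (- 2 * \<epsilon>\<^sup>2 * real (n div T))"
  proof eventually_elim
    case (elim n)
    hence "\<forall>k. \<exists>cwk. codebook q (n div T) (err n) (num n k) cwk k" by simp
    from choice[OF this] have ex: "\<exists>cw. ok n cw" unfolding ok_def .
    from ok_cw[OF ex] have cb: "\<And>k. codebook q (n div T) (err n) (num n k) (cw n k) k" by (simp add: ok_def)
    have "error_prob \<Omega> H Z demand n (the_code s q (n div T) (err n) (num n) (cw n))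
        \<le> exp (- 2 * \<epsilon>\<^sup>2 * real (n div T))"
      using cb unfolding err_def by (intro error_prob_the_code fits s \<epsilon>) (auto simp: codebook_def)
    thus ?case using ex by (simp add: c_def)
  qed
  have lim: "(\<lambda>n. exp (- 2 * \<epsilon>\<^sup>2 * real (n div T))) \<longlonglongrightarrow> 0"
  proof -
    have "filterlim (\<lambda>n. 2 * \<epsilon>\<^sup>2 * real (n div T)) at_top sequentially"
      using \<epsilon> T_pos
      by (intro filterlim_tendsto_pos_mult_at_top[OF tendsto_const] filterlim_compose[OF filterlim_real_sequentially]
          filterlim_at_top_div_const_nat) auto
    hence "filterlim (\<lambda>n. - (2 * \<epsilon>\<^sup>2 * real (n div T))) at_bot sequentially"
      by (simp add: filterlim_uminus_at_bot)
    from filterlim_compose[OF exp_at_bot this] show ?thesis by simp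
  qed
  have nonneg: "\<forall>\<^sub>F n in sequentially. 0 \<le> error_prob \<Omega> H Z demand n (c n)"
    unfolding error_prob_def by (intro always_eventually allI divide_nonneg_nonneg sum_nonneg) (auto intro: prod_nonneg)
  have "(\<lambda>n. error_prob \<Omega> H Z demand n (c n)) \<longlonglongrightarrow> 0"
    by (rule tendsto_sandwich[OF nonneg up tendsto_const lim])
  thus ?thesis unfolding achievable_def
    by (intro conjI allI R exI[of _ c] meas pow msgs)
qed

lemma achievable_asymptotics:
  assumes \<theta>: "0 \<le> \<theta>" "\<theta> < 1"
  shows "\<forall>\<^sub>F P in at_top. achievable \<Omega> H Z demand P
     (\<chi> k. \<theta> * (real (card (streams k)) / real T) * log 2 P)"
proof -
  \<comment> \<open>Makes \<open>1 - 4 * \<epsilon> = (1 + \<theta>) / 2\<close>, halfway between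
    \<open>\<theta>\<close> and 1; the margin over \<open>\<theta>\<close> absorbs all constants for
    large \<open>P\<close>.\<close>
  define \<epsilon> where "\<epsilon> = (1 - \<theta>) / 8"
  have \<epsilon>: "\<epsilon> > 0" using \<theta> by (simp add: \<epsilon>_def)
  obtain s where s: "s > 0" "measure (block_law T) (bad s) \<le> \<epsilon>" using bad_small[OF \<epsilon>] by blast
  obtain K0 where K0: "K0 > 0" and pow: "\<And>q B err num cw n P.
      (\<forall>k. \<forall>u<num k. cw k u \<in> PiE {..<B} (\<lambda>_. letters q k)) \<Longrightarrow>
      (K0 * s\<^sup>2 * real q)\<^sup>2 \<le> P \<Longrightarrow> power_constraint \<Omega> H n (the_code s q B err num cw) P"
    using power_the_code s(1) by metis
  define K where "K = K0 * s\<^sup>2"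
  have K: "K > 0" using K0 s by (simp add: K_def)
  \<comment> \<open>The largest alphabet that the power permits. Since \<open>log 2 q\<close> is at
    least \<open>log 2 P / 2\<close> minus a constant, the \<open>q^2\<close> symbols give nearly
    \<open>log 2 P\<close> bits per stream.\<close>
  define q where "q P = nat \<lfloor>sqrt P / K\<rfloor>" for P
  have lin: "\<forall>\<^sub>F P in at_top. c < log 2 P" for c :: real
    using eventually_gt_at_top[of "2 powr c"]
  proof eventually_elim
    case (elim P)
    moreover have "0 < 2 powr c" by simp
    ultimately have "0 < P" by linarith
    thus ?case using elim by (subst less_log_iff) auto
  qed
  have "\<forall>\<^sub>F P in at_top. ((1 - 4 * \<epsilon>) * 2 * log 2 (2 * K) + 1) / ((1 - \<theta>) / 2) < log 2 P"
    by (rule lin)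
  moreover have "\<forall>\<^sub>F P in at_top. P \<ge> max 1 ((2 * K)\<^sup>2)" by (rule eventually_ge_at_top)
  ultimately show ?thesis
  proof eventually_elim
    case (elim P)
    have P: "P \<ge> 1" "(2 * K)\<^sup>2 \<le> P" using elim by auto
    have root: "2 * K \<le> sqrt P" using P K by (intro real_le_rsqrt) auto
    hence two: "2 \<le> sqrt P / K" using K by (simp add: pos_le_divide_eq)
    have q_up: "real (q P) \<le> sqrt P / K" unfolding q_def using two by simp
    have "real (q P) > sqrt P / K - 1" unfolding q_def using two by linarith
    hence q_low: "sqrt P / (2 * K) \<le> real (q P)" using two by (simp add: field_simps)
    have "1 \<le> sqrt P / (2 * K)" using root K by (simp add: pos_le_divide_eq)
    hence q1: "q P \<ge> 1" using q_low by linarith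
    have "K * real (q P) \<le> sqrt P" using q_up K by (simp add: pos_le_divide_eq mult.commute)
    hence "(K * real (q P))\<^sup>2 \<le> (sqrt P)\<^sup>2" using K by (intro power_mono) auto
    hence qP: "(K * real (q P))\<^sup>2 \<le> P" using P by simp
    have logq: "log 2 P / 2 - log 2 (2 * K) \<le> log 2 (real (q P))"
    proof -
      have "log 2 (sqrt P / (2 * K)) = log 2 P / 2 - log 2 (2 * K)"
        using P K by (simp add: log_divide powr_half_sqrt[symmetric] log_powr)
      moreover have "log 2 (sqrt P / (2 * K)) \<le> log 2 (real (q P))"
        using q_low q1 P K by (subst log_le_cancel_iff) auto
      ultimately show ?thesis by simp
    qed
    show ?case
    proof (rule achievable_rates[OF q1 s(1) \<epsilon> s(2)])
      show "power_constraint \<Omega> H n (the_code s (q P) B err num cw) P"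
        if "\<forall>k. \<forall>u<num k. cw k u \<in> PiE {..<B} (\<lambda>_. letters (q P) k)" for B err num cw n
        using pow[OF that, of P] qP by (simp add: K_def)
      show "0 \<le> (\<chi> k. \<theta> * (real (card (streams k)) / real T) * log 2 P) $ k" for k
        using \<theta> P by simp
      fix k
      show "(streams k = {} \<and> (\<chi> k. \<theta> * (real (card (streams k)) / real T) * log 2 P) $ k = 0) \<or>
        real T * (\<chi> k. \<theta> * (real (card (streams k)) / real T) * log 2 P) $ k + 1
          < (1 - 4 * \<epsilon>) * real (2 * card (streams k)) * log 2 (real (q P))"
      proof (cases "card (streams k) = 0")
        case True
        thus ?thesis by simp
      next
        case False
        define S where "S = real (card (streams k))"
        have S: "S \<ge> 1" using False by (simp add: S_def Suc_le_eq card_gt_0_iff)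
        have 1: "1 - 4 * \<epsilon> = (1 + \<theta>) / 2" by (simp add: \<epsilon>_def field_simps)
        have "(1 - 4 * \<epsilon>) * 2 * log 2 (2 * K) + 1 < (1 - \<theta>) / 2 * log 2 P"
        proof -
          have "0 < (1 - \<theta>) / 2" using \<theta> by simp
          from iffD1[OF pos_divide_less_eq[OF this] elim(1)] show ?thesis by (simp only: mult.commute)
        qed
        hence "\<theta> * log 2 P + 1 < (1 - 4 * \<epsilon>) * (2 * (log 2 P / 2 - log 2 (2 * K)))"
          unfolding 1 by (simp add: field_simps)
        also have "\<dots> \<le> (1 - 4 * \<epsilon>) * (2 * log 2 (real (q P)))"
          using logq \<theta> by (intro mult_left_mono) (auto simp: 1)
        finally have "S * (\<theta> * log 2 P + 1) < S * ((1 - 4 * \<epsilon>) * (2 * log 2 (real (q P))))"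
          using S by simp
        moreover have "S * (\<theta> * log 2 P) + 1 \<le> S * (\<theta> * log 2 P + 1)"
          using S by (simp add: distrib_left)
        moreover have "S * ((1 - 4 * \<epsilon>) * (2 * log 2 (real (q P)))) = (1 - 4 * \<epsilon>) * (2 * S) * log 2 (real (q P))"
          by (simp only: mult_ac)
        ultimately have "S * (\<theta> * log 2 P) + 1 < (1 - 4 * \<epsilon>) * (2 * S) * log 2 (real (q P))"
          by linarith
        thus ?thesis using T_pos by (simp add: S_def mult_ac)
      qed
    qed
  qed
qed

end

text \<open>The region asks for one family \<open>R P\<close> with exact limits, whereas a fixed
  design only comes within \<open>\<delta>\<close>. Choosing each \<open>R P\<close> within
  \<open>1 / P\<close> of the least distance to \<open>d\<close> merges all designs; nonemptiness
  provides a choice at small \<open>P\<close> too.\<close>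

lemma DoF_by_approximation:
  fixes d :: "real ^ 'k::finite"
    and H :: "nat \<Rightarrow> 'w \<Rightarrow> ('j::finite, 'k, 'm::finite) channel_state"
  assumes d: "\<And>k. 0 \<le> d $ k"
    and nonempty: "\<And>P. P > 0 \<Longrightarrow> capacity_region \<Omega> H Z demand P \<noteq> {}"
    and approx: "\<And>\<delta>. \<delta> > 0 \<Longrightarrow> \<forall>\<^sub>F P in at_top. \<exists>R\<in>capacity_region \<Omega> H Z demand P.
        \<forall>k. \<bar>R $ k / log 2 P - d $ k\<bar> \<le> \<delta>"
  shows "d \<in> DoF_region \<Omega> H Z demand"
proof -
  define gap where "gap P R = (\<Sum>k\<in>UNIV. \<bar>R $ k / log 2 P - d $ k\<bar>)" for P R
  have "\<exists>R. R \<in> capacity_region \<Omega> H Z demand P \<and>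
      (\<forall>R'\<in>capacity_region \<Omega> H Z demand P. gap P R \<le> gap P R' + 1 / P)" if P: "P > 0" for P
  proof -
    let ?C = "capacity_region \<Omega> H Z demand P"
    have bdd: "bdd_below (gap P ` ?C)"
      by (rule bdd_belowI[of _ 0]) (auto simp: gap_def intro!: sum_nonneg)
    have "(INF R\<in>?C. gap P R) < (INF R\<in>?C. gap P R) + 1 / P" using P by simp
    then obtain R where R: "R \<in> ?C" "gap P R < (INF R\<in>?C. gap P R) + 1 / P"
      using cINF_less_iff[OF nonempty[OF P] bdd] by blast
    have "gap P R \<le> gap P R' + 1 / P" if "R' \<in> ?C" for R'
      using R(2) cINF_lower[OF bdd that] by linarith
    thus ?thesis using R(1) by blast
  qed
  then obtain R where RC: "\<And>P. P > 0 \<Longrightarrow> R P \<in> capacity_region \<Omega> H Z demand P"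
    and opt: "\<And>P R'. P > 0 \<Longrightarrow> R' \<in> capacity_region \<Omega> H Z demand P \<Longrightarrow> gap P (R P) \<le> gap P R' + 1 / P"
    by metis
  have "((\<lambda>P. R P $ k / log 2 P) \<longlongrightarrow> d $ k) at_top" for k
  proof (rule tendstoI)
    fix \<delta> :: real assume \<delta>: "\<delta> > 0"
    \<comment> \<open>The \<open>CARD('k)\<close> coordinates together contribute
      \<open>\<delta> / 4\<close>, and \<open>1 / P\<close> contributes at most as much
      again.\<close>
    define \<delta>' where "\<delta>' = \<delta> / (4 * real CARD('k))"
    have \<delta>': "\<delta>' > 0" using \<delta> by (simp add: \<delta>'_def)
    have "\<forall>\<^sub>F P in at_top. P \<ge> 4 / \<delta>" by (rule eventually_ge_at_top)
    with approx[OF \<delta>'] show "\<forall>\<^sub>F P in at_top. dist (R P $ k / log 2 P) (d $ k) < \<delta>"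
    proof eventually_elim
      case (elim P)
      have P: "P > 0" using elim(2) \<delta> by (meson divide_pos_pos less_le_trans zero_less_numeral)
      obtain R' where R': "R' \<in> capacity_region \<Omega> H Z demand P" "\<And>k. \<bar>R' $ k / log 2 P - d $ k\<bar> \<le> \<delta>'"
        using elim(1) by blast
      have "\<bar>R P $ k / log 2 P - d $ k\<bar> \<le> gap P (R P)"
        unfolding gap_def by (rule member_le_sum) auto
      also have "\<dots> \<le> gap P R' + 1 / P" by (rule opt[OF P R'(1)])
      also have "gap P R' \<le> (\<Sum>k\<in>(UNIV::'k set). \<delta>')"
        unfolding gap_def by (intro sum_mono R'(2))
      also have "\<dots> = \<delta> / 4" by (simp add: \<delta>'_def)
      also have "1 / P \<le> \<delta> / 4" using elim(2) P \<delta> by (simp add: field_simps)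
      finally have "\<bar>R P $ k / log 2 P - d $ k\<bar> \<le> \<delta> / 2" by simp
      thus ?case using \<delta> by (simp add: dist_real_def)
    qed
  qed
  thus ?thesis unfolding DoF_region_def using d RC by blast
qed

section \<open>Choice of the design for a point of the region\<close>

context interference_channel
begin

lemma achievable_zero:
  assumes "0 \<le> P"
  shows "achievable \<Omega> H Z demand P 0"
proof -
  define c :: "('j, 'k, 'm) block_code" where
    "c = \<lparr>num_msgs = \<lambda>_. 1, encode = \<lambda>_ _ _ _. 0, decode = \<lambda>_ _ _ _. 0\<rparr>"
  have "measurable_code n c" for n
    by (simp add: measurable_code_def c_def split_def)
  moreover have "power_constraint \<Omega> H n c P" for n
    by (simp add: power_constraint_def c_def)
  moreover have "error_prob \<Omega> H Z demand n c = 0" for n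
    unfolding error_prob_def c_def by (auto simp: PiE_iff intro!: sum.neutral)
  ultimately show ?thesis
    unfolding achievable_def by (intro conjI exI[of _ "\<lambda>_. c"]) (simp_all add: c_def)
qed

text \<open>Seeds are allotted in proportion to the DoF, \<open>m k\<close> being about
  \<open>d $ k * Q / M\<close>, which turns the inequalities of the region into the dimension count
  with \<open>Q\<close>. The scheme then attains \<open>\<phi> * M * m k / Q\<close>, with
  \<open>\<phi>\<close> close to 1.\<close>

lemma DoF_inner:
  fixes d :: "real ^ 'k" and demand :: "'j \<Rightarrow> 'k set"
  assumes d0: "\<And>k. 0 \<le> d $ k"
    and region: "\<And>j. (\<Sum>k\<in>demand j. d $ k)
        + (if - demand j = {} then 0 else Max ((\<lambda>i. d $ i) ` (- demand j))) \<le> real CARD('m)"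
  shows "d \<in> DoF_region \<Omega> H Z demand"
proof (rule DoF_by_approximation[OF d0])
  fix P :: real assume "P > 0"
  hence "0 \<in> capacity_region \<Omega> H Z demand P"
    unfolding capacity_region_def using achievable_zero closure_subset by (metis less_imp_le mem_Collect_eq subsetD)
  thus "capacity_region \<Omega> H Z demand P \<noteq> {}" by blast
next
  fix \<delta> :: real assume \<delta>: "\<delta> > 0"
  define M where "M = real CARD('m)"
  have M: "M \<ge> 1" unfolding M_def by (simp add: Suc_le_eq)
  define g where "g = card {(j, k, r :: 'm, c :: 'm). k \<notin> demand j}"
  have bound: "(\<Sum>k\<in>demand j. d $ k) + d $ i \<le> M" if "i \<notin> demand j" for i j
  proof -
    have "d $ i \<le> Max ((\<lambda>i. d $ i) ` (- demand j))" using that by (intro Max_ge) auto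
    moreover have "- demand j \<noteq> {}" using that by auto
    hence "(\<Sum>k\<in>demand j. d $ k) + Max ((\<lambda>i. d $ i) ` (- demand j)) \<le> M"
      using region[of j] by (simp only: M_def if_False)
    ultimately show ?thesis by linarith
  qed
  have bound0: "(\<Sum>k\<in>demand j. d $ k) \<le> M" for j
  proof (cases "- demand j = {}")
    case True
    thus ?thesis using region[of j] by (simp add: M_def)
  next
    case False
    then obtain i where "i \<notin> demand j" by blast
    thus ?thesis using bound[of i j] d0[of i] by linarith
  qed
  have dM: "d $ k \<le> M" for k
  \<comment> \<open>\<open>undefined\<close> stands for an arbitrary receiver: whether it wants
    message \<open>k\<close> or hears it as interference, its inequality gives
    \<open>d $ k \<le> M\<close>.\<close>
  proof (cases "k \<in> demand undefined")
    case True
    hence "d $ k \<le> (\<Sum>k\<in>demand undefined. d $ k)" using d0 by (intro member_le_sum) auto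
    thus ?thesis using bound0[of undefined] by linarith
  next
    case False
    moreover have "0 \<le> (\<Sum>k\<in>demand undefined. d $ k)" using d0 by (intro sum_nonneg) auto
    ultimately show ?thesis using bound[of k undefined] by linarith
  qed
  \<comment> \<open>Rounding the DoF down to multiples of \<open>M / Q\<close> then loses at most
    \<open>\<delta> / 2\<close>.\<close>
  obtain Q where Q: "real Q > 2 * M / \<delta>" using reals_Archimedean2 by blast
  have "2 * M / \<delta> > 0" using M \<delta> by simp
  hence Q0: "Q > 0" using Q by (cases Q) auto
  define m where "m k = nat \<lfloor>d $ k * real Q / M\<rfloor>" for k
  have m_le: "real (m k) \<le> d $ k * real Q / M" for k
    unfolding m_def using d0[of k] M by (intro of_nat_floor) simp
  have m_ge: "d $ k * real Q / M - 1 \<le> real (m k)" for k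
    unfolding m_def by linarith
  have sum_le: "(\<Sum>k\<in>demand j. real (m k)) \<le> (\<Sum>k\<in>demand j. d $ k) * (real Q / M)" for j
    unfolding sum_distrib_right using m_le by (intro sum_mono) simp
  have QM: "real Q / M \<ge> 0" using M by simp
  have to_Q: "y * (real Q / M) \<le> real Q" if "y \<le> M" for y
    using mult_right_mono[OF that QM] M by simp
  \<comment> \<open>Spent twice, on the ratio \<open>(N / (N+1))^g\<close> and on the rate factor
    \<open>1 - \<eta>\<close>; both together cost at most
    \<open>2 * \<eta> * M \<le> \<delta> / 2\<close>.\<close>
  define \<eta> where "\<eta> = min (1/2) (\<delta> / (4 * M))"
  have \<eta>: "0 < \<eta>" "\<eta> \<le> 1/2" "\<eta> * M \<le> \<delta> / 4" using \<delta> M by (auto simp: \<eta>_def min_def field_simps)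
  have "(\<lambda>N. (real N / real (Suc N)) ^ g) \<longlonglongrightarrow> 1 ^ g"
    by (intro tendsto_power LIMSEQ_n_over_Suc_n)
  hence "(\<lambda>N. (real N / real (Suc N)) ^ g) \<longlonglongrightarrow> 1" by simp
  from order_tendstoD(1)[OF this, of "1 - \<eta>"] obtain N where N: "1 - \<eta> < (real N / real (Suc N)) ^ g"
    using \<eta> by (auto simp: eventually_sequentially)
  obtain e :: "('j \<times> 'k \<times> 'm \<times> 'm) + 'k option \<Rightarrow> nat" where
    e: "inj_on (\<lambda>\<alpha>. \<Sum>g\<in>UNIV. \<alpha> g * e g) (PiE UNIV (\<lambda>_. {..N + Q + 1}))"
    using exponent_code[of "UNIV :: (('j \<times> 'k \<times> 'm \<times> 'm) + 'k option) set" "N + Q + 1"] by auto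
  interpret beams demand m N Q e by unfold_locales (rule e)
  have mQ: "m k \<le> Q" for k
    using m_le[of k] to_Q[OF dM[of k]] by (simp add: of_nat_le_iff[symmetric] del: of_nat_le_iff)
  have dims: "(\<Sum>k\<in>demand j. m k) + mx j \<le> Q" for j
  proof -
    have "real (\<Sum>k\<in>demand j. m k) + real (mx j) \<le> real Q"
    proof (cases "mx j = 0")
      case True
      thus ?thesis using sum_le[of j] to_Q[OF bound0[of j]] by simp
    next
      case False
      have "mx j \<in> insert 0 (m ` (- demand j))" unfolding mx_def by (intro Max_in) auto
      then obtain i where i: "i \<notin> demand j" "mx j = m i" using False by auto
      have "real (m i) \<le> d $ i * (real Q / M)" using m_le[of i] by simp
      with sum_le[of j] have "real (\<Sum>k\<in>demand j. m k) + real (mx j)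
          \<le> ((\<Sum>k\<in>demand j. d $ k) + d $ i) * (real Q / M)"
        unfolding i(2) distrib_right of_nat_sum by linarith
      also have "\<dots> \<le> real Q" by (rule to_Q[OF bound[OF i(1)]])
      finally show ?thesis .
    qed
    thus ?thesis by (simp only: of_nat_add[symmetric] of_nat_le_iff)
  qed
  interpret coded_channel \<Omega> H Z \<mu> hmin hmax demand m N Q e
    by unfold_locales (use Q0 mQ dims in auto)
  have cross_g: "card cross = g" by (simp add: cross_def g_def)
  define \<phi> where "\<phi> = (1 - \<eta>) * (real N / real (Suc N)) ^ g"
  have \<phi>: "1 - 2 * \<eta> \<le> \<phi>" "\<phi> \<le> 1"
  proof -
    have "(1 - \<eta>) * (1 - \<eta>) \<le> \<phi>" unfolding \<phi>_def using N \<eta> by (intro mult_left_mono) auto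
    moreover have "(1 - \<eta>) * (1 - \<eta>) \<ge> 1 - 2 * \<eta>" by (simp add: algebra_simps)
    ultimately show "1 - 2 * \<eta> \<le> \<phi>" by linarith
    have "(real N / real (Suc N)) ^ g \<le> 1" by (intro power_le_one) auto
    thus "\<phi> \<le> 1" unfolding \<phi>_def using \<eta> by (intro mult_le_one) auto
  qed
  have rate: "(1 - \<eta>) * (real (card (streams k)) / real T) = \<phi> * (M * real (m k) / real Q)" for k
    unfolding T_def card_streams cross_g \<phi>_def
    by (simp add: M_def power_divide mult_ac del: power_Suc of_nat_Suc)
  have close: "\<bar>\<phi> * (M * real (m k) / real Q) - d $ k\<bar> \<le> \<delta>" for k
  proof -
    let ?r = "M * real (m k) / real Q"
    have MQ: "M / real Q \<le> \<delta> / 2" using Q Q0 \<delta> by (simp add: field_simps)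
    have "(d $ k * real Q / M - 1) * (M / real Q) = d $ k - M / real Q"
      using M Q0 by (simp add: left_diff_distrib diff_divide_distrib)
    with mult_right_mono[OF m_ge[of k], of "M / real Q"] have "d $ k - M / real Q \<le> ?r"
      using M by (simp add: mult.commute)
    moreover have "?r \<le> d $ k" "0 \<le> ?r"
      using m_le[of k] M Q0 by (auto simp: field_simps)
    ultimately have r: "?r \<le> d $ k" "d $ k - M / real Q \<le> ?r" "0 \<le> ?r" by blast+
    have "\<phi> * ?r \<le> 1 * ?r" using \<phi> r by (intro mult_right_mono)
    moreover have "(1 - 2 * \<eta>) * ?r \<le> \<phi> * ?r" using \<phi> r by (intro mult_right_mono)
    moreover have "\<eta> * ?r \<le> \<eta> * M" using \<eta> r dM[of k] by (intro mult_left_mono) linarith+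
    moreover have "(1 - 2 * \<eta>) * x = x - 2 * (\<eta> * x)" for x by (simp add: algebra_simps)
    note this[of ?r]
    ultimately show ?thesis using r MQ \<eta> unfolding abs_le_iff by linarith
  qed
  have "\<forall>\<^sub>F P in at_top. achievable \<Omega> H Z demand P
     (\<chi> k. (1 - \<eta>) * (real (card (streams k)) / real T) * log 2 P)"
    using \<eta> by (intro achievable_asymptotics) auto
  moreover have "\<forall>\<^sub>F P :: real in at_top. P > 1" by (rule eventually_gt_at_top)
  ultimately show "\<forall>\<^sub>F P in at_top. \<exists>R\<in>capacity_region \<Omega> H Z demand P.
        \<forall>k. \<bar>R $ k / log 2 P - d $ k\<bar> \<le> \<delta>"
  proof eventually_elim
    case (elim P)
    let ?R = "\<chi> k. (1 - \<eta>) * (real (card (streams k)) / real T) * log 2 P"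
    have "?R \<in> capacity_region \<Omega> H Z demand P"
      unfolding capacity_region_def using elim(1) closure_subset by blast
    moreover have "\<bar>?R $ k / log 2 P - d $ k\<bar> \<le> \<delta>" for k
    proof -
      have "log 2 P \<noteq> 0" using elim(2) by (simp add: less_imp_neq[symmetric])
      hence "?R $ k / log 2 P = (1 - \<eta>) * (real (card (streams k)) / real T)" by simp
      thus ?thesis using close[of k] by (simp only: rate)
    qed
    ultimately show ?case by blast
  qed
qed

end

section \<open>Packing under Gaussian noise\<close>

lemma product_sigma_finite_const: "sigma_finite_measure M \<Longrightarrow> product_sigma_finite (\<lambda>_. M)"
  by (simp add: product_sigma_finite_def)

text \<open>Fubini peels off one coordinate at a time. The applications are translations and the
  reflection of all coordinates.\<close>

lemma nn_integral_PiM_map: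
  fixes M :: "'b measure" and \<phi> :: "'i \<Rightarrow> 'b \<Rightarrow> 'b"
  assumes sf: "sigma_finite_measure M" and fin: "finite I"
    and \<phi>: "\<And>i. \<phi> i \<in> M \<rightarrow>\<^sub>M M" "\<And>i. distr M M (\<phi> i) = M"
    and f: "f \<in> borel_measurable (PiM I (\<lambda>_. M))"
  shows "(\<integral>\<^sup>+x. f (\<lambda>i\<in>I. \<phi> i (x i)) \<partial>PiM I (\<lambda>_. M)) = (\<integral>\<^sup>+x. f x \<partial>PiM I (\<lambda>_. M))"
  using fin f
proof (induction I arbitrary: f rule: finite_induct)
  case empty
  show ?case by (simp add: nn_integral_count_space_finite PiM_empty)
next
  case (insert i I)
  interpret P: product_sigma_finite "\<lambda>_::'i. M" by (rule product_sigma_finite_const[OF sf])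
  note [measurable] = insert.prems \<phi>(1)
  have m: "(\<lambda>x. \<lambda>k\<in>insert i I. \<phi> k (x k)) \<in> PiM (insert i I) (\<lambda>_. M) \<rightarrow>\<^sub>M PiM (insert i I) (\<lambda>_. M)"
    by (intro measurable_restrict measurable_compose[OF _ \<phi>(1)] measurable_component_singleton) auto
  have "(\<integral>\<^sup>+x. f (\<lambda>k\<in>insert i I. \<phi> k (x k)) \<partial>PiM (insert i I) (\<lambda>_. M))
      = (\<integral>\<^sup>+x. \<integral>\<^sup>+y. f (\<lambda>k\<in>insert i I. \<phi> k ((x(i := y)) k)) \<partial>M \<partial>PiM I (\<lambda>_. M))"
    by (rule P.product_nn_integral_insert[OF insert.hyps measurable_compose[OF m insert.prems]])
  also have "\<dots> = (\<integral>\<^sup>+x. \<integral>\<^sup>+y. f ((\<lambda>k\<in>I. \<phi> k (x k))(i := \<phi> i y)) \<partial>M \<partial>PiM I (\<lambda>_. M))"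
  proof -
    have "(\<lambda>k\<in>insert i I. \<phi> k ((x(i := y)) k)) = (\<lambda>k\<in>I. \<phi> k (x k))(i := \<phi> i y)" for x y
      using insert.hyps by (auto simp: fun_eq_iff restrict_def)
    thus ?thesis by simp
  qed
  also have "\<dots> = (\<integral>\<^sup>+x. \<integral>\<^sup>+y. f ((\<lambda>k\<in>I. \<phi> k (x k))(i := y)) \<partial>M \<partial>PiM I (\<lambda>_. M))"
  proof (rule nn_integral_cong)
    fix x assume x: "x \<in> space (PiM I (\<lambda>_. M))"
    have sp: "(\<lambda>k\<in>I. \<phi> k (x k)) \<in> space (PiM I (\<lambda>_. M))"
      using x \<phi>(1)[THEN measurable_space] by (auto simp: space_PiM)
    have upd: "(\<lambda>y. (\<lambda>k\<in>I. \<phi> k (x k))(i := y)) \<in> M \<rightarrow>\<^sub>M PiM (insert i I) (\<lambda>_. M)"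
      using sp by (intro measurable_fun_upd[where J = I]) auto
    have "(\<integral>\<^sup>+y. f ((\<lambda>k\<in>I. \<phi> k (x k))(i := y)) \<partial>M)
        = (\<integral>\<^sup>+y. f ((\<lambda>k\<in>I. \<phi> k (x k))(i := y)) \<partial>distr M M (\<phi> i))"
      by (simp only: \<phi>(2))
    also have "\<dots> = (\<integral>\<^sup>+y. f ((\<lambda>k\<in>I. \<phi> k (x k))(i := \<phi> i y)) \<partial>M)"
      by (intro nn_integral_distr \<phi>(1)) (unfold \<phi>(2), rule measurable_compose[OF upd insert.prems])
    finally show "(\<integral>\<^sup>+y. f ((\<lambda>k\<in>I. \<phi> k (x k))(i := \<phi> i y)) \<partial>M)
        = (\<integral>\<^sup>+y. f ((\<lambda>k\<in>I. \<phi> k (x k))(i := y)) \<partial>M)" by simp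
  qed
  also have "\<dots> = (\<integral>\<^sup>+x. \<integral>\<^sup>+y. f (x(i := y)) \<partial>M \<partial>PiM I (\<lambda>_. M))"
  proof (rule insert.IH)
    have "(\<lambda>p. f ((fst p)(i := snd p))) \<in> borel_measurable (PiM I (\<lambda>_. M) \<Otimes>\<^sub>M M)"
      by (rule measurable_compose[OF _ insert.prems])
         (intro measurable_fun_upd[where J = I] measurable_fst measurable_snd, auto)
    thus "(\<lambda>x. \<integral>\<^sup>+y. f (x(i := y)) \<partial>M) \<in> borel_measurable (PiM I (\<lambda>_. M))"
      using sigma_finite_measure.borel_measurable_nn_integral_fst[OF sf] by fastforce
  qed
  also have "\<dots> = (\<integral>\<^sup>+x. f x \<partial>PiM (insert i I) (\<lambda>_. M))"
    by (rule P.product_nn_integral_insert[OF insert.hyps insert.prems, symmetric])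
  finally show ?case .
qed

lemma nn_integral_PiM_density:
  fixes M :: "'b measure" and g :: "'b \<Rightarrow> ennreal" and I :: "'i set"
  assumes sf: "sigma_finite_measure M" "sigma_finite_measure (density M g)" and fin: "finite I"
    and g: "g \<in> borel_measurable M" and f: "f \<in> borel_measurable (PiM I (\<lambda>_. M))"
  shows "(\<integral>\<^sup>+x. f x \<partial>PiM I (\<lambda>_. density M g)) = (\<integral>\<^sup>+x. f x * (\<Prod>i\<in>I. g (x i)) \<partial>PiM I (\<lambda>_. M))"
  using fin f
proof (induction I arbitrary: f rule: finite_induct)
  case empty
  show ?case by (simp add: nn_integral_count_space_finite PiM_empty)
next
  case (insert i I)
  interpret P: product_sigma_finite "\<lambda>_::'i. M" by (rule product_sigma_finite_const[OF sf(1)])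
  interpret D: product_sigma_finite "\<lambda>_::'i. density M g" by (rule product_sigma_finite_const[OF sf(2)])
  have sets_eq: "sets (PiM J (\<lambda>_. density M g)) = sets (PiM J (\<lambda>_. M))" for J :: "'i set"
    by (intro sets_PiM_cong) auto
  have meas_eq: "borel_measurable (PiM J (\<lambda>_. density M g)) = borel_measurable (PiM J (\<lambda>_. M))" for J :: "'i set"
    by (intro measurable_cong_sets sets_eq refl)
  have upd2: "(\<lambda>p. (fst p)(i := snd p)) \<in> PiM I (\<lambda>_. M) \<Otimes>\<^sub>M M \<rightarrow>\<^sub>M PiM (insert i I) (\<lambda>_. M)"
    by (intro measurable_fun_upd[where J = I] measurable_fst measurable_snd) auto
  have prod_meas: "(\<lambda>x. \<Prod>k\<in>J. g (x k)) \<in> borel_measurable (PiM J (\<lambda>_. M))" for J :: "'i set"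
    by (intro borel_measurable_prod_ennreal measurable_compose[OF _ g] measurable_component_singleton) auto
  have "(\<integral>\<^sup>+x. f x \<partial>PiM (insert i I) (\<lambda>_. density M g))
      = (\<integral>\<^sup>+x. \<integral>\<^sup>+y. f (x(i := y)) \<partial>density M g \<partial>PiM I (\<lambda>_. density M g))"
    by (rule D.product_nn_integral_insert[OF insert.hyps]) (simp add: meas_eq insert.prems)
  also have "\<dots> = (\<integral>\<^sup>+x. \<integral>\<^sup>+y. g y * f (x(i := y)) \<partial>M \<partial>PiM I (\<lambda>_. density M g))"
  proof (rule nn_integral_cong)
    fix x assume "x \<in> space (PiM I (\<lambda>_. density M g))"
    hence "x \<in> space (PiM I (\<lambda>_. M))" by (simp add: space_PiM)
    hence "(\<lambda>y. x(i := y)) \<in> M \<rightarrow>\<^sub>M PiM (insert i I) (\<lambda>_. M)"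
      by (intro measurable_fun_upd[where J = I]) auto
    from measurable_compose[OF this insert.prems]
    show "(\<integral>\<^sup>+y. f (x(i := y)) \<partial>density M g) = (\<integral>\<^sup>+y. g y * f (x(i := y)) \<partial>M)"
      by (intro nn_integral_density g)
  qed
  also have "\<dots> = (\<integral>\<^sup>+x. (\<integral>\<^sup>+y. g y * f (x(i := y)) \<partial>M) * (\<Prod>k\<in>I. g (x k)) \<partial>PiM I (\<lambda>_. M))"
  proof (rule insert.IH)
    have "(\<lambda>p. g (snd p) * f ((fst p)(i := snd p))) \<in> borel_measurable (PiM I (\<lambda>_. M) \<Otimes>\<^sub>M M)"
      by (intro borel_measurable_times_ennreal measurable_compose[OF measurable_snd g]
          measurable_compose[OF upd2 insert.prems])
    thus "(\<lambda>x. \<integral>\<^sup>+y. g y * f (x(i := y)) \<partial>M) \<in> borel_measurable (PiM I (\<lambda>_. M))"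
      using sigma_finite_measure.borel_measurable_nn_integral_fst[OF sf(1)] by fastforce
  qed
  also have "\<dots> = (\<integral>\<^sup>+x. \<integral>\<^sup>+y. f (x(i := y)) * (\<Prod>k\<in>insert i I. g ((x(i := y)) k)) \<partial>M \<partial>PiM I (\<lambda>_. M))"
  proof (rule nn_integral_cong)
    fix x assume x: "x \<in> space (PiM I (\<lambda>_. M))"
    hence upd: "(\<lambda>y. x(i := y)) \<in> M \<rightarrow>\<^sub>M PiM (insert i I) (\<lambda>_. M)"
      by (intro measurable_fun_upd[where J = I]) auto
    have "(\<Prod>k\<in>insert i I. g ((x(i := y)) k)) = g y * (\<Prod>k\<in>I. g (x k))" for y
    proof -
      have "(\<Prod>k\<in>I. g ((x(i := y)) k)) = (\<Prod>k\<in>I. g (x k))"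
        using insert.hyps by (intro prod.cong) auto
      thus ?thesis using insert.hyps by simp
    qed
    hence "(\<integral>\<^sup>+y. f (x(i := y)) * (\<Prod>k\<in>insert i I. g ((x(i := y)) k)) \<partial>M)
        = (\<integral>\<^sup>+y. g y * f (x(i := y)) * (\<Prod>k\<in>I. g (x k)) \<partial>M)"
      by (simp add: mult_ac)
    also have "\<dots> = (\<integral>\<^sup>+y. g y * f (x(i := y)) \<partial>M) * (\<Prod>k\<in>I. g (x k))"
      by (intro nn_integral_multc borel_measurable_times_ennreal g measurable_compose[OF upd insert.prems])
    finally show "(\<integral>\<^sup>+y. g y * f (x(i := y)) \<partial>M) * (\<Prod>k\<in>I. g (x k))
        = (\<integral>\<^sup>+y. f (x(i := y)) * (\<Prod>k\<in>insert i I. g ((x(i := y)) k)) \<partial>M)" ..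
  qed
  also have "\<dots> = (\<integral>\<^sup>+x. f x * (\<Prod>k\<in>insert i I. g (x k)) \<partial>PiM (insert i I) (\<lambda>_. M))"
    by (rule P.product_nn_integral_insert[OF insert.hyps, symmetric])
       (intro borel_measurable_times_ennreal insert.prems prod_meas)
  finally show ?case .
qed


text \<open>The cross terms of the two shifts are opposite, and
  \<open>exp s + exp (- s) \<ge> 2\<close>. Averaging a shift with its opposite therefore loses a
  factor that depends on \<open>a\<close> alone; for a single shift the loss would depend on
  \<open>z\<close> and be unbounded.\<close>

lemma gaussian_symmetrize:
  fixes z a :: "'i \<Rightarrow> complex"
  shows "2 * (\<Prod>i\<in>I. exp (- (cmod (z i))\<^sup>2) / pi) * exp (- (\<Sum>i\<in>I. (cmod (a i))\<^sup>2))
     \<le> (\<Prod>i\<in>I. exp (- (cmod (z i - a i))\<^sup>2) / pi) + (\<Prod>i\<in>I. exp (- (cmod (z i + a i))\<^sup>2) / pi)"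
proof (cases "finite I")
  case False
  thus ?thesis by simp
next
  case True
  define E where "E = exp (- (\<Sum>i\<in>I. (cmod (z i))\<^sup>2)) * exp (- (\<Sum>i\<in>I. (cmod (a i))\<^sup>2)) / pi ^ card I"
  define s where "s = (\<Sum>i\<in>I. 2 * (z i \<bullet> a i))"
  have prod: "(\<Prod>i\<in>I. exp (- f i) / pi) = exp (- (\<Sum>i\<in>I. f i)) / pi ^ card I" for f :: "'i \<Rightarrow> real"
    using True by (simp add: prod_dividef exp_sum sum_negf[symmetric])
  have "(\<Sum>i\<in>I. (cmod (z i - a i))\<^sup>2) = (\<Sum>i\<in>I. (cmod (z i))\<^sup>2) + (\<Sum>i\<in>I. (cmod (a i))\<^sup>2) - s"
    unfolding s_def power2_norm_eq_inner
    by (simp add: inner_diff inner_commute sum.distrib sum_subtractf sum_distrib_left algebra_simps)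
  hence m: "(\<Prod>i\<in>I. exp (- (cmod (z i - a i))\<^sup>2) / pi) = E * exp s"
    unfolding prod by (simp add: E_def exp_add[symmetric])
  have "(\<Sum>i\<in>I. (cmod (z i + a i))\<^sup>2) = (\<Sum>i\<in>I. (cmod (z i))\<^sup>2) + (\<Sum>i\<in>I. (cmod (a i))\<^sup>2) + s"
    unfolding s_def power2_norm_eq_inner
    by (simp add: inner_add inner_commute sum.distrib sum_distrib_left algebra_simps)
  hence p: "(\<Prod>i\<in>I. exp (- (cmod (z i + a i))\<^sup>2) / pi) = E * exp (- s)"
    unfolding prod by (simp add: E_def exp_add[symmetric])
  have "exp s + exp (- s) \<ge> 2" using cosh_real_ge_1[of s] by (simp add: cosh_def)
  moreover have "E \<ge> 0" by (simp add: E_def)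
  ultimately have "E * 2 \<le> E * (exp s + exp (- s))" by (intro mult_left_mono)
  moreover have "2 * (\<Prod>i\<in>I. exp (- (cmod (z i))\<^sup>2) / pi) * exp (- (\<Sum>i\<in>I. (cmod (a i))\<^sup>2)) = E * 2"
    unfolding prod by (simp add: E_def)
  ultimately show ?thesis unfolding m p by (simp add: distrib_left)
qed

lemma distr_lborel_add: "distr lborel lborel (\<lambda>x. x + c) = (lborel :: complex measure)"
  using lborel_distr_plus[of c] by (simp add: add.commute distr_cong[OF refl sets_lborel[symmetric]])

lemma distr_lborel_uminus: "distr lborel lborel uminus = (lborel :: complex measure)"
proof -
  have "(lborel :: complex measure) = density (distr lborel borel (\<lambda>x. 0 + (-1) *\<^sub>R x)) (\<lambda>_. \<bar>- 1 :: real\<bar> ^ DIM(complex))"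
    using lborel_affine[of "-1" "0 :: complex"] by simp
  also have "\<dots> = distr lborel borel uminus"
    by (simp add: density_1)
  finally show ?thesis by (simp cong: distr_cong)
qed

definition gaussian_density :: "'i set \<Rightarrow> ('i \<Rightarrow> complex) \<Rightarrow> ennreal" where
  "gaussian_density I z = (\<Prod>i\<in>I. ennreal (exp (- (cmod (z i))\<^sup>2) / pi))"

abbreviation vadd :: "'i set \<Rightarrow> ('i \<Rightarrow> complex) \<Rightarrow> ('i \<Rightarrow> complex) \<Rightarrow> 'i \<Rightarrow> complex" where
  "vadd I x y \<equiv> (\<lambda>i\<in>I. x i + y i)"

abbreviation vsub :: "'i set \<Rightarrow> ('i \<Rightarrow> complex) \<Rightarrow> ('i \<Rightarrow> complex) \<Rightarrow> 'i \<Rightarrow> complex" where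
  "vsub I x y \<equiv> (\<lambda>i\<in>I. x i - y i)"

abbreviation polydisc :: "'i set \<Rightarrow> ('i \<Rightarrow> complex) set" where
  "polydisc I \<equiv> PiE I (\<lambda>_. cball 0 1)"

lemma nn_integral_PiM_translate:
  fixes c :: "'i \<Rightarrow> complex"
  assumes "finite I" and "f \<in> borel_measurable (PiM I (\<lambda>_. lborel))"
  shows "(\<integral>\<^sup>+x. f (vadd I x c) \<partial>PiM I (\<lambda>_. lborel)) = (\<integral>\<^sup>+x. f x \<partial>PiM I (\<lambda>_. lborel))"
  using assms by (intro nn_integral_PiM_map distr_lborel_add lborel.sigma_finite_measure_axioms) auto

lemma sets_PiM_lborel: "sets (PiM I (\<lambda>_. lborel :: complex measure)) = sets (PiM I (\<lambda>_. borel))"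
  by (intro sets_PiM_cong) auto

lemma gaussian_density_measurable [measurable]: "gaussian_density I \<in> borel_measurable (PiM I (\<lambda>_. lborel))"
  unfolding gaussian_density_def by measurable

lemma polydisc_sets [measurable]: "finite I \<Longrightarrow> polydisc I \<in> sets (PiM I (\<lambda>_. lborel :: complex measure))"
  by (intro sets_PiM_I_finite) auto

text \<open>The symmetrised inequality integrated over the polydisc. As \<open>L\<close> is odd, the
  reflection of \<open>p\<close> exchanges the two shifts, so one sign remains in the
  conclusion.\<close>

lemma gaussian_shift_average:
  fixes z :: "'i \<Rightarrow> complex"
  assumes fin: "finite I"
    and L: "\<And>i. i \<in> I \<Longrightarrow> (\<lambda>p. L p i) \<in> borel_measurable (PiM I (\<lambda>_. lborel))"
    and odd: "\<And>p i. p \<in> polydisc I \<Longrightarrow> i \<in> I \<Longrightarrow> L (\<lambda>i\<in>I. - p i) i = - L p i"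
    and \<kappa>: "\<And>p. p \<in> polydisc I \<Longrightarrow> (\<Sum>i\<in>I. (cmod (L p i))\<^sup>2) \<le> \<kappa>"
  shows "gaussian_density I z * emeasure (PiM I (\<lambda>_. lborel)) (polydisc I)
     \<le> ennreal (exp \<kappa>) * (\<integral>\<^sup>+p. indicator (polydisc I) p * gaussian_density I (vsub I z (L p)) \<partial>PiM I (\<lambda>_. lborel))"
proof -
  let ?M = "PiM I (\<lambda>_. lborel :: complex measure)"
  let ?G = "gaussian_density I"
  note [measurable] = polydisc_sets[OF fin]
  have Lm: "(\<lambda>p. vsub I z (L p)) \<in> ?M \<rightarrow>\<^sub>M ?M" "(\<lambda>p. vadd I z (L p)) \<in> ?M \<rightarrow>\<^sub>M ?M"
    using L by (auto intro!: measurable_restrict)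
  note Gm = measurable_compose[OF Lm(1) gaussian_density_measurable] measurable_compose[OF Lm(2) gaussian_density_measurable]
  have pt: "2 * ?G z \<le> ennreal (exp \<kappa>) * (?G (vsub I z (L p)) + ?G (vadd I z (L p)))"
    if p: "p \<in> polydisc I" for p
  proof -
    let ?P = "\<lambda>f. \<Prod>i\<in>I. exp (- (cmod (f i))\<^sup>2) / pi"
    have G: "?G f = ennreal (?P f)" for f
      unfolding gaussian_density_def by (simp add: prod_ennreal)
    have P0: "?P f \<ge> 0" for f by (intro prod_nonneg) simp
    have "2 * ?P z * exp (- \<kappa>) \<le> 2 * ?P z * exp (- (\<Sum>i\<in>I. (cmod (L p i))\<^sup>2))"
      using \<kappa>[OF p] P0 by (intro mult_left_mono) auto
    also have "\<dots> \<le> ?P (\<lambda>i. z i - L p i) + ?P (\<lambda>i. z i + L p i)"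
      by (rule gaussian_symmetrize)
    also have "\<dots> = ?P (vsub I z (L p)) + ?P (vadd I z (L p))"
      by (intro arg_cong2[of _ _ _ _ "(+)"] prod.cong) auto
    finally have "2 * ?P z \<le> exp \<kappa> * (?P (vsub I z (L p)) + ?P (vadd I z (L p)))"
      by (simp add: exp_minus field_simps)
    hence "ennreal (2 * ?P z) \<le> ennreal (exp \<kappa> * (?P (vsub I z (L p)) + ?P (vadd I z (L p))))"
      by (rule ennreal_leI)
    thus ?thesis using P0 unfolding G by (simp add: ennreal_mult ennreal_plus[symmetric] del: ennreal_plus)
  qed
  have "2 * (?G z * emeasure ?M (polydisc I)) = (\<integral>\<^sup>+p. 2 * ?G z * indicator (polydisc I) p \<partial>?M)"
    by (subst nn_integral_cmult) (auto simp: mult.assoc)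
  also have "\<dots> \<le> (\<integral>\<^sup>+p. ennreal (exp \<kappa>) * (indicator (polydisc I) p * ?G (vsub I z (L p))
      + indicator (polydisc I) p * ?G (vadd I z (L p))) \<partial>?M)"
    by (intro nn_integral_mono) (use pt in \<open>auto simp: indicator_def\<close>)
  also have "\<dots> = ennreal (exp \<kappa>) * ((\<integral>\<^sup>+p. indicator (polydisc I) p * ?G (vsub I z (L p)) \<partial>?M)
      + (\<integral>\<^sup>+p. indicator (polydisc I) p * ?G (vadd I z (L p)) \<partial>?M))"
    using Gm by (subst nn_integral_cmult) (auto simp: nn_integral_add)
  also have "(\<integral>\<^sup>+p. indicator (polydisc I) p * ?G (vadd I z (L p)) \<partial>?M)
      = (\<integral>\<^sup>+p. indicator (polydisc I) p * ?G (vsub I z (L p)) \<partial>?M)"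
  proof -
    have "(\<integral>\<^sup>+p. indicator (polydisc I) p * ?G (vsub I z (L p)) \<partial>?M)
        = (\<integral>\<^sup>+p. (\<lambda>p. indicator (polydisc I) p * ?G (vsub I z (L p))) (\<lambda>i\<in>I. - p i) \<partial>?M)"
      using Gm by (intro nn_integral_PiM_map[symmetric] fin distr_lborel_uminus lborel.sigma_finite_measure_axioms) auto
    also have "\<dots> = (\<integral>\<^sup>+p. indicator (polydisc I) p * ?G (vadd I z (L p)) \<partial>?M)"
    proof (rule nn_integral_cong)
      fix p assume "p \<in> space ?M"
      hence iff: "(\<lambda>i\<in>I. - p i) \<in> polydisc I \<longleftrightarrow> p \<in> polydisc I"
        by (auto simp: PiE_iff space_PiM)
      show "indicator (polydisc I) (\<lambda>i\<in>I. - p i) * ?G (vsub I z (L (\<lambda>i\<in>I. - p i)))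
          = indicator (polydisc I) p * ?G (vadd I z (L p))"
      proof (cases "p \<in> polydisc I")
        case True
        hence "vsub I z (L (\<lambda>i\<in>I. - p i)) = vadd I z (L p)"
          by (intro restrict_ext) (simp add: odd)
        thus ?thesis using iff True by simp
      qed (use iff in simp)
    qed
    finally show ?thesis ..
  qed
  finally have "2 * (?G z * emeasure ?M (polydisc I))
      \<le> 2 * (ennreal (exp \<kappa>) * (\<integral>\<^sup>+p. indicator (polydisc I) p * ?G (vsub I z (L p)) \<partial>?M))"
    by (simp only: mult_2 distrib_left)
  thus ?thesis by (subst (asm) ennreal_mult_le_mult_iff) auto
qed

text \<open>Every noise vector is smeared over the shifts \<^term>\<open>L p\<close>
  with \<^term>\<open>p\<close> in the polydisc, at the price of the factor \<^term>\<open>exp \<kappa>\<close>.  A shift of message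
  \<^term>\<open>w\<close> is then parametrized by its centre \<^term>\<open>T w\<close> displaced by \<^term>\<open>p\<close>, and for distinct
  messages these parameter sets do not overlap, so that their volumes add up.\<close>

lemma (in interference_channel) gaussian_packing:
  fixes A :: "'msg \<Rightarrow> ('i \<Rightarrow> complex) set"
  assumes fin: "finite I" "finite W"
    and A: "\<And>w. w \<in> W \<Longrightarrow> A w \<in> sets (PiM I (\<lambda>_. lborel))"
    and L: "\<And>i. i \<in> I \<Longrightarrow> (\<lambda>p. L p i) \<in> borel_measurable (PiM I (\<lambda>_. lborel))"
    and odd: "\<And>p i. p \<in> polydisc I \<Longrightarrow> i \<in> I \<Longrightarrow> L (\<lambda>i\<in>I. - p i) i = - L p i"
    and \<kappa>: "\<And>p. p \<in> polydisc I \<Longrightarrow> (\<Sum>i\<in>I. (cmod (L p i))\<^sup>2) \<le> \<kappa>"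
    and disjoint: "\<And>w w' \<nu> v. w \<in> W \<Longrightarrow> w' \<in> W \<Longrightarrow> w \<noteq> w' \<Longrightarrow>
       vadd I \<nu> (L (vsub I v (T w))) \<in> A w \<Longrightarrow> vadd I \<nu> (L (vsub I v (T w'))) \<in> A w' \<Longrightarrow> False"
    and \<Psi>: "\<Psi> \<in> borel_measurable (PiM I (\<lambda>_. lborel))"
    and weight: "\<And>w v. w \<in> W \<Longrightarrow> v \<in> extensional I \<Longrightarrow> vsub I v (T w) \<in> polydisc I \<Longrightarrow> 1 \<le> D * \<Psi> v"
  shows "(\<Sum>w\<in>W. emeasure (PiM I (\<lambda>_. CN)) (A w)) * emeasure (PiM I (\<lambda>_. lborel)) (polydisc I)
     \<le> ennreal (exp \<kappa>) * (D * (\<integral>\<^sup>+v. \<Psi> v \<partial>PiM I (\<lambda>_. lborel)))"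
proof -
  let ?M = "PiM I (\<lambda>_. lborel :: complex measure)"
  let ?G = "gaussian_density I"
  let ?Bx = "indicator (polydisc I) :: _ \<Rightarrow> ennreal"
  note [measurable] = polydisc_sets[OF fin(1)] \<Psi>
  interpret PS: product_sigma_finite "\<lambda>_::'i. lborel :: complex measure"
    by (rule product_sigma_finite_const[OF lborel.sigma_finite_measure_axioms])
  interpret S: sigma_finite_measure ?M by (rule PS.sigma_finite[OF fin(1)])
  interpret P: pair_sigma_finite ?M ?M ..
  have CN_eq: "CN = density lborel (\<lambda>z. ennreal (exp (- (cmod z)\<^sup>2) / pi))" by (simp add: CN_def)
  have emA: "emeasure (PiM I (\<lambda>_. CN)) (A w) = (\<integral>\<^sup>+z. indicator (A w) z * ?G z \<partial>?M)" if w: "w \<in> W" for w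
  proof -
    have "A w \<in> sets (PiM I (\<lambda>_. CN))"
      using A[OF w] by (simp add: sets_PiM_lborel cong: sets_PiM_cong)
    hence "emeasure (PiM I (\<lambda>_. CN)) (A w) = (\<integral>\<^sup>+z. indicator (A w) z \<partial>PiM I (\<lambda>_. CN))"
      by simp
    also have "\<dots> = (\<integral>\<^sup>+z. indicator (A w) z * ?G z \<partial>?M)"
      unfolding CN_eq gaussian_density_def using A[OF w] prob_space_imp_sigma_finite[OF prob_CN]
      by (intro nn_integral_PiM_density fin lborel.sigma_finite_measure_axioms) (auto simp: CN_def)
    finally show ?thesis .
  qed
  have G1: "(\<integral>\<^sup>+\<nu>. ?G \<nu> \<partial>?M) = 1"
  proof -
    have "(\<integral>\<^sup>+\<nu>. ?G \<nu> \<partial>?M) = (\<integral>\<^sup>+\<nu>. 1 * ?G \<nu> \<partial>?M)" by simp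
    also have "\<dots> = (\<integral>\<^sup>+\<nu>. 1 \<partial>PiM I (\<lambda>_. CN))"
      unfolding CN_eq gaussian_density_def using prob_space_imp_sigma_finite[OF prob_CN]
      by (intro nn_integral_PiM_density[symmetric] fin lborel.sigma_finite_measure_axioms) (auto simp: CN_def)
    also have "\<dots> = 1"
      using prob_space.emeasure_space_1[OF prob_space_PiM[of I "\<lambda>_. CN", OF prob_CN]] by simp
    finally show ?thesis .
  qed
  have L2: "(\<lambda>x. L (f x) i) \<in> borel_measurable N" if "f \<in> N \<rightarrow>\<^sub>M ?M" "i \<in> I" for f i and N :: "'z measure"
    by (rule measurable_compose[OF that(1) L[OF that(2)]])
  have comp: "(\<lambda>x. f x i) \<in> borel_measurable N" if "f \<in> N \<rightarrow>\<^sub>M ?M" "i \<in> I" for f i and N :: "'z measure"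
    using measurable_compose[OF that(1) measurable_component_singleton[OF that(2)]] by simp
  have vadd_m: "(\<lambda>q. vadd I (f q) (L (g q))) \<in> N \<rightarrow>\<^sub>M ?M"
    if "f \<in> N \<rightarrow>\<^sub>M ?M" "g \<in> N \<rightarrow>\<^sub>M ?M" for f g and N :: "'z measure"
    using comp[OF that(1)] L2[OF that(2)] by (auto intro!: measurable_restrict)
  have vsub_m: "(\<lambda>q. vsub I (f q) (L (g q))) \<in> N \<rightarrow>\<^sub>M ?M"
    if "f \<in> N \<rightarrow>\<^sub>M ?M" "g \<in> N \<rightarrow>\<^sub>M ?M" for f g and N :: "'z measure"
    using comp[OF that(1)] L2[OF that(2)] by (auto intro!: measurable_restrict)
  have vsubT_m: "(\<lambda>q. vsub I (f q) (T w)) \<in> N \<rightarrow>\<^sub>M ?M"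
    if "f \<in> N \<rightarrow>\<^sub>M ?M" for f w and N :: "'z measure"
    using comp[OF that(1)] by (auto intro!: measurable_restrict)
  note fs = measurable_fst[of ?M ?M] measurable_snd[of ?M ?M]
  have indA: "(\<lambda>x. indicator (A w) (f x) :: ennreal) \<in> borel_measurable N"
    if "w \<in> W" "f \<in> N \<rightarrow>\<^sub>M ?M" for f w and N :: "'z measure"
    using A[OF that(1)] by (intro measurable_compose[OF that(2)]) simp
  have indB: "(\<lambda>x. ?Bx (f x)) \<in> borel_measurable N" if "f \<in> N \<rightarrow>\<^sub>M ?M" for f and N :: "'z measure"
    by (intro measurable_compose[OF that]) simp
  note Gc = measurable_compose[OF _ gaussian_density_measurable]
  \<comment> \<open>Coordinates after two substitutions: \<open>\<nu>\<close> is the noise before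
    the shift and \<open>v\<close> the shift parameter moved by the centre \<open>T w\<close>. For
    fixed \<open>\<nu>\<close> and \<open>v\<close> the hypothesis \<open>disjoint\<close> allows at
    most one message.\<close>
  define F where "F w \<nu> v = indicator (A w) (vadd I \<nu> (L (vsub I v (T w)))) * ?Bx (vsub I v (T w))" for w \<nu> v
  have Fm: "(\<lambda>v. F w \<nu> v) \<in> borel_measurable ?M" if "w \<in> W" "\<nu> \<in> space ?M" for w \<nu>
    unfolding F_def using that
    by (intro borel_measurable_times_ennreal indA indB vadd_m vsubT_m) auto
  have Fm2: "(\<lambda>q. F w (fst q) (snd q)) \<in> borel_measurable (?M \<Otimes>\<^sub>M ?M)" if "w \<in> W" for w
    unfolding F_def by (intro borel_measurable_times_ennreal indA indB vadd_m vsubT_m fs that)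
  have Fi: "(\<lambda>\<nu>. \<integral>\<^sup>+v. F w \<nu> v \<partial>?M) \<in> borel_measurable ?M" if "w \<in> W" for w
    using S.borel_measurable_nn_integral_fst[OF Fm2[OF that]] by simp
  have one: "emeasure (PiM I (\<lambda>_. CN)) (A w) * emeasure ?M (polydisc I)
      \<le> ennreal (exp \<kappa>) * (\<integral>\<^sup>+\<nu>. ?G \<nu> * (\<integral>\<^sup>+v. F w \<nu> v \<partial>?M) \<partial>?M)" if w: "w \<in> W" for w
  proof -
    define f1 where "f1 z p = indicator (A w) z * (?Bx p * ?G (vsub I z (L p)))" for z p
    define f2 where "f2 \<nu> p = indicator (A w) (vadd I \<nu> (L p)) * (?Bx p * ?G \<nu>)" for \<nu> p
    have f1m: "(\<lambda>q. f1 (fst q) (snd q)) \<in> borel_measurable (?M \<Otimes>\<^sub>M ?M)"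
      unfolding f1_def by (intro borel_measurable_times_ennreal indA[OF w] indB Gc vsub_m fs)
    have f2m: "(\<lambda>q. f2 (fst q) (snd q)) \<in> borel_measurable (?M \<Otimes>\<^sub>M ?M)"
      unfolding f2_def by (intro borel_measurable_times_ennreal indA[OF w] indB Gc vadd_m fs)
    have f1a: "(\<lambda>p. ?Bx p * ?G (vsub I z (L p))) \<in> borel_measurable ?M" if "z \<in> space ?M" for z
      using that by (intro borel_measurable_times_ennreal indB Gc vsub_m) auto
    have f1b: "(\<lambda>z. f1 z p) \<in> borel_measurable ?M" if "p \<in> space ?M" for p
      unfolding f1_def using that by (intro borel_measurable_times_ennreal indA[OF w] indB Gc vsub_m) auto
    have f2b: "(\<lambda>p. f2 \<nu> p) \<in> borel_measurable ?M" if "\<nu> \<in> space ?M" for \<nu>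
      unfolding f2_def using that by (intro borel_measurable_times_ennreal indA[OF w] indB vadd_m) auto
    have "emeasure (PiM I (\<lambda>_. CN)) (A w) * emeasure ?M (polydisc I)
        = (\<integral>\<^sup>+z. indicator (A w) z * (?G z * emeasure ?M (polydisc I)) \<partial>?M)"
      unfolding emA[OF w] using A[OF w] by (subst nn_integral_multc[symmetric]) (auto simp: mult.assoc)
    also have "\<dots> \<le> (\<integral>\<^sup>+z. ennreal (exp \<kappa>) * (\<integral>\<^sup>+p. f1 z p \<partial>?M) \<partial>?M)"
    proof (rule nn_integral_mono)
      fix z assume z: "z \<in> space ?M"
      have "indicator (A w) z * (?G z * emeasure ?M (polydisc I))
          \<le> indicator (A w) z * (ennreal (exp \<kappa>) * (\<integral>\<^sup>+p. ?Bx p * ?G (vsub I z (L p)) \<partial>?M))"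
        by (intro mult_left_mono gaussian_shift_average[OF fin(1) L odd \<kappa>]) auto
      also have "\<dots> = ennreal (exp \<kappa>) * (\<integral>\<^sup>+p. f1 z p \<partial>?M)"
        unfolding f1_def using f1a[OF z] by (subst nn_integral_cmult) (auto simp: mult_ac)
      finally show "indicator (A w) z * (?G z * emeasure ?M (polydisc I)) \<le> ennreal (exp \<kappa>) * (\<integral>\<^sup>+p. f1 z p \<partial>?M)" .
    qed
    also have "\<dots> = ennreal (exp \<kappa>) * (\<integral>\<^sup>+z. \<integral>\<^sup>+p. f1 z p \<partial>?M \<partial>?M)"
      using S.borel_measurable_nn_integral_fst[OF f1m] by (intro nn_integral_cmult) simp
    also have "(\<integral>\<^sup>+z. \<integral>\<^sup>+p. f1 z p \<partial>?M \<partial>?M) = (\<integral>\<^sup>+p. \<integral>\<^sup>+z. f1 z p \<partial>?M \<partial>?M)"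
      using P.Fubini[OF f1m] by simp
    also have "\<dots> = (\<integral>\<^sup>+p. \<integral>\<^sup>+\<nu>. f2 \<nu> p \<partial>?M \<partial>?M)"
    proof (rule nn_integral_cong)
      fix p assume p: "p \<in> space ?M"
      have "(\<integral>\<^sup>+z. f1 z p \<partial>?M) = (\<integral>\<^sup>+\<nu>. f1 (vadd I \<nu> (L p)) p \<partial>?M)"
        by (rule nn_integral_PiM_translate[OF fin(1) f1b[OF p], symmetric])
      also have "\<dots> = (\<integral>\<^sup>+\<nu>. f2 \<nu> p \<partial>?M)"
      proof -
        have "?G (vsub I (vadd I \<nu> (L p)) (L p)) = ?G \<nu>" for \<nu>
          unfolding gaussian_density_def by (intro prod.cong) auto
        thus ?thesis by (simp only: f1_def f2_def)
      qed
      finally show "(\<integral>\<^sup>+z. f1 z p \<partial>?M) = (\<integral>\<^sup>+\<nu>. f2 \<nu> p \<partial>?M)" .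
    qed
    also have "\<dots> = (\<integral>\<^sup>+\<nu>. \<integral>\<^sup>+p. f2 \<nu> p \<partial>?M \<partial>?M)"
      using P.Fubini[OF f2m] by simp
    also have "\<dots> = (\<integral>\<^sup>+\<nu>. ?G \<nu> * (\<integral>\<^sup>+v. F w \<nu> v \<partial>?M) \<partial>?M)"
    proof (rule nn_integral_cong)
      fix \<nu> assume \<nu>: "\<nu> \<in> space ?M"
      have "(\<integral>\<^sup>+p. f2 \<nu> p \<partial>?M) = (\<integral>\<^sup>+v. f2 \<nu> (vadd I v (\<lambda>i. - T w i)) \<partial>?M)"
        by (rule nn_integral_PiM_translate[OF fin(1) f2b[OF \<nu>], symmetric])
      also have "\<dots> = (\<integral>\<^sup>+v. ?G \<nu> * F w \<nu> v \<partial>?M)"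
        by (simp add: f2_def F_def mult_ac)
      also have "\<dots> = ?G \<nu> * (\<integral>\<^sup>+v. F w \<nu> v \<partial>?M)"
        by (rule nn_integral_cmult[OF Fm[OF w \<nu>]])
      finally show "(\<integral>\<^sup>+p. f2 \<nu> p \<partial>?M) = ?G \<nu> * (\<integral>\<^sup>+v. F w \<nu> v \<partial>?M)" .
    qed
    finally show ?thesis .
  qed
  \<comment> \<open>Since only one message can contribute, the sum over \<open>W\<close> is at most
    1, and it is nonzero only where the weight makes \<open>D * \<Psi> v\<close> at least 1.\<close>
  have bound: "(\<Sum>w\<in>W. F w \<nu> v) \<le> D * \<Psi> v" if v: "v \<in> space ?M" for \<nu> v
  proof (cases "\<exists>w\<in>W. F w \<nu> v \<noteq> 0")
    case True
    then obtain w where w: "w \<in> W" "F w \<nu> v \<noteq> 0" by blast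
    hence hit: "vadd I \<nu> (L (vsub I v (T w))) \<in> A w" "vsub I v (T w) \<in> polydisc I"
      by (auto simp: F_def indicator_def split: if_splits)
    have "F w' \<nu> v = 0" if "w' \<in> W" "w' \<noteq> w" for w'
      using disjoint[OF w(1) that(1) that(2)[symmetric] hit(1)] by (auto simp: F_def indicator_def)
    hence "(\<Sum>w\<in>W. F w \<nu> v) = F w \<nu> v"
      using fin(2) w(1) by (subst sum.remove[OF fin(2) w(1)]) simp
    also have "\<dots> \<le> 1" by (simp add: F_def indicator_def)
    also have "1 \<le> D * \<Psi> v" using v hit by (intro weight[OF w(1)]) (auto simp: space_PiM PiE_def)
    finally show ?thesis .
  qed simp
  have "(\<Sum>w\<in>W. emeasure (PiM I (\<lambda>_. CN)) (A w)) * emeasure ?M (polydisc I)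
      \<le> (\<Sum>w\<in>W. ennreal (exp \<kappa>) * (\<integral>\<^sup>+\<nu>. ?G \<nu> * (\<integral>\<^sup>+v. F w \<nu> v \<partial>?M) \<partial>?M))"
    unfolding sum_distrib_right by (intro sum_mono one)
  also have "\<dots> = ennreal (exp \<kappa>) * (\<integral>\<^sup>+\<nu>. (\<Sum>w\<in>W. ?G \<nu> * (\<integral>\<^sup>+v. F w \<nu> v \<partial>?M)) \<partial>?M)"
    using Fi by (subst nn_integral_sum) (auto simp: sum_distrib_left)
  also have "\<dots> \<le> ennreal (exp \<kappa>) * (\<integral>\<^sup>+\<nu>. ?G \<nu> * (D * (\<integral>\<^sup>+v. \<Psi> v \<partial>?M)) \<partial>?M)"
  proof (intro mult_left_mono nn_integral_mono)
    fix \<nu> assume \<nu>: "\<nu> \<in> space ?M"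
    have "(\<Sum>w\<in>W. ?G \<nu> * (\<integral>\<^sup>+v. F w \<nu> v \<partial>?M)) = ?G \<nu> * (\<integral>\<^sup>+v. (\<Sum>w\<in>W. F w \<nu> v) \<partial>?M)"
      using Fm \<nu> by (subst nn_integral_sum) (auto simp: sum_distrib_left)
    also have "\<dots> \<le> ?G \<nu> * (\<integral>\<^sup>+v. D * \<Psi> v \<partial>?M)"
      by (intro mult_left_mono nn_integral_mono bound) auto
    also have "\<dots> = ?G \<nu> * (D * (\<integral>\<^sup>+v. \<Psi> v \<partial>?M))"
      by (simp only: nn_integral_cmult[OF \<Psi>])
    finally show "(\<Sum>w\<in>W. ?G \<nu> * (\<integral>\<^sup>+v. F w \<nu> v \<partial>?M)) \<le> ?G \<nu> * (D * (\<integral>\<^sup>+v. \<Psi> v \<partial>?M))" .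
  qed simp
  also have "(\<integral>\<^sup>+\<nu>. ?G \<nu> * (D * (\<integral>\<^sup>+v. \<Psi> v \<partial>?M)) \<partial>?M) = D * (\<integral>\<^sup>+v. \<Psi> v \<partial>?M)"
    by (simp add: nn_integral_multc G1)
  finally show ?thesis .
qed

lemma emeasure_polydisc:
  assumes "finite I"
  shows "emeasure (PiM I (\<lambda>_. lborel :: complex measure)) (polydisc I) = ennreal pi ^ card I"
proof -
  interpret PS: product_sigma_finite "\<lambda>_::'a. lborel :: complex measure"
    by (rule product_sigma_finite_const[OF lborel.sigma_finite_measure_axioms])
  have "emeasure lborel (cball (0::complex) 1) = ennreal pi"
    by (subst emeasure_cball) (auto simp: unit_ball_vol_2)
  thus ?thesis using assms by (subst PS.emeasure_PiM) auto
qed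

section \<open>Volume bound for a fixed channel state\<close>

context interference_channel
begin

text \<open>A coordinate of power \<open>P\<close> contributes the volume \<open>pi * P\<close>,
  against \<open>pi\<close> for a unit disc; this is where powers of \<open>P\<close> enter the
  converse.\<close>

lemma nn_integral_gaussian:
  assumes P: "P > 0"
  shows "(\<integral>\<^sup>+z. ennreal (exp (- (cmod z)\<^sup>2 / P)) \<partial>lborel) = ennreal (pi * P)"
proof -
  have "(\<integral>\<^sup>+z. ennreal (exp (- (cmod z)\<^sup>2) / pi) \<partial>lborel) = 1"
    using prob_space.emeasure_space_1[OF prob_CN] unfolding CN_def by (subst (asm) emeasure_density) auto
  hence g: "(\<integral>\<^sup>+z. ennreal (exp (- (cmod z)\<^sup>2)) \<partial>lborel) = ennreal pi"
  proof -
    have "(\<integral>\<^sup>+z. ennreal (exp (- (cmod z)\<^sup>2)) \<partial>lborel) = (\<integral>\<^sup>+z. ennreal pi * ennreal (exp (- (cmod z)\<^sup>2) / pi) \<partial>lborel)"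
      by (intro nn_integral_cong) (simp add: ennreal_mult[symmetric])
    also have "\<dots> = ennreal pi * (\<integral>\<^sup>+z. ennreal (exp (- (cmod z)\<^sup>2) / pi) \<partial>lborel)"
      by (rule nn_integral_cmult) measurable
    finally show ?thesis using \<open>(\<integral>\<^sup>+z. ennreal (exp (- (cmod z)\<^sup>2) / pi) \<partial>lborel) = 1\<close> by simp
  qed
  define s where "s = sqrt P"
  have s: "s > 0" "s\<^sup>2 = P" using P by (auto simp: s_def)
  have "(lborel :: complex measure) = density (distr lborel borel (\<lambda>x. 0 + s *\<^sub>R x)) (\<lambda>_. \<bar>s\<bar> ^ DIM(complex))"
    using lborel_affine[of s "0 :: complex"] s by simp
  also have "\<bar>s\<bar> ^ DIM(complex) = P" using s by simp
  finally have "(\<integral>\<^sup>+z. ennreal (exp (- (cmod z)\<^sup>2 / P)) \<partial>lborel)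
      = (\<integral>\<^sup>+z. ennreal (exp (- (cmod z)\<^sup>2 / P)) \<partial>density (distr lborel borel (\<lambda>x. 0 + s *\<^sub>R x)) (\<lambda>_. ennreal P))"
    by (rule arg_cong)
  also have "\<dots> = (\<integral>\<^sup>+z. ennreal P * ennreal (exp (- (cmod (s *\<^sub>R z))\<^sup>2 / P)) \<partial>lborel)"
    by (simp add: nn_integral_density nn_integral_distr)
  also have "\<dots> = (\<integral>\<^sup>+z. ennreal P * ennreal (exp (- (cmod z)\<^sup>2)) \<partial>lborel)"
    using s P by (simp add: power_mult_distrib)
  also have "\<dots> = ennreal (pi * P)"
    using P by (subst nn_integral_cmult) (auto simp: g ennreal_mult[symmetric] mult.commute)
  finally show ?thesis .
qed

lemma noise_entries_eq: "noise_entries n = Inr ` ({..<n} \<times> UNIV)"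
  by (auto simp: noise_entries_def entries_def)

lemma finite_noise_entries [simp, intro]: "finite (noise_entries n)"
  by (simp add: noise_entries_eq)

lemma sum_noise_entries:
  "(\<Sum>e\<in>noise_entries n. f e) = (\<Sum>t<n. \<Sum>jj\<in>UNIV. \<Sum>r\<in>UNIV. f (Inr (t, jj, r)))"
proof -
  have "(\<Sum>e\<in>noise_entries n. f e) = (\<Sum>x\<in>{..<n} \<times> UNIV \<times> UNIV. f (Inr x))"
    unfolding noise_entries_eq by (subst sum.reindex) (auto simp: comp_def)
  thus ?thesis by (simp only: sum.cartesian_product')
qed

definition signal :: "('j, 'k, 'm) block_code \<Rightarrow> (nat \<Rightarrow> ('j, 'k, 'm) channel_state) \<Rightarrow> ('k \<Rightarrow> nat) \<Rightarrow> 'j \<Rightarrow> nat \<Rightarrow> complex ^ 'm" where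
  "signal c S w j t = (\<Sum>k\<in>UNIV. S t $ j $ k *v encode c k (w k) S t)"

text \<open>The received block as a function of state and noise separately, so that the noise can be
  shifted at a fixed state.\<close>

definition receive :: "('j, 'k, 'm) block_code \<Rightarrow> nat \<Rightarrow> (nat \<Rightarrow> ('j, 'k, 'm) channel_state) \<Rightarrow> ('k \<Rightarrow> nat) \<Rightarrow> 'j \<Rightarrow>
    (('j, 'k, 'm) entry \<Rightarrow> complex) \<Rightarrow> nat \<Rightarrow> complex ^ 'm" where
  "receive c n S w j z = (\<lambda>t\<in>{..<n}. signal c S w j t + (\<chi> r. z (Inr (t, j, r))))"

definition correct where
  "correct c n demand j j' i S w = {z \<in> space (PiM (noise_entries n) (\<lambda>_. lborel :: complex measure)).
     (\<forall>k\<in>demand j. decode c j k (receive c n S w j z) S = w k) \<and> decode c j' i (receive c n S w j' z) S = w i}"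

lemma received_block_eq:
  "received_block H Z n c w j \<omega> = receive c n (state_block H n \<omega>) w j (\<lambda>i\<in>noise_entries n. X i \<omega>)"
proof (rule ext)
  fix t
  show "received_block H Z n c w j \<omega> t = receive c n (state_block H n \<omega>) w j (\<lambda>i\<in>noise_entries n. X i \<omega>) t"
  proof (cases "t < n")
    case True
    hence "(\<chi> r. (\<lambda>i\<in>noise_entries n. X i \<omega>) (Inr (t, j, r))) = Z t \<omega> $ j"
      by (simp add: noise_entries_eq vec_eq_iff)
    thus ?thesis using True by (simp add: received_block_def receive_def signal_def state_block_def)
  qed (simp add: received_block_def receive_def)
qed

lemma receive_measurable:
  "(\<lambda>z. receive c n S w j z) \<in> PiM (noise_entries n) (\<lambda>_. lborel) \<rightarrow>\<^sub>M PiM {..<n} (\<lambda>_. borel)"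
  unfolding receive_def
proof (rule measurable_restrict)
  fix t assume t: "t \<in> {..<n}"
  have "(\<lambda>z. \<chi> r. z (Inr (t, j, r))) \<in> borel_measurable (PiM (noise_entries n) (\<lambda>_. lborel :: complex measure))"
  proof (rule borel_measurable_vec_lambda)
    fix r
    have "(\<lambda>z. z (Inr (t, j, r))) \<in> PiM (noise_entries n) (\<lambda>_. lborel :: complex measure) \<rightarrow>\<^sub>M lborel"
      using t by (intro measurable_component_singleton) (auto simp: noise_entries_eq)
    thus "(\<lambda>z. z (Inr (t, j, r))) \<in> borel_measurable (PiM (noise_entries n) (\<lambda>_. lborel :: complex measure))"
      by simp
  qed
  thus "(\<lambda>z. signal c S w j t + (\<chi> r. z (Inr (t, j, r)))) \<in> borel_measurable (PiM (noise_entries n) (\<lambda>_. lborel :: complex measure))"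
    by (intro borel_measurable_add) auto
qed

lemma correct_sets:
  assumes c: "measurable_code n c" and S: "S \<in> space (PiM {..<n} (\<lambda>_. borel))"
  shows "correct c n demand j j' i S w \<in> sets (PiM (noise_entries n) (\<lambda>_. lborel))"
proof -
  let ?M = "PiM (noise_entries n) (\<lambda>_. lborel :: complex measure)"
  have d: "Measurable.pred ?M (\<lambda>z. decode c j k (receive c n S w j z) S = u)" for j k u
  proof -
    have "(\<lambda>z. (receive c n S w j z, S)) \<in> ?M \<rightarrow>\<^sub>M PiM {..<n} (\<lambda>_. borel) \<Otimes>\<^sub>M PiM {..<n} (\<lambda>_. borel)"
      using S by (intro measurable_Pair receive_measurable) auto
    moreover have "(\<lambda>(y, s). decode c j k y s) \<in> (PiM {..<n} (\<lambda>_. borel) \<Otimes>\<^sub>M PiM {..<n} (\<lambda>_. borel)) \<rightarrow>\<^sub>M count_space UNIV"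
      using c by (simp add: measurable_code_def)
    ultimately have "(\<lambda>z. decode c j k (receive c n S w j z) S) \<in> ?M \<rightarrow>\<^sub>M count_space UNIV"
      using measurable_compose by fastforce
    thus ?thesis by measurable
  qed
  have "Measurable.pred ?M (\<lambda>z. (\<forall>k\<in>demand j. decode c j k (receive c n S w j z) S = w k)
      \<and> decode c j' i (receive c n S w j' z) S = w i)"
    by (intro pred_intros_logic pred_ball_countable countable_finite d finite)
  thus ?thesis by (simp only: correct_def pred_def)
qed

text \<open>\<open>B t\<close> acts as the channel from \<open>i\<close> to \<open>j'\<close> after
  the inverse of that from \<open>i\<close> to \<open>j\<close>. Shifting the noise of
  \<open>j\<close> freely and that of \<open>j'\<close> by its image under \<open>B t\<close>
  imitates at both receivers a change of message \<open>i\<close>. Only the coordinates of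
  \<open>j\<close>, and those of \<open>j'\<close> during \<open>bd\<close>, cost a factor
  \<open>P\<close>, whence the exponent \<open>CARD('m) * (n + card bd)\<close>.\<close>

lemma packing_per_state:
  fixes demand :: "'j \<Rightarrow> 'k set" and B :: "nat \<Rightarrow> 'm \<Rightarrow> 'm \<Rightarrow> complex" and bd :: "nat set"
  assumes j': "i \<in> demand j'" "i \<notin> demand j \<Longrightarrow> j' \<noteq> j"
    and B: "\<And>t x r. t < n \<Longrightarrow> t \<notin> bd \<Longrightarrow> (\<Sum>c\<in>UNIV. B t r c * (S t $ j $ i *v x) $ c) = (S t $ j' $ i *v x) $ r"
    and B_le: "\<And>t r c. t < n \<Longrightarrow> t \<notin> bd \<Longrightarrow> cmod (B t r c) \<le> \<Lambda>"
    and c: "measurable_code n c" and S: "S \<in> space (PiM {..<n} (\<lambda>_. borel))"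
    and W: "finite W" "\<And>w w' k. w \<in> W \<Longrightarrow> w' \<in> W \<Longrightarrow> k \<notin> insert i (demand j) \<Longrightarrow> w k = w' k"
    and energy: "\<And>w. w \<in> W \<Longrightarrow>
        (\<Sum>t<n. (norm (signal c S w j t))\<^sup>2 + (norm (signal c S w j' t))\<^sup>2) \<le> \<rho> * real n * P"
    and P: "P \<ge> 1" and bd: "bd \<subseteq> {..<n}" and \<Lambda>: "\<Lambda> \<ge> 0"
  shows "(\<Sum>w\<in>W. emeasure (PiM (noise_entries n) (\<lambda>_. CN)) (correct c n demand j j' i S w))
     \<le> ennreal (exp (real n * (real CARD('m) * (6 + (real CARD('m) * \<Lambda>)\<^sup>2) + 2 * \<rho>)) * P ^ (CARD('m) * (n + card bd)))"
proof -
  let ?I = "noise_entries n"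
  let ?M = "PiM ?I (\<lambda>_. lborel :: complex measure)"
  define M where "M = real CARD('m)"
  \<comment> \<open>The active coordinates, where the shift is free and a factor \<open>P\<close> is
    charged; at the other coordinates of \<open>j'\<close> the shift is determined by that of
    \<open>j\<close>.\<close>
  define act where "act = (\<lambda>(t, jj, r :: 'm). jj = j \<or> (jj = j' \<and> t \<in> bd))"
  define T where "T w e = (case e of Inr (t, jj, r) \<Rightarrow> if act (t, jj, r) then signal c S w jj t $ r else 0 | Inl _ \<Rightarrow> 0)"
    for w and e :: "('j, 'k, 'm) entry"
  define L where "L p e = (case e of Inl _ \<Rightarrow> 0
     | Inr (t, jj, r) \<Rightarrow> if act (t, jj, r) then p e
         else if jj = j' then (\<Sum>c\<in>UNIV. B t r c * p (Inr (t, j, c))) else 0)"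
    for p :: "('j, 'k, 'm) entry \<Rightarrow> complex" and e :: "('j, 'k, 'm) entry"
  \<comment> \<open>A Gaussian weight of scale \<open>P\<close> where the output is free and a unit
    disc elsewhere. The powers of \<open>pi\<close> then cancel against the volume of the
    polydisc.\<close>
  define \<psi> where "\<psi> e z = (case e of Inl _ \<Rightarrow> 1
     | Inr x \<Rightarrow> if act x then ennreal (exp (- (cmod z)\<^sup>2 / P)) else indicator (cball 0 1) z)"
    for e :: "('j, 'k, 'm) entry" and z :: complex
  define \<Psi> where "\<Psi> v = (\<Prod>e\<in>?I. \<psi> e (v e))" for v
  \<comment> \<open>Squared length of the shift per time: \<open>M\<close> from receiver
    \<open>j\<close> and at most \<open>M * (1 + (M * \<Lambda>)^2)\<close> from
    \<open>j'\<close>.\<close>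
  define \<kappa> where "\<kappa> = real n * (M * (2 + (M * \<Lambda>)\<^sup>2))"
  \<comment> \<open>Compensates the Gaussian weight. With signal \<open>x\<close> at a coordinate,
    \<open>(x + 1)^2 \<le> 2 * x^2 + 2\<close>; the energy bound turns the first term into
    \<open>2 * \<rho>\<close> per time and the second gives \<open>4 * M\<close> over two
    receivers.\<close>
  define D where "D = exp (real n * (2 * \<rho> + 4 * M))"
  have mem: "Inr (t, jj, r) \<in> ?I" if "t < n" for t jj r
    using that by (auto simp: noise_entries_eq)
  have Lm: "(\<lambda>p. L p e) \<in> borel_measurable ?M" if e: "e \<in> ?I" for e
  proof -
    obtain t jj r where e': "e = Inr (t, jj, r)" "t < n" using e by (auto simp: noise_entries_eq)
    have comp: "(\<lambda>p. p e') \<in> borel_measurable ?M" if "e' \<in> ?I" for e'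
      using measurable_component_singleton[OF that, of "\<lambda>_. lborel :: complex measure"] by simp
    have "(\<lambda>p. \<Sum>c\<in>UNIV. B t r c * p (Inr (t, j, c))) \<in> borel_measurable ?M"
      by (intro borel_measurable_sum borel_measurable_times borel_measurable_const comp mem e')
    thus ?thesis using comp[OF e] by (auto simp: L_def e'(1))
  qed
  have odd: "L (\<lambda>i\<in>?I. - p i) e = - L p e" if e: "e \<in> ?I" for p e
  proof -
    obtain t jj r where e': "e = Inr (t, jj, r)" "t < n" using e by (auto simp: noise_entries_eq)
    have "Inr (t, j, c) \<in> ?I" for c using e' by (intro mem)
    thus ?thesis using e by (simp add: L_def e'(1) sum_negf)
  qed
  have \<kappa>: "(\<Sum>e\<in>?I. (cmod (L p e))\<^sup>2) \<le> \<kappa>" if p: "p \<in> polydisc ?I" for p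
  proof -
    have p1: "cmod (p e) \<le> 1" if "e \<in> ?I" for e using p that by (auto simp: PiE_iff)
    have entry: "(cmod (L p (Inr (t, jj, r))))\<^sup>2 \<le> (if jj = j then 1 else 0) + (if jj = j' then 1 + (M * \<Lambda>)\<^sup>2 else 0)"
      if t: "t < n" for t jj r
    proof (cases "act (t, jj, r)")
      case True
      have "(cmod (p (Inr (t, jj, r))))\<^sup>2 \<le> 1\<^sup>2" by (intro power_mono p1 mem t) simp
      moreover have "1 \<le> (if jj = j then 1 else 0) + (if jj = j' then 1 + (M * \<Lambda>)\<^sup>2 else 0)"
        using True by (auto simp: act_def)
      ultimately show ?thesis using True by (simp add: L_def)
    next
      case False
      show ?thesis
      proof (cases "jj = j'")
        case True
        hence t': "t \<notin> bd" using False by (auto simp: act_def)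
        have "cmod (\<Sum>c\<in>UNIV. B t r c * p (Inr (t, j, c))) \<le> (\<Sum>c\<in>(UNIV::'m set). \<Lambda> * 1)"
          by (intro order.trans[OF norm_sum] sum_mono) (unfold norm_mult, intro mult_mono B_le t t' p1 mem \<Lambda> norm_ge_zero)
        also have "\<dots> = M * \<Lambda>" by (simp add: M_def)
        finally have "(cmod (\<Sum>c\<in>UNIV. B t r c * p (Inr (t, j, c))))\<^sup>2 \<le> (M * \<Lambda>)\<^sup>2"
          by (intro power_mono) auto
        thus ?thesis using True False by (auto simp: L_def)
      qed (use False in \<open>simp add: L_def\<close>)
    qed
    have "(\<Sum>e\<in>?I. (cmod (L p e))\<^sup>2)
        \<le> (\<Sum>t<n. \<Sum>jj\<in>UNIV. \<Sum>r\<in>(UNIV::'m set). (if jj = j then 1 else 0) + (if jj = j' then 1 + (M * \<Lambda>)\<^sup>2 else 0))"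
      unfolding sum_noise_entries by (intro sum_mono entry) auto
    also have "\<dots> = (\<Sum>t<n. M * (1 + (1 + (M * \<Lambda>)\<^sup>2)))"
      by (simp add: M_def sum.distrib sum_distrib_left[symmetric] distrib_left)
    also have "\<dots> = \<kappa>" by (simp add: \<kappa>_def)
    finally show ?thesis .
  qed
  have disjoint: False
    if w: "w \<in> W" "w' \<in> W" "w \<noteq> w'" and z: "vadd ?I \<nu> (L (vsub ?I v (T w))) \<in> correct c n demand j j' i S w"
      and z': "vadd ?I \<nu> (L (vsub ?I v (T w'))) \<in> correct c n demand j j' i S w'" for w w' \<nu> v
  proof -
    let ?z = "\<lambda>w. vadd ?I \<nu> (L (vsub ?I v (T w)))"
    \<comment> \<open>The centre \<open>T u\<close> cancels the signal, so the output at an active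
      coordinate is \<open>\<nu> + v\<close> for every message tuple.\<close>
    have at_act: "signal c S u jj t $ r + ?z u (Inr (t, jj, r)) = \<nu> (Inr (t, jj, r)) + v (Inr (t, jj, r))"
      if "t < n" "act (t, jj, r)" for u t jj r
      using that mem[OF that(1)] by (simp add: L_def T_def)
    have "receive c n S w j (?z w) = receive c n S w' j (?z w')"
      unfolding receive_def
    proof (rule restrict_ext)
      fix t assume "t \<in> {..<n}"
      hence "t < n" by simp
      thus "signal c S w j t + (\<chi> r. ?z w (Inr (t, j, r))) = signal c S w' j t + (\<chi> r. ?z w' (Inr (t, j, r)))"
        unfolding vec_eq_iff vector_add_component vec_lambda_beta
        by (subst (1 2) at_act) (auto simp: act_def)
    qed
    hence agree: "w k = w' k" if "k \<in> demand j" for k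
      using z z' that by (auto simp: correct_def)
    show False
    proof (cases "i \<in> demand j")
      case True
      hence "w k = w' k" for k
        using agree W(2)[OF w(1,2), of k] by (cases "k \<in> demand j") auto
      thus False using w(3) by blast
    next
      case False
      have ki: "w k = w' k" if "k \<noteq> i" for k
        using agree W(2)[OF w(1,2), of k] that by (cases "k \<in> demand j") auto
      define base where "base jj t = (\<Sum>k\<in>UNIV - {i}. S t $ jj $ k *v encode c k (w k) S t)" for jj t
      have split: "signal c S u jj t = base jj t + S t $ jj $ i *v encode c i (u i) S t" if "u = w \<or> u = w'" for u jj t
      proof -
        have "signal c S u jj t = S t $ jj $ i *v encode c i (u i) S t + (\<Sum>k\<in>UNIV - {i}. S t $ jj $ k *v encode c k (u k) S t)"
          unfolding signal_def by (subst sum.remove[of _ i]) auto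
        moreover have "(\<Sum>k\<in>UNIV - {i}. S t $ jj $ k *v encode c k (u k) S t) = base jj t"
          unfolding base_def using that ki by (intro sum.cong) auto
        ultimately show ?thesis by (simp add: add.commute)
      qed
      \<comment> \<open>The dependent shift subtracts the image of the signal at \<open>j\<close>.
        Its part from message \<open>i\<close> is exactly what \<open>i\<close> contributes at
        \<open>j'\<close>, so the remaining output depends only on messages already known to
        agree.\<close>
      have idle: "signal c S u j' t $ r + ?z u (Inr (t, j', r)) = base j' t $ r + \<nu> (Inr (t, j', r))
          + (\<Sum>c\<in>UNIV. B t r c * v (Inr (t, j, c))) - (\<Sum>c\<in>UNIV. B t r c * base j t $ c)"
        if u: "u = w \<or> u = w'" and t: "t < n" "\<not> act (t, j', r)" for u t r
      proof -
        have t': "t \<notin> bd" using t by (auto simp: act_def)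
        have "?z u (Inr (t, j', r)) = \<nu> (Inr (t, j', r)) + (\<Sum>c'\<in>UNIV. B t r c' * (v (Inr (t, j, c')) - signal c S u j t $ c'))"
          using mem[OF t(1)] t(2) by (simp add: L_def T_def act_def)
        also have "(\<Sum>c'\<in>UNIV. B t r c' * (v (Inr (t, j, c')) - signal c S u j t $ c'))
            = (\<Sum>c'\<in>UNIV. B t r c' * v (Inr (t, j, c'))) - (\<Sum>c'\<in>UNIV. B t r c' * base j t $ c')
              - (\<Sum>c'\<in>UNIV. B t r c' * (S t $ j $ i *v encode c i (u i) S t) $ c')"
          unfolding split[OF u] by (simp add: sum_subtractf[symmetric] algebra_simps)
        also have "(\<Sum>c'\<in>UNIV. B t r c' * (S t $ j $ i *v encode c i (u i) S t) $ c')
            = (S t $ j' $ i *v encode c i (u i) S t) $ r"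
          by (rule B[OF t(1) t'])
        finally have eq: "?z u (Inr (t, j', r)) = \<nu> (Inr (t, j', r)) + ((\<Sum>c'\<in>UNIV. B t r c' * v (Inr (t, j, c')))
            - (\<Sum>c'\<in>UNIV. B t r c' * base j t $ c') - (S t $ j' $ i *v encode c i (u i) S t) $ r)" .
        show ?thesis unfolding eq split[OF u, of j'] vector_add_component by simp
      qed
      have "receive c n S w j' (?z w) = receive c n S w' j' (?z w')"
        unfolding receive_def
      proof (rule restrict_ext)
        fix t assume "t \<in> {..<n}"
        hence t: "t < n" by simp
        have "signal c S w j' t $ r + ?z w (Inr (t, j', r)) = signal c S w' j' t $ r + ?z w' (Inr (t, j', r))" for r
        proof (cases "act (t, j', r)")
          case True
          show ?thesis by (simp only: at_act[OF t True])
        next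
          case False
          show ?thesis by (simp only: idle[OF _ t False] simp_thms)
        qed
        thus "signal c S w j' t + (\<chi> r. ?z w (Inr (t, j', r))) = signal c S w' j' t + (\<chi> r. ?z w' (Inr (t, j', r)))"
          unfolding vec_eq_iff vector_add_component vec_lambda_beta by blast
      qed
      hence "w i = w' i" using z z' by (auto simp: correct_def)
      hence "w k = w' k" for k using ki by (cases "k = i") auto
      thus False using w(3) by blast
    qed
  qed
  have \<psi>m: "\<psi> e \<in> borel_measurable lborel" for e
  proof (cases e)
    case (Inr x)
    thus ?thesis by (cases "act x") (simp_all add: \<psi>_def[abs_def] borel_measurable_indicator)
  qed (simp add: \<psi>_def[abs_def])
  have \<Psi>m: "\<Psi> \<in> borel_measurable ?M"
    unfolding \<Psi>_def
    by (intro borel_measurable_prod_ennreal measurable_compose[OF _ \<psi>m] measurable_component_singleton)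
  have weight: "1 \<le> ennreal D * \<Psi> v" if w: "w \<in> W" and v: "vsub ?I v (T w) \<in> polydisc ?I" for w v
  proof -
    have p1: "cmod (v e - T w e) \<le> 1" if "e \<in> ?I" for e
      using v that by (auto simp: PiE_iff)
    have "\<Psi> v = (\<Prod>e\<in>?I. ennreal (exp (- (case e of Inl _ \<Rightarrow> 0 | Inr x \<Rightarrow> if act x then (cmod (v e))\<^sup>2 / P else 0))))"
      unfolding \<Psi>_def
    proof (rule prod.cong[OF refl])
      fix e assume e: "e \<in> ?I"
      then obtain t jj r where e': "e = Inr (t, jj, r)" by (auto simp: noise_entries_eq)
      show "\<psi> e (v e) = ennreal (exp (- (case e of Inl _ \<Rightarrow> 0 | Inr x \<Rightarrow> if act x then (cmod (v e))\<^sup>2 / P else 0)))"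
        using p1[OF e] by (auto simp: \<psi>_def T_def e')
    qed
    also have "\<dots> = ennreal (exp (- (\<Sum>e\<in>?I. case e of Inl _ \<Rightarrow> 0 | Inr x \<Rightarrow> if act x then (cmod (v e))\<^sup>2 / P else 0)))"
      by (simp add: prod_ennreal exp_sum[symmetric] sum_negf)
    also have "(\<Sum>e\<in>?I. case e of Inl _ \<Rightarrow> 0 | Inr x \<Rightarrow> if act x then (cmod (v e))\<^sup>2 / P else 0)
        = (\<Sum>t<n. \<Sum>jj\<in>UNIV. \<Sum>r\<in>UNIV. if act (t, jj, r) then (cmod (v (Inr (t, jj, r))))\<^sup>2 / P else 0)"
      by (simp add: sum_noise_entries)
    finally have \<Psi>: "\<Psi> v = ennreal (exp (- (\<Sum>t<n. \<Sum>jj\<in>UNIV. \<Sum>r\<in>UNIV.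
        if act (t, jj, r) then (cmod (v (Inr (t, jj, r))))\<^sup>2 / P else 0)))" .
    have norm2: "(norm x)\<^sup>2 = (\<Sum>r\<in>UNIV. (cmod (x $ r))\<^sup>2)" for x :: "complex ^ 'm"
      by (simp add: norm_vec_def L2_set_def sum_nonneg)
    have "(\<Sum>t<n. \<Sum>jj\<in>UNIV. \<Sum>r\<in>UNIV. if act (t, jj, r) then (cmod (v (Inr (t, jj, r))))\<^sup>2 / P else 0)
        \<le> (\<Sum>t<n. \<Sum>jj\<in>UNIV. \<Sum>r\<in>(UNIV::'m set). (if jj = j then 2 * (cmod (signal c S w jj t $ r))\<^sup>2 / P + 2 else 0)
             + (if jj = j' then 2 * (cmod (signal c S w jj t $ r))\<^sup>2 / P + 2 else 0))"
    proof (intro sum_mono)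
      fix t jj and r :: 'm assume "t \<in> {..<n}"
      hence t: "t < n" by simp
      show "(if act (t, jj, r) then (cmod (v (Inr (t, jj, r))))\<^sup>2 / P else 0)
          \<le> (if jj = j then 2 * (cmod (signal c S w jj t $ r))\<^sup>2 / P + 2 else 0)
             + (if jj = j' then 2 * (cmod (signal c S w jj t $ r))\<^sup>2 / P + 2 else 0)"
      proof (cases "act (t, jj, r)")
        case True
        let ?x = "cmod (signal c S w jj t $ r)" and ?y = "cmod (v (Inr (t, jj, r)))"
        have "?y \<le> ?x + cmod (v (Inr (t, jj, r)) - signal c S w jj t $ r)"
          by (rule norm_triangle_sub)
        also have "\<dots> \<le> ?x + 1" using p1[OF mem[OF t], of jj r] True by (simp add: T_def)
        finally have "?y\<^sup>2 \<le> (?x + 1)\<^sup>2" by (intro power_mono) auto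
        also have "\<dots> \<le> 2 * ?x\<^sup>2 + 2"
          using zero_le_power2[of "?x - 1"] by (simp add: power2_eq_square algebra_simps)
        finally have "?y\<^sup>2 / P \<le> (2 * ?x\<^sup>2 + 2) / P" using P by (intro divide_right_mono) auto
        also have "\<dots> \<le> 2 * ?x\<^sup>2 / P + 2" using P by (simp add: add_divide_distrib divide_le_eq)
        finally have le: "?y\<^sup>2 / P \<le> 2 * ?x\<^sup>2 / P + 2" .
        have nn: "0 \<le> 2 * ?x\<^sup>2 / P + 2" using P by simp
        have "jj = j \<or> jj = j'" using True by (auto simp: act_def)
        thus ?thesis using True le nn by auto
      qed (use P in simp)
    qed
    also have "\<dots> = (\<Sum>t<n. (2 * (norm (signal c S w j t))\<^sup>2 / P + 2 * M) + (2 * (norm (signal c S w j' t))\<^sup>2 / P + 2 * M))"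
    proof (rule sum.cong[OF refl])
      fix t
      have one: "(\<Sum>jj\<in>UNIV. \<Sum>r\<in>(UNIV::'m set). if jj = j0 then 2 * (cmod (signal c S w jj t $ r))\<^sup>2 / P + 2 else 0)
          = 2 * (norm (signal c S w j0 t))\<^sup>2 / P + 2 * M" for j0
      proof -
        have "(\<Sum>jj\<in>UNIV. \<Sum>r\<in>(UNIV::'m set). if jj = j0 then 2 * (cmod (signal c S w jj t $ r))\<^sup>2 / P + 2 else 0)
            = (\<Sum>jj\<in>UNIV. if jj = j0 then (\<Sum>r\<in>(UNIV::'m set). 2 * (cmod (signal c S w jj t $ r))\<^sup>2 / P + 2) else 0)"
          by (intro sum.cong) auto
        thus ?thesis
          by (simp add: norm2 sum.distrib sum_distrib_left sum_divide_distrib M_def)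
      qed
      show "(\<Sum>jj\<in>UNIV. \<Sum>r\<in>(UNIV::'m set). (if jj = j then 2 * (cmod (signal c S w jj t $ r))\<^sup>2 / P + 2 else 0)
             + (if jj = j' then 2 * (cmod (signal c S w jj t $ r))\<^sup>2 / P + 2 else 0))
          = (2 * (norm (signal c S w j t))\<^sup>2 / P + 2 * M) + (2 * (norm (signal c S w j' t))\<^sup>2 / P + 2 * M)"
        unfolding sum.distrib one ..
    qed
    also have "\<dots> = 2 * (\<Sum>t<n. (norm (signal c S w j t))\<^sup>2 + (norm (signal c S w j' t))\<^sup>2) / P + real n * (4 * M)"
      by (simp add: sum.distrib sum_distrib_left sum_divide_distrib add_divide_distrib algebra_simps)
    also have "\<dots> \<le> 2 * (\<rho> * real n * P) / P + real n * (4 * M)"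
      using energy[OF w] P by (intro add_right_mono divide_right_mono mult_left_mono) auto
    also have "\<dots> = real n * (2 * \<rho> + 4 * M)" using P by (simp add: algebra_simps)
    finally have "1 \<le> D * exp (- (\<Sum>t<n. \<Sum>jj\<in>UNIV. \<Sum>r\<in>UNIV. if act (t, jj, r) then (cmod (v (Inr (t, jj, r))))\<^sup>2 / P else 0))"
      unfolding D_def by (simp add: exp_minus[symmetric] exp_add[symmetric])
    thus ?thesis unfolding \<Psi> by (subst ennreal_mult[symmetric]) (auto simp: D_def)
  qed
  interpret PS: product_sigma_finite "\<lambda>_::('j, 'k, 'm) entry. lborel :: complex measure"
    by (rule product_sigma_finite_const[OF lborel.sigma_finite_measure_axioms])
  have "(\<Sum>w\<in>W. emeasure (PiM ?I (\<lambda>_. CN)) (correct c n demand j j' i S w)) * emeasure ?M (polydisc ?I)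
      \<le> ennreal (exp \<kappa>) * (ennreal D * (\<integral>\<^sup>+v. \<Psi> v \<partial>?M))"
    by (rule gaussian_packing[where L = L and T = T]) (use W(1) correct_sets[OF c S] Lm odd \<kappa> disjoint \<Psi>m weight in auto)
  also have "emeasure ?M (polydisc ?I) = ennreal pi ^ card ?I" by (rule emeasure_polydisc) simp
  also have "(\<integral>\<^sup>+v. \<Psi> v \<partial>?M) = (\<Prod>e\<in>?I. \<integral>\<^sup>+z. \<psi> e z \<partial>lborel)"
    unfolding \<Psi>_def by (rule PS.product_nn_integral_prod[OF finite_noise_entries \<psi>m])
  also have "\<dots> = (\<Prod>e\<in>?I. ennreal pi * ennreal (case e of Inl _ \<Rightarrow> 1 | Inr x \<Rightarrow> if act x then P else 1))"
  proof (rule prod.cong[OF refl])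
    fix e assume "e \<in> ?I"
    then obtain x where e: "e = Inr x" by (auto simp: noise_entries_eq)
    have "emeasure lborel (cball (0::complex) 1) = ennreal pi"
      by (subst emeasure_cball) (auto simp: unit_ball_vol_2)
    thus "(\<integral>\<^sup>+z. \<psi> e z \<partial>lborel) = ennreal pi * ennreal (case e of Inl _ \<Rightarrow> 1 | Inr x \<Rightarrow> if act x then P else 1)"
      using nn_integral_gaussian[of P] P by (auto simp: \<psi>_def e ennreal_mult[symmetric])
  qed
  also have "\<dots> = ennreal pi ^ card ?I * ennreal (\<Prod>e\<in>?I. case e of Inl _ \<Rightarrow> 1 | Inr x \<Rightarrow> if act x then P else 1)"
    using P by (subst prod_ennreal[symmetric]) (auto simp: prod.distrib split: sum.splits)
  finally have "ennreal pi ^ card ?I * (\<Sum>w\<in>W. emeasure (PiM ?I (\<lambda>_. CN)) (correct c n demand j j' i S w))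
      \<le> ennreal pi ^ card ?I * (ennreal (exp \<kappa>) * (ennreal D * ennreal (\<Prod>e\<in>?I. case e of Inl _ \<Rightarrow> 1 | Inr x \<Rightarrow> if act x then P else 1)))"
    by (simp add: mult_ac)
  hence "(\<Sum>w\<in>W. emeasure (PiM ?I (\<lambda>_. CN)) (correct c n demand j j' i S w))
      \<le> ennreal (exp \<kappa>) * (ennreal D * ennreal (\<Prod>e\<in>?I. case e of Inl _ \<Rightarrow> 1 | Inr x \<Rightarrow> if act x then P else 1))"
    by (subst (asm) ennreal_mult_le_mult_iff) (auto simp: ennreal_power)
  also have "(\<Prod>e\<in>?I. case e of Inl _ \<Rightarrow> 1 | Inr x \<Rightarrow> if act x then P else 1) \<le> P ^ (CARD('m) * (n + card bd))"
  proof -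
    have "(\<Prod>e\<in>?I. case e of Inl _ \<Rightarrow> 1 | Inr x \<Rightarrow> if act x then P else 1)
        = (\<Prod>e\<in>?I. if (case e of Inl _ \<Rightarrow> False | Inr x \<Rightarrow> act x) then P else 1)"
      by (intro prod.cong) (auto split: sum.splits)
    also have "\<dots> = P ^ card {e \<in> ?I. case e of Inl _ \<Rightarrow> False | Inr x \<Rightarrow> act x}"
      by (simp add: prod.If_cases Int_def)
    also have "\<dots> \<le> P ^ (CARD('m) * (n + card bd))"
    proof (rule power_increasing[OF _ P])
      have finbd: "finite bd" using bd finite_subset by blast
      have "card {e \<in> ?I. case e of Inl _ \<Rightarrow> False | Inr x \<Rightarrow> act x}
          \<le> card (Inr ` ({..<n} \<times> {j} \<times> UNIV) \<union> Inr ` (bd \<times> {j'} \<times> UNIV) :: ('j, 'k, 'm) entry set)"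
        using finbd by (intro card_mono) (auto simp: noise_entries_eq act_def)
      also have "\<dots> \<le> card ({..<n} \<times> {j} \<times> (UNIV :: 'm set)) + card (bd \<times> {j'} \<times> (UNIV :: 'm set))"
        using finbd by (intro order.trans[OF card_Un_le] add_mono card_image_le) auto
      also have "\<dots> = CARD('m) * (n + card bd)" by (simp add: card_cartesian_product algebra_simps)
      finally show "card {e \<in> ?I. case e of Inl _ \<Rightarrow> False | Inr x \<Rightarrow> act x} \<le> CARD('m) * (n + card bd)" .
    qed
    finally show ?thesis .
  qed
  also have "ennreal (exp \<kappa>) * (ennreal D * ennreal (P ^ (CARD('m) * (n + card bd))))
      = ennreal (exp \<kappa> * D * P ^ (CARD('m) * (n + card bd)))"
    using P by (simp add: ennreal_mult D_def mult.assoc)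
  also have "exp \<kappa> * D = exp (real n * (real CARD('m) * (6 + (real CARD('m) * \<Lambda>)\<^sup>2) + 2 * \<rho>))"
    unfolding \<kappa>_def D_def M_def exp_add[symmetric] by (simp add: algebra_simps)
  finally show ?thesis by (auto simp: ennreal_leI mult_left_mono)
qed

end

section \<open>Fading and energy\<close>

lemma polyfun_reindex:
  assumes "polyfun F"
  shows "polyfun (\<lambda>h. F (\<lambda>p. h (f p)))"
  using assms by induction (auto intro: polyfun.intros)

text \<open>Elimination at the identity matrix provides polynomial stand-ins for determinant and
  adjugate.\<close>

lemma generic_adjugate:
  "\<exists>(F :: ('m::finite \<times> 'm \<Rightarrow> complex) \<Rightarrow> complex) L. polyfun F \<and> F (\<lambda>(r, c). if r = c then 1 else 0) \<noteq> 0 \<and>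
     (\<forall>c r. polyfun (\<lambda>h. L h c r)) \<and>
     (\<forall>h v c. F h * v c = (\<Sum>r\<in>UNIV. L h c r * (\<Sum>c'\<in>UNIV. h (r, c') * v c')))"
proof -
  let ?A = "\<lambda>h r c. h (r, c) :: complex"
  have "\<exists>F L. polyfun F \<and> F (\<lambda>(r, c). if r = c then 1 else 0) \<noteq> 0 \<and>
     (\<forall>c\<in>(UNIV::'m set). \<forall>r\<in>(UNIV::'m set). polyfun (\<lambda>h. L h c r)) \<and>
     (\<forall>h v. \<forall>c\<in>(UNIV::'m set). F h * v c = (\<Sum>r\<in>(UNIV::'m set). L h c r * (\<Sum>c'\<in>UNIV. ?A h r c' * v c')))"
  proof (rule generic_left_inverse)
    fix v :: "'m \<Rightarrow> complex"
    assume z: "\<And>r. r \<in> (UNIV::'m set) \<Longrightarrow> (\<Sum>c\<in>UNIV. ?A (\<lambda>(r, c). if r = c then 1 else 0) r c * v c) = 0"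
    have "v r = 0" for r
      using z[of r] by (simp add: if_distrib[of "\<lambda>x. x * _"] cong: if_cong)
    thus "\<forall>c\<in>UNIV. v c = 0" by blast
  qed (auto intro: polyfun.coord)
  thus ?thesis by simp
qed

lemma norm_matrix_vector_le:
  fixes A :: "complex ^ 'm::finite ^ 'm"
  assumes "\<And>r c. cmod (A $ r $ c) \<le> a"
  shows "norm (A *v x) \<le> (real CARD('m))\<^sup>2 * a * norm x"
proof -
  have a: "a \<ge> 0" using assms norm_ge_zero order_trans by blast
  have "norm (A *v x) \<le> (\<Sum>r\<in>UNIV. cmod ((A *v x) $ r))"
    unfolding norm_vec_def by (rule L2_set_le_sum) auto
  also have "\<dots> \<le> (\<Sum>r\<in>(UNIV::'m set). \<Sum>c\<in>(UNIV::'m set). a * norm x)"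
    unfolding matrix_vector_mult_def vec_lambda_beta
    by (intro sum_mono order.trans[OF norm_sum]) (unfold norm_mult, intro sum_mono mult_mono assms Finite_Cartesian_Product.norm_nth_le a norm_ge_zero)
  also have "\<dots> = (real CARD('m))\<^sup>2 * a * norm x" by (simp add: power2_eq_square)
  finally show ?thesis .
qed

lemma sum_power2_le:
  fixes a :: "'k \<Rightarrow> real"
  assumes "finite K"
  shows "(\<Sum>k\<in>K. a k)\<^sup>2 \<le> real (card K) * (\<Sum>k\<in>K. (a k)\<^sup>2)"
  using Cauchy_Schwarz_ineq_sum[of "\<lambda>_. 1" a K] by simp

text \<open>Each coordinate of a uniform tuple is uniform: the power constraint averages over the
  messages of one transmitter, while the error probability averages over tuples.\<close>

lemma sum_PiE_coordinate:
  fixes f :: "nat \<Rightarrow> real" and num :: "'k::finite \<Rightarrow> nat"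
  assumes "num k > 0"
  shows "(\<Sum>w\<in>PiE UNIV (\<lambda>k. {..<num k}). f (w k)) = real (\<Prod>k\<in>UNIV. num k) * ((\<Sum>u<num k. f u) / real (num k))"
proof -
  have "(\<Prod>k'\<in>UNIV. \<Sum>u<num k'. if k' = k then f u else 1)
      = (\<Sum>w\<in>PiE UNIV (\<lambda>k. {..<num k}). \<Prod>k'\<in>UNIV. if k' = k then f (w k') else 1)"
    by (rule prod_sum_PiE) auto
  also have "\<dots> = (\<Sum>w\<in>PiE UNIV (\<lambda>k. {..<num k}). f (w k))"
    by (simp add: prod.delta)
  finally have "(\<Sum>w\<in>PiE UNIV (\<lambda>k. {..<num k}). f (w k)) = (\<Prod>k'\<in>UNIV. \<Sum>u<num k'. if k' = k then f u else 1)" ..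
  also have "\<dots> = (\<Sum>u<num k. f u) * (\<Prod>k'\<in>UNIV - {k}. real (num k'))"
    by (subst prod.remove[of _ k]) (auto intro!: prod.cong)
  also have "\<dots> = real (\<Prod>k\<in>UNIV. num k) * ((\<Sum>u<num k. f u) / real (num k))"
    using assms by (subst (2) prod.remove[of _ k]) auto
  finally show ?thesis .
qed

section \<open>Fades, channel states and signal norms\<close>

context interference_channel
begin

definition gains :: "'j \<Rightarrow> 'k \<Rightarrow> ('j, 'k, 'm) channel_state \<Rightarrow> 'm \<times> 'm \<Rightarrow> complex" where
  "gains j i S = (\<lambda>(r, c). S $ j $ i $ r $ c)"

lemma gains_measurable:
  assumes "f \<in> borel_measurable M"
  shows "(\<lambda>x. gains j i (f x) p) \<in> borel_measurable M"
  using assms by (cases p) (simp add: gains_def)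

lemma polyfun_gains_measurable:
  assumes "polyfun F" and "f \<in> borel_measurable M"
  shows "(\<lambda>x. F (gains j i (f x))) \<in> borel_measurable M"
  by (rule polyfun_measurable[OF assms(1) gains_measurable[OF assms(2)]])

text \<open>The adjugate formula inverts the channel with a bounded inverse only where the polynomial
  \<^term>\<open>F\<close> is not small.\<close>

lemma fade_small:
  assumes F: "polyfun F" "F (\<lambda>(r, c). if r = c then 1 else 0) \<noteq> 0" and \<eta>: "\<eta> > 0"
  shows "\<exists>\<delta>>0. \<forall>t. prob {\<omega> \<in> space \<Omega>. cmod (F (gains j i (H t \<omega>))) < \<delta>} \<le> \<eta>"
proof -
  define g where "g v = (\<lambda>(r, c). v (Inl (0, j, i, r, c)))" for v :: "('j, 'k, 'm) entry \<Rightarrow> complex"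
  let ?N = "PiM (entries 1) (\<lambda>_. borel) :: (('j, 'k, 'm) entry \<Rightarrow> complex) measure"
  interpret B: prob_space "block_law 1" by (rule prob_block_law)
  define F' where "F' h = F (\<lambda>p. h (case p of (r, c) \<Rightarrow> Inl (0, j, i, r, c)))" for h :: "('j, 'k, 'm) entry \<Rightarrow> complex"
  \<comment> \<open>Identity matrices in all channels witness that the polynomial is not identically
    zero.\<close>
  define h0 :: "('j, 'k, 'm) entry \<Rightarrow> complex" where "h0 = (\<lambda>e. case e of Inl (t, j, k, r, c) \<Rightarrow> if r = c then 1 else 0 | Inr _ \<Rightarrow> 0)"
  have F'g: "F' h = F (g h)" for h by (simp add: F'_def g_def split_def)
  have polyF': "polyfun F'" unfolding F'_def by (rule polyfun_reindex[OF F(1)])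
  have "F' h0 \<noteq> 0" using F(2) by (simp add: F'_def h0_def split_def)
  hence "AE v in PiM (entries 1) entry_law. F' (\<lambda>i. if i \<in> entries 1 then v i else h0 i) \<noteq> 0"
    using polyfun_AE_nonzero[of entry_law F' "entries 1" h0] prob_entry_law sets_entry_law polyF' finite_entries
      entry_law_atomless by blast
  hence ae: "AE v in block_law 1. F (g v) \<noteq> 0"
    unfolding block_law_def
  proof eventually_elim
    case (elim v)
    have "g (\<lambda>i. if i \<in> entries 1 then v i else h0 i) = g v"
      by (auto simp: g_def entries_def)
    thus ?case using elim by (simp add: F'g)
  qed
  have gm: "(\<lambda>v. F (g v)) \<in> borel_measurable ?N"
  proof (rule polyfun_measurable[OF F(1)])
    fix p
    show "(\<lambda>v. g v p) \<in> borel_measurable ?N"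
      unfolding g_def by (cases p) (auto simp: entries_def intro!: measurable_component_singleton)
  qed
  define D where "D \<delta> = {v \<in> space ?N. cmod (F (g v)) < \<delta>}" for \<delta>
  have D: "D \<delta> \<in> sets ?N" for \<delta>
    unfolding D_def using gm by measurable
  hence D': "D \<delta> \<in> sets (block_law 1)" for \<delta> by simp
  have "(\<lambda>n. measure (block_law 1) (D (1 / real (Suc n)))) \<longlonglongrightarrow> measure (block_law 1) (\<Inter>n. D (1 / real (Suc n)))"
  proof (rule B.finite_Lim_measure_decseq)
    show "decseq (\<lambda>n. D (1 / real (Suc n)))"
    proof (rule decseq_SucI, rule subsetI)
      fix n v assume "v \<in> D (1 / real (Suc (Suc n)))"
      moreover have "1 / real (Suc (Suc n)) \<le> 1 / real (Suc n)" by (simp add: field_simps)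
      ultimately show "v \<in> D (1 / real (Suc n))" by (simp add: D_def)
    qed
  qed (use D' in auto)
  moreover have "measure (block_law 1) (\<Inter>n. D (1 / real (Suc n))) = 0"
  proof -
    have "AE v in block_law 1. v \<notin> (\<Inter>n. D (1 / real (Suc n)))"
      using ae
    proof eventually_elim
      case (elim v)
      then obtain n where "1 / real (Suc n) < cmod (F (g v))"
        using reals_Archimedean[of "cmod (F (g v))"] by (auto simp: inverse_eq_divide)
      hence "v \<notin> D (1 / real (Suc n))" by (simp add: D_def)
      thus ?case by blast
    qed
    moreover have "(\<Inter>n. D (1 / real (Suc n))) \<in> sets (block_law 1)"
      using D' by (intro sets.countable_INT) auto
    ultimately show ?thesis by (simp only: B.prob_eq_0)
  qed
  ultimately have "(\<lambda>n. measure (block_law 1) (D (1 / real (Suc n)))) \<longlonglongrightarrow> 0" by (simp only:)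
  from order_tendstoD(2)[OF this \<eta>] obtain n where n: "measure (block_law 1) (D (1 / real (Suc n))) < \<eta>"
    by (auto simp: eventually_sequentially)
  show ?thesis
  proof (intro exI[of _ "1 / real (Suc n)"] conjI allI)
    fix t
    \<comment> \<open>Blocks of length 1 have the same law at all times, so one
      \<open>\<delta>\<close> serves every \<open>t\<close>.\<close>
    have rv: "block 1 t \<in> \<Omega> \<rightarrow>\<^sub>M ?N"
      using indep_blocks[of 1] by (simp add: indep_vars_def)
    have "gains j i (H t \<omega>) = g (block 1 t \<omega>)" for \<omega>
      by (auto simp: gains_def g_def block_def entries_def)
    hence "{\<omega> \<in> space \<Omega>. cmod (F (gains j i (H t \<omega>))) < 1 / real (Suc n)} = block 1 t -` D (1 / real (Suc n)) \<inter> space \<Omega>"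
      using measurable_space[OF rv] by (auto simp: D_def)
    also have "prob \<dots> = measure (distr \<Omega> ?N (block 1 t)) (D (1 / real (Suc n)))"
      by (rule measure_distr[OF rv D, symmetric])
    also have "\<dots> = measure (block_law 1) (D (1 / real (Suc n)))" by (simp only: distr_block)
    finally show "prob {\<omega> \<in> space \<Omega>. cmod (F (gains j i (H t \<omega>))) < 1 / real (Suc n)} \<le> \<eta>"
      using n by simp
  qed simp
qed

text \<open>Reads the state off the channel entries; as a function on the first factor of a product
  space it stays fixed while the noise is integrated out.\<close>

definition state_of :: "nat \<Rightarrow> (('j, 'k, 'm) entry \<Rightarrow> complex) \<Rightarrow> nat \<Rightarrow> ('j, 'k, 'm) channel_state" where
  "state_of n u = (\<lambda>t\<in>{..<n}. \<chi> j k r c. u (Inl (t, j, k, r, c)))"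

lemma state_of_measurable: "state_of n \<in> PiM (chan_entries n) (\<lambda>_. borel) \<rightarrow>\<^sub>M PiM {..<n} (\<lambda>_. borel)"
  unfolding state_of_def[abs_def]
  by (intro measurable_restrict borel_measurable_vec_lambda measurable_component_singleton)
     (auto simp: chan_entries_def entries_def)

lemma state_block_eq: "state_block H n \<omega> = state_of n (\<lambda>i\<in>chan_entries n. X i \<omega>)"
  unfolding state_block_def state_of_def
  by (intro restrict_ext) (simp add: chan_entries_def entries_def vec_eq_iff)

lemma state_block_measurable [measurable]: "state_block H n \<in> \<Omega> \<rightarrow>\<^sub>M PiM {..<n} (\<lambda>_. borel)"
  unfolding state_block_def[abs_def] by (intro measurable_restrict H_measurable)

lemma signal_measurable:
  assumes c: "measurable_code n c" and w: "\<And>k. w k < num_msgs c k" and t: "t < n"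
  shows "(\<lambda>S. signal c S w j t) \<in> borel_measurable (PiM {..<n} (\<lambda>_. borel))"
proof -
  have S: "(\<lambda>S. S t) \<in> borel_measurable (PiM {..<n} (\<lambda>_. borel :: ('j, 'k, 'm) channel_state measure))"
    using t by (intro measurable_component_singleton) simp
  have e: "(\<lambda>S. encode c k (w k) S t) \<in> borel_measurable (PiM {..<n} (\<lambda>_. borel))" for k
    using c w t by (auto simp: measurable_code_def)
  have "(\<lambda>S. \<chi> r. \<Sum>c'\<in>UNIV. S t $ j $ k $ r $ c' * encode c k (w k) S t $ c')
      \<in> borel_measurable (PiM {..<n} (\<lambda>_. borel :: ('j, 'k, 'm) channel_state measure))" for k
    by (intro borel_measurable_vec_lambda borel_measurable_sum borel_measurable_times borel_measurable_vec_nth S e)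
  thus ?thesis
    unfolding signal_def by (intro borel_measurable_sum) (simp add: matrix_vector_mult_def)
qed

lemma decision_measurable:
  assumes c: "measurable_code n c" and w: "\<And>k. w k < num_msgs c k"
  shows "(\<lambda>q. decode c j k (receive c n (state_of n (fst q)) w j (snd q)) (state_of n (fst q)))
    \<in> PiM (chan_entries n) (\<lambda>_. borel) \<Otimes>\<^sub>M PiM (noise_entries n) (\<lambda>_. borel) \<rightarrow>\<^sub>M count_space UNIV"
proof -
  let ?Q = "PiM (chan_entries n) (\<lambda>_. borel) \<Otimes>\<^sub>M PiM (noise_entries n) (\<lambda>_. borel)
     :: ((('j, 'k, 'm) entry \<Rightarrow> complex) \<times> (('j, 'k, 'm) entry \<Rightarrow> complex)) measure"
  have st: "(\<lambda>q. state_of n (fst q)) \<in> ?Q \<rightarrow>\<^sub>M PiM {..<n} (\<lambda>_. borel)"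
    by (rule measurable_compose[OF measurable_fst state_of_measurable])
  have "(\<lambda>q. receive c n (state_of n (fst q)) w j (snd q)) \<in> ?Q \<rightarrow>\<^sub>M PiM {..<n} (\<lambda>_. borel)"
    unfolding receive_def
  proof (rule measurable_restrict)
    fix t assume "t \<in> {..<n}"
    hence t: "t < n" by simp
    have z: "(\<lambda>q. snd q (Inr (t, j, r))) \<in> borel_measurable ?Q" for r
      using t by (intro measurable_compose[OF measurable_snd] measurable_component_singleton) (auto simp: noise_entries_eq)
    show "(\<lambda>q. signal c (state_of n (fst q)) w j t + (\<chi> r. snd q (Inr (t, j, r)))) \<in> borel_measurable ?Q"
      by (intro borel_measurable_add borel_measurable_vec_lambda z
          measurable_compose[OF st signal_measurable[OF c w t]])
  qed
  with st have "(\<lambda>q. (receive c n (state_of n (fst q)) w j (snd q), state_of n (fst q)))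
      \<in> ?Q \<rightarrow>\<^sub>M PiM {..<n} (\<lambda>_. borel) \<Otimes>\<^sub>M PiM {..<n} (\<lambda>_. borel)"
    by (intro measurable_Pair)
  moreover have "(\<lambda>(y, s). decode c j k y s) \<in> (PiM {..<n} (\<lambda>_. borel) \<Otimes>\<^sub>M PiM {..<n} (\<lambda>_. borel)) \<rightarrow>\<^sub>M count_space UNIV"
    using c by (simp add: measurable_code_def)
  ultimately show ?thesis using measurable_compose by fastforce
qed

lemma norm_signal_le:
  assumes S: "\<And>j k r c. cmod (S t $ j $ k $ r $ c) \<le> hmax"
  shows "(norm (signal c S w j t))\<^sup>2 \<le> real CARD('k) * ((real CARD('m))\<^sup>2 * hmax)\<^sup>2 * (\<Sum>k\<in>UNIV. (norm (encode c k (w k) S t))\<^sup>2)"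
proof -
  let ?a = "(real CARD('m))\<^sup>2 * hmax"
  have "norm (signal c S w j t) \<le> (\<Sum>k\<in>UNIV. ?a * norm (encode c k (w k) S t))"
    unfolding signal_def by (intro order.trans[OF norm_sum] sum_mono norm_matrix_vector_le S)
  hence "(norm (signal c S w j t))\<^sup>2 \<le> (\<Sum>k\<in>UNIV. ?a * norm (encode c k (w k) S t))\<^sup>2"
    by (intro power_mono) auto
  also have "\<dots> \<le> real CARD('k) * (\<Sum>k\<in>UNIV. (?a * norm (encode c k (w k) S t))\<^sup>2)"
    by (rule sum_power2_le) simp
  also have "\<dots> = real CARD('k) * ?a\<^sup>2 * (\<Sum>k\<in>UNIV. (norm (encode c k (w k) S t))\<^sup>2)"
    by (simp add: power_mult_distrib sum_distrib_left mult_ac)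
  finally show ?thesis .
qed

end

section \<open>Markov bounds for energy and fades\<close>

lemma markov_real:
  fixes f :: "'a \<Rightarrow> real"
  assumes [measurable]: "f \<in> borel_measurable M" and a: "a > 0"
  shows "emeasure M {x \<in> space M. a < f x} \<le> ennreal (1 / a) * (\<integral>\<^sup>+x. ennreal (f x) \<partial>M)"
proof -
  have "emeasure M {x \<in> space M. a < f x} \<le> emeasure M {x \<in> space M. 1 \<le> ennreal (1 / a) * ennreal (f x)}"
  proof (rule emeasure_mono)
    have "1 \<le> ennreal (1 / a) * ennreal (f x)" if "a < f x" for x
    proof -
      have "1 \<le> 1 / a * f x" using that a by (simp add: pos_le_divide_eq)
      hence "ennreal 1 \<le> ennreal (1 / a * f x)" by (rule ennreal_leI)
      also have "ennreal (1 / a * f x) = ennreal (1 / a) * ennreal (f x)"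
        using a that by (intro ennreal_mult) auto
      finally show ?thesis by simp
    qed
    thus "{x \<in> space M. a < f x} \<subseteq> {x \<in> space M. 1 \<le> ennreal (1 / a) * ennreal (f x)}" by blast
  qed measurable
  also have "\<dots> \<le> ennreal (1 / a) * (\<integral>\<^sup>+x. ennreal (f x) * indicator (space M) x \<partial>M)"
    by (rule nn_integral_Markov_inequality) measurable
  also have "(\<integral>\<^sup>+x. ennreal (f x) * indicator (space M) x \<partial>M) = (\<integral>\<^sup>+x. ennreal (f x) \<partial>M)"
    by (intro nn_integral_cong) simp
  finally show ?thesis .
qed

context interference_channel
begin

lemma hmax_nonneg: "0 \<le> hmax"
proof (rule ccontr)
  assume "\<not> 0 \<le> hmax"
  have "AE z in \<mu>. False"
    using channel_bounds(2)
  proof eventually_elim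
    case (elim z)
    have "0 \<le> hmax" using elim by (meson norm_ge_zero order_trans)
    thus ?case using \<open>\<not> 0 \<le> hmax\<close> by simp
  qed
  thus False using prob_space.AE_False[OF prob_mu] by simp
qed

definition energy :: "('j, 'k, 'm) block_code \<Rightarrow> nat \<Rightarrow> 'j \<Rightarrow> 'j \<Rightarrow> (nat \<Rightarrow> ('j, 'k, 'm) channel_state) \<Rightarrow> ('k \<Rightarrow> nat) \<Rightarrow> real" where
  "energy c n j j' S w = (\<Sum>t<n. (norm (signal c S w j t))\<^sup>2 + (norm (signal c S w j' t))\<^sup>2)"

definition fades :: "(('m \<times> 'm \<Rightarrow> complex) \<Rightarrow> complex) \<Rightarrow> real \<Rightarrow> nat \<Rightarrow> 'j \<Rightarrow> 'k \<Rightarrow> (nat \<Rightarrow> ('j, 'k, 'm) channel_state) \<Rightarrow> nat set" where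
  "fades F \<delta> n j i S = {t \<in> {..<n}. cmod (F (gains j i (S t))) < \<delta>}"

lemma energy_measurable:
  assumes "measurable_code n c" and "\<And>k. w k < num_msgs c k"
  shows "(\<lambda>S. energy c n j j' S w) \<in> borel_measurable (PiM {..<n} (\<lambda>_. borel))"
proof -
  have "(\<lambda>S. (norm (signal c S w jj t))\<^sup>2) \<in> borel_measurable (PiM {..<n} (\<lambda>_. borel))" if "t < n" for jj t
  proof -
    note [measurable] = signal_measurable[OF assms that]
    show ?thesis by measurable
  qed
  thus ?thesis unfolding energy_def by (intro borel_measurable_sum borel_measurable_add) auto
qed

lemma fades_measurable:
  assumes F: "polyfun F"
  shows "(\<lambda>S. real (card (fades F \<delta> n j i S))) \<in> borel_measurable (PiM {..<n} (\<lambda>_. borel))"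
proof -
  let ?N = "PiM {..<n} (\<lambda>_. borel) :: (nat \<Rightarrow> ('j, 'k, 'm) channel_state) measure"
  have "real (card (fades F \<delta> n j i S)) = (\<Sum>t<n. indicator {S. cmod (F (gains j i (S t))) < \<delta>} S)" for S
    by (simp add: fades_def indicator_def sum.If_cases Int_def conj_commute)
  moreover have "(\<lambda>S. \<Sum>t<n. indicator {S. cmod (F (gains j i (S t))) < \<delta>} S :: real) \<in> borel_measurable ?N"
  proof (rule borel_measurable_sum)
    fix t assume t: "t \<in> {..<n}"
    have "(\<lambda>S. S t) \<in> borel_measurable ?N" using t by (intro measurable_component_singleton)
    from polyfun_gains_measurable[OF F this]
    have [measurable]: "(\<lambda>S. F (gains j i (S t))) \<in> borel_measurable ?N" .
    show "(\<lambda>S. indicator {S. cmod (F (gains j i (S t))) < \<delta>} S :: real) \<in> borel_measurable ?N"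
      unfolding indicator_def mem_Collect_eq by measurable
  qed
  ultimately show ?thesis by simp
qed

text \<open>Markov's inequality for the number of fades, whose mean is at most
  \<open>n * \<beta> / 8\<close>.\<close>

lemma few_fades:
  assumes F: "polyfun F" and fade: "\<And>t. prob {\<omega> \<in> space \<Omega>. cmod (F (gains j i (H t \<omega>))) < \<delta>} \<le> \<beta> / 8"
    and pos: "\<beta> > 0" "n > 0"
  shows "prob {\<omega> \<in> space \<Omega>. \<beta> * real n < real (card (fades F \<delta> n j i (state_block H n \<omega>)))} \<le> 1 / 8"
proof -
  let ?D = "\<lambda>t. {\<omega> \<in> space \<Omega>. cmod (F (gains j i (H t \<omega>))) < \<delta>}"
  have [measurable]: "(\<lambda>\<omega>. F (gains j i (H t \<omega>))) \<in> borel_measurable \<Omega>" for t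
    by (intro polyfun_gains_measurable F) measurable
  have D: "?D t \<in> events" for t by measurable
  let ?N = "\<lambda>\<omega>. \<Sum>t<n. indicator (?D t) \<omega> :: ennreal"
  have card: "ennreal (real (card (fades F \<delta> n j i (state_block H n \<omega>)))) = ?N \<omega>" if "\<omega> \<in> space \<Omega>" for \<omega>
  proof -
    have "fades F \<delta> n j i (state_block H n \<omega>) = {t \<in> {..<n}. \<omega> \<in> ?D t}"
      using that by (auto simp: fades_def state_block_def)
    thus ?thesis by (simp add: indicator_def sum.If_cases Int_def ennreal_of_nat_eq_real_of_nat)
  qed
  have bn: "\<beta> * real n > 0" using pos by simp
  have "emeasure \<Omega> {\<omega> \<in> space \<Omega>. \<beta> * real n < real (card (fades F \<delta> n j i (state_block H n \<omega>)))}
      \<le> ennreal (1 / (\<beta> * real n)) * (\<integral>\<^sup>+\<omega>. ennreal (real (card (fades F \<delta> n j i (state_block H n \<omega>)))) \<partial>\<Omega>)"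
    by (intro markov_real measurable_compose[OF state_block_measurable fades_measurable[OF F]] bn)
  also have "(\<integral>\<^sup>+\<omega>. ennreal (real (card (fades F \<delta> n j i (state_block H n \<omega>)))) \<partial>\<Omega>) = (\<integral>\<^sup>+\<omega>. ?N \<omega> \<partial>\<Omega>)"
    by (intro nn_integral_cong card)
  also have "\<dots> = (\<Sum>t<n. emeasure \<Omega> (?D t))"
    using D by (subst nn_integral_sum) auto
  also have "\<dots> \<le> (\<Sum>t<n. ennreal (\<beta> / 8))"
    by (intro sum_mono) (auto simp: emeasure_eq_measure intro!: ennreal_leI fade)
  also have "(\<Sum>t<n. ennreal (\<beta> / 8)) = ennreal (real n * (\<beta> / 8))"
    using pos by (subst sum_ennreal) auto
  also have "ennreal (1 / (\<beta> * real n)) * ennreal (real n * (\<beta> / 8)) = ennreal (1 / 8)"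
    using pos by (subst ennreal_mult[symmetric]) auto
  finally show ?thesis
    by (simp add: emeasure_eq_measure mult_left_mono)
qed

text \<open>A single tuple may use excessive power, since the constraint averages over messages;
  hence the sum over all tuples. The constant collects two receivers, the Cauchy-Schwarz factor
  \<open>CARD('k)\<close>, a sum over \<open>CARD('k)\<close> transmitters and the squared bound for
  the channel matrices.\<close>

lemma energy_markov:
  assumes c: "measurable_code n c" and num: "\<And>k. num_msgs c k > 0"
    and pow: "power_constraint \<Omega> H n c P" and pos: "P > 0" "n > 0" "\<rho> > 0"
  shows "(\<Sum>w\<in>PiE UNIV (\<lambda>k. {..<num_msgs c k}).
      prob {\<omega> \<in> space \<Omega>. \<rho> * real n * P < energy c n j j' (state_block H n \<omega>) w})
    \<le> real (\<Prod>k\<in>UNIV. num_msgs c k) * (2 * (real CARD('k))\<^sup>2 * ((real CARD('m))\<^sup>2 * hmax)\<^sup>2) / \<rho>"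
proof -
  let ?W = "PiE UNIV (\<lambda>k. {..<num_msgs c k})"
  let ?S = "state_block H n"
  define a where "a = real CARD('k) * ((real CARD('m))\<^sup>2 * hmax)\<^sup>2"
  define TN where "TN = real (\<Prod>k\<in>UNIV. num_msgs c k)"
  have a0: "a \<ge> 0" by (simp add: a_def)
  have TN0: "TN \<ge> 0" unfolding TN_def by (rule of_nat_0_le_iff)
  define pw where "pw k t \<omega> = (\<Sum>u<num_msgs c k. (norm (encode c k u (?S \<omega>) t))\<^sup>2) / real (num_msgs c k)" for k t \<omega>
  have pw0: "pw k t \<omega> \<ge> 0" for k t \<omega> by (simp add: pw_def sum_nonneg)
  have enc: "(\<lambda>\<omega>. encode c k u (?S \<omega>) t) \<in> borel_measurable \<Omega>" if "t < n" "u < num_msgs c k" for k u t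
    using c that by (intro measurable_compose[OF state_block_measurable]) (auto simp: measurable_code_def)
  have pwm: "pw k t \<in> borel_measurable \<Omega>" if "t < n" for k t
  proof -
    have "(\<lambda>\<omega>. (norm (encode c k u (?S \<omega>) t))\<^sup>2) \<in> borel_measurable \<Omega>" if "u < num_msgs c k" for u
    proof -
      note [measurable] = enc[OF \<open>t < n\<close> that]
      show ?thesis by measurable
    qed
    thus ?thesis unfolding pw_def[abs_def] by (intro borel_measurable_divide borel_measurable_sum) auto
  qed
  have en0: "energy c n j j' S w \<ge> 0" for S w by (simp add: energy_def sum_nonneg)
  have enm: "(\<lambda>\<omega>. energy c n j j' (?S \<omega>) w) \<in> borel_measurable \<Omega>" if "w \<in> ?W" for w
    using that by (intro measurable_compose[OF state_block_measurable energy_measurable[OF c]]) auto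
  have th: "\<rho> * real n * P > 0" using pos by simp
  have markov: "emeasure \<Omega> {\<omega> \<in> space \<Omega>. \<rho> * real n * P < energy c n j j' (?S \<omega>) w}
      \<le> ennreal (1 / (\<rho> * real n * P)) * (\<integral>\<^sup>+\<omega>. ennreal (energy c n j j' (?S \<omega>) w) \<partial>\<Omega>)" if w: "w \<in> ?W" for w
    by (rule markov_real[OF enm[OF w] th])
  have total: "(\<Sum>w\<in>?W. energy c n j j' (?S \<omega>) w) \<le> 2 * a * TN * (\<Sum>t<n. \<Sum>k\<in>UNIV. pw k t \<omega>)"
    if b: "\<forall>t j k r c. cmod (H t \<omega> $ j $ k $ r $ c) \<le> hmax" for \<omega>
  proof -
    have sg: "(norm (signal c (?S \<omega>) w jj t))\<^sup>2 \<le> a * (\<Sum>k\<in>UNIV. (norm (encode c k (w k) (?S \<omega>) t))\<^sup>2)" if "t < n" for w jj t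
      unfolding a_def using b that by (intro norm_signal_le) (simp add: state_block_def)
    have "(\<Sum>w\<in>?W. energy c n j j' (?S \<omega>) w)
        \<le> (\<Sum>w\<in>?W. \<Sum>t<n. 2 * a * (\<Sum>k\<in>UNIV. (norm (encode c k (w k) (?S \<omega>) t))\<^sup>2))"
      unfolding energy_def
    proof (intro sum_mono)
      fix w t assume "t \<in> {..<n}"
      thus "(norm (signal c (?S \<omega>) w j t))\<^sup>2 + (norm (signal c (?S \<omega>) w j' t))\<^sup>2
          \<le> 2 * a * (\<Sum>k\<in>UNIV. (norm (encode c k (w k) (?S \<omega>) t))\<^sup>2)"
        using add_mono[OF sg[of t w j] sg[of t w j']] by simp
    qed
    also have "\<dots> = (\<Sum>t<n. \<Sum>k\<in>UNIV. 2 * a * (\<Sum>w\<in>?W. (norm (encode c k (w k) (?S \<omega>) t))\<^sup>2))"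
      unfolding sum_distrib_left by (subst sum.swap, subst (2) sum.swap) (rule refl)
    also have "\<dots> = (\<Sum>t<n. \<Sum>k\<in>UNIV. 2 * a * (TN * pw k t \<omega>))"
      unfolding TN_def pw_def
      by (intro sum.cong refl arg_cong[of _ _ "(*) (2 * a)"] sum_PiE_coordinate num)
    finally show ?thesis by (simp add: sum_distrib_left mult.assoc)
  qed
  have "ennreal (\<Sum>w\<in>?W. prob {\<omega> \<in> space \<Omega>. \<rho> * real n * P < energy c n j j' (?S \<omega>) w})
      = (\<Sum>w\<in>?W. emeasure \<Omega> {\<omega> \<in> space \<Omega>. \<rho> * real n * P < energy c n j j' (?S \<omega>) w})"
    by (simp add: emeasure_eq_measure sum_ennreal)
  also have "\<dots> \<le> (\<Sum>w\<in>?W. ennreal (1 / (\<rho> * real n * P)) * (\<integral>\<^sup>+\<omega>. ennreal (energy c n j j' (?S \<omega>) w) \<partial>\<Omega>))"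
    by (intro sum_mono markov)
  also have "\<dots> = ennreal (1 / (\<rho> * real n * P)) * (\<integral>\<^sup>+\<omega>. ennreal (\<Sum>w\<in>?W. energy c n j j' (?S \<omega>) w) \<partial>\<Omega>)"
    using enm by (simp add: sum_distrib_left[symmetric] nn_integral_sum[symmetric] sum_ennreal en0)
  also have "\<dots> \<le> ennreal (1 / (\<rho> * real n * P)) * (\<integral>\<^sup>+\<omega>. ennreal (2 * a * TN * (\<Sum>t<n. \<Sum>k\<in>UNIV. pw k t \<omega>)) \<partial>\<Omega>)"
  proof (intro mult_left_mono nn_integral_mono_AE)
    show "AE \<omega> in \<Omega>. ennreal (\<Sum>w\<in>?W. energy c n j j' (?S \<omega>) w) \<le> ennreal (2 * a * TN * (\<Sum>t<n. \<Sum>k\<in>UNIV. pw k t \<omega>))"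
      using channel_entry_bounds by eventually_elim (intro ennreal_leI total)
  qed simp
  also have "(\<integral>\<^sup>+\<omega>. ennreal (2 * a * TN * (\<Sum>t<n. \<Sum>k\<in>UNIV. pw k t \<omega>)) \<partial>\<Omega>)
      = ennreal (2 * a * TN) * (\<Sum>t<n. \<Sum>k\<in>UNIV. \<integral>\<^sup>+\<omega>. ennreal (pw k t \<omega>) \<partial>\<Omega>)"
  proof -
    have "(\<integral>\<^sup>+\<omega>. ennreal (2 * a * TN * (\<Sum>t<n. \<Sum>k\<in>UNIV. pw k t \<omega>)) \<partial>\<Omega>)
        = (\<integral>\<^sup>+\<omega>. ennreal (2 * a * TN) * (\<Sum>t<n. \<Sum>k\<in>UNIV. ennreal (pw k t \<omega>)) \<partial>\<Omega>)"
      using a0 TN0 pw0 by (simp add: ennreal_mult sum_nonneg sum_ennreal)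
    also have "\<dots> = ennreal (2 * a * TN) * (\<integral>\<^sup>+\<omega>. (\<Sum>t<n. \<Sum>k\<in>UNIV. ennreal (pw k t \<omega>)) \<partial>\<Omega>)"
      using pwm by (intro nn_integral_cmult borel_measurable_sum) auto
    also have "(\<integral>\<^sup>+\<omega>. (\<Sum>t<n. \<Sum>k\<in>UNIV. ennreal (pw k t \<omega>)) \<partial>\<Omega>) = (\<Sum>t<n. \<integral>\<^sup>+\<omega>. (\<Sum>k\<in>UNIV. ennreal (pw k t \<omega>)) \<partial>\<Omega>)"
      using pwm by (intro nn_integral_sum borel_measurable_sum) auto
    also have "\<dots> = (\<Sum>t<n. \<Sum>k\<in>UNIV. \<integral>\<^sup>+\<omega>. ennreal (pw k t \<omega>) \<partial>\<Omega>)"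
      using pwm by (intro sum.cong refl nn_integral_sum) auto
    finally show ?thesis .
  qed
  also have "(\<Sum>t<n. \<Sum>k\<in>UNIV. \<integral>\<^sup>+\<omega>. ennreal (pw k t \<omega>) \<partial>\<Omega>) \<le> (\<Sum>t<n. \<Sum>k\<in>(UNIV::'k set). ennreal P)"
    using pow unfolding power_constraint_def pw_def by (intro sum_mono) auto
  also have "(\<Sum>t<n. \<Sum>k\<in>(UNIV::'k set). ennreal P) = ennreal (real n * real CARD('k) * P)"
    using pos by (simp add: ennreal_mult ennreal_of_nat_eq_real_of_nat mult.assoc)
  also have "ennreal (1 / (\<rho> * real n * P)) * (ennreal (2 * a * TN) * ennreal (real n * real CARD('k) * P))
      = ennreal (1 / (\<rho> * real n * P) * (2 * a * TN * (real n * real CARD('k) * P)))"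
  proof -
    have "ennreal (2 * a * TN) * ennreal (real n * real CARD('k) * P) = ennreal (2 * a * TN * (real n * real CARD('k) * P))"
      using pos a0 TN0 by (intro ennreal_mult[symmetric]) auto
    thus ?thesis using pos a0 TN0 by (simp only:) (intro ennreal_mult[symmetric], auto)
  qed
  also have "1 / (\<rho> * real n * P) * (2 * a * TN * (real n * real CARD('k) * P))
      = TN * (2 * (real CARD('k))\<^sup>2 * ((real CARD('m))\<^sup>2 * hmax)\<^sup>2) / \<rho>"
    using pos by (simp add: a_def power2_eq_square)
  finally have "ennreal (\<Sum>w\<in>?W. prob {\<omega> \<in> space \<Omega>. \<rho> * real n * P < energy c n j j' (?S \<omega>) w})
      \<le> ennreal (TN * (2 * (real CARD('k))\<^sup>2 * ((real CARD('m))\<^sup>2 * hmax)\<^sup>2) / \<rho>)"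
    by (simp add: mult_left_mono)
  thus ?thesis
    using pos TN0 unfolding TN_def[symmetric] by (subst (asm) ennreal_le_iff) auto
qed

text \<open>Tuples are grouped by the messages outside \<open>insert i (demand j)\<close>, which act
  as known interference within a group, so that packing applies there. The number of groups gives
  the product in front, and few fades raise the exponent of \<open>P\<close> by the factor
  \<open>1 + \<beta>\<close> at most.\<close>

lemma count_typical:
  fixes demand :: "'j \<Rightarrow> 'k set"
  assumes j': "i \<in> demand j'" "i \<notin> demand j \<Longrightarrow> j' \<noteq> j"
    and F: "\<And>h v c. F h * v c = (\<Sum>r\<in>UNIV. L h c r * (\<Sum>c'\<in>UNIV. h (r, c') * v c'))"
    and Ca: "\<And>h c r. (\<forall>p. cmod (h p) \<le> hmax) \<Longrightarrow> cmod (L h c r) \<le> Ca" and \<delta>: "\<delta> > 0"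
    and c: "measurable_code n c" and S: "S \<in> space (PiM {..<n} (\<lambda>_. borel))"
    and S_le: "\<And>t j k r c. t < n \<Longrightarrow> cmod (S t $ j $ k $ r $ c) \<le> hmax"
    and few: "real (card (fades F \<delta> n j i S)) \<le> \<beta> * real n" and P: "P \<ge> 1"
  shows "(\<Sum>w\<in>{w \<in> PiE UNIV (\<lambda>k. {..<num_msgs c k}). energy c n j j' S w \<le> \<rho> * real n * P}.
      emeasure (PiM (noise_entries n) (\<lambda>_. CN)) (correct c n demand j j' i S w))
    \<le> ennreal (real (\<Prod>k\<in>- insert i (demand j). num_msgs c k) *
        (exp (real n * (real CARD('m) * (6 + (real CARD('m) * (real CARD('m) * (hmax * Ca) / \<delta>))\<^sup>2) + 2 * \<rho>))
          * P powr (real CARD('m) * (real n * (1 + \<beta>)))))"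
proof -
  let ?Wt = "{w \<in> PiE UNIV (\<lambda>k. {..<num_msgs c k}). energy c n j j' S w \<le> \<rho> * real n * P}"
  let ?O = "PiE (- insert i (demand j)) (\<lambda>k. {..<num_msgs c k})"
  let ?bd = "fades F \<delta> n j i S"
  define \<Lambda> where "\<Lambda> = real CARD('m) * (hmax * Ca) / \<delta>"
  \<comment> \<open>The channel from \<open>i\<close> to \<open>j'\<close> times the inverse in
    adjugate form. Outside the fades the denominator is at least \<open>\<delta>\<close> in modulus,
    which bounds the entries by \<open>\<Lambda>\<close>.\<close>
  define B where "B t r c = (\<Sum>c1\<in>UNIV. S t $ j' $ i $ r $ c1 * L (gains j i (S t)) c1 c) / F (gains j i (S t))" for t r c
  define bnd where "bnd = exp (real n * (real CARD('m) * (6 + (real CARD('m) * \<Lambda>)\<^sup>2) + 2 * \<rho>)) * P powr (real CARD('m) * (real n * (1 + \<beta>)))"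
  have g_le: "\<forall>p. cmod (gains j i (S t) p) \<le> hmax" if "t < n" for t
    using S_le[OF that] by (auto simp: gains_def)
  have Ca0: "Ca \<ge> 0"
  proof (rule order.trans[OF norm_ge_zero])
    show "cmod (L (\<lambda>_. 0) undefined undefined) \<le> Ca" using hmax_nonneg by (intro Ca) simp
  qed
  have \<Lambda>0: "\<Lambda> \<ge> 0" using Ca0 hmax_nonneg \<delta> by (simp add: \<Lambda>_def)
  have Brel: "(\<Sum>c\<in>UNIV. B t r c * (S t $ j $ i *v x) $ c) = (S t $ j' $ i *v x) $ r"
    if "t < n" "t \<notin> ?bd" for t r x
  proof -
    let ?h = "gains j i (S t)"
    have F0: "F ?h \<noteq> 0" using that \<delta> by (auto simp: fades_def)
    have G: "(S t $ j $ i *v x) $ c = (\<Sum>c'\<in>UNIV. ?h (c, c') * x $ c')" for c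
      by (simp add: matrix_vector_mult_def gains_def)
    have "(\<Sum>c\<in>UNIV. B t r c * (S t $ j $ i *v x) $ c)
        = (\<Sum>c\<in>UNIV. \<Sum>c1\<in>UNIV. S t $ j' $ i $ r $ c1 * (L ?h c1 c * (S t $ j $ i *v x) $ c) / F ?h)"
      unfolding B_def sum_divide_distrib sum_distrib_right by (simp add: mult_ac)
    also have "\<dots> = (\<Sum>c1\<in>UNIV. S t $ j' $ i $ r $ c1 * (\<Sum>c\<in>UNIV. L ?h c1 c * (S t $ j $ i *v x) $ c) / F ?h)"
      by (subst sum.swap) (simp add: sum_distrib_left sum_divide_distrib)
    also have "\<dots> = (\<Sum>c1\<in>UNIV. S t $ j' $ i $ r $ c1 * (F ?h * x $ c1) / F ?h)"
      unfolding G F[of ?h "\<lambda>c. x $ c"] ..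
    also have "\<dots> = (S t $ j' $ i *v x) $ r"
      using F0 by (simp add: matrix_vector_mult_def)
    finally show ?thesis .
  qed
  have B_le: "cmod (B t r c) \<le> \<Lambda>" if "t < n" "t \<notin> ?bd" for t r c
  proof -
    let ?h = "gains j i (S t)"
    have F\<delta>: "\<delta> \<le> cmod (F ?h)" using that by (auto simp: fades_def)
    have "cmod (\<Sum>c1\<in>UNIV. S t $ j' $ i $ r $ c1 * L ?h c1 c) \<le> (\<Sum>c1\<in>(UNIV::'m set). hmax * Ca)"
      by (intro order.trans[OF norm_sum] sum_mono)
         (unfold norm_mult, intro mult_mono S_le Ca g_le that hmax_nonneg norm_ge_zero)
    also have "\<dots> = real CARD('m) * (hmax * Ca)" by simp
    finally have "cmod (\<Sum>c1\<in>UNIV. S t $ j' $ i $ r $ c1 * L ?h c1 c) \<le> real CARD('m) * (hmax * Ca)" .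
    thus ?thesis unfolding B_def \<Lambda>_def norm_divide
      using F\<delta> \<delta> hmax_nonneg Ca0 by (intro frac_le) auto
  qed
  have group: "(\<Sum>w\<in>{w \<in> ?Wt. restrict w (- insert i (demand j)) = v}.
      emeasure (PiM (noise_entries n) (\<lambda>_. CN)) (correct c n demand j j' i S w)) \<le> ennreal bnd" for v
  proof -
    let ?V = "{w \<in> ?Wt. restrict w (- insert i (demand j)) = v}"
    have "(\<Sum>w\<in>?V. emeasure (PiM (noise_entries n) (\<lambda>_. CN)) (correct c n demand j j' i S w))
      \<le> ennreal (exp (real n * (real CARD('m) * (6 + (real CARD('m) * \<Lambda>)\<^sup>2) + 2 * \<rho>)) * P ^ (CARD('m) * (n + card ?bd)))"
    proof (rule packing_per_state[where B = B and demand = demand])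
      show "finite ?V" by (rule finite_subset[of _ "PiE UNIV (\<lambda>k. {..<num_msgs c k})"]) (auto intro!: finite_PiE)
      show "w k = w' k" if "w \<in> ?V" "w' \<in> ?V" "k \<notin> insert i (demand j)" for w w' k
      proof -
        have "restrict w (- insert i (demand j)) k = restrict w' (- insert i (demand j)) k" using that by simp
        thus ?thesis using that(3) by simp
      qed
      show "?bd \<subseteq> {..<n}" by (auto simp: fades_def)
    qed (use j' Brel B_le c S P \<Lambda>0 in \<open>auto simp: energy_def\<close>)
    also have "P ^ (CARD('m) * (n + card ?bd)) = P powr (real CARD('m) * (real n + real (card ?bd)))"
      using P by (simp add: powr_realpow[symmetric])
    also have "ennreal (exp (real n * (real CARD('m) * (6 + (real CARD('m) * \<Lambda>)\<^sup>2) + 2 * \<rho>)) * \<dots>) \<le> ennreal bnd"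
      unfolding bnd_def using few P
      by (intro ennreal_leI mult_left_mono powr_mono) (auto simp: distrib_left mult.commute)
    finally show ?thesis .
  qed
  have "(\<Sum>w\<in>?Wt. emeasure (PiM (noise_entries n) (\<lambda>_. CN)) (correct c n demand j j' i S w))
      = (\<Sum>v\<in>?O. \<Sum>w\<in>{w \<in> ?Wt. restrict w (- insert i (demand j)) = v}.
          emeasure (PiM (noise_entries n) (\<lambda>_. CN)) (correct c n demand j j' i S w))"
  proof (rule sum.group[symmetric])
    show "finite ?Wt" by (rule finite_subset[of _ "PiE UNIV (\<lambda>k. {..<num_msgs c k})"]) (auto intro!: finite_PiE)
    have "restrict w (- insert i (demand j)) \<in> ?O" if "w \<in> ?Wt" for w
      using that by (intro restrict_PiE_iff[THEN iffD2] ballI) auto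
    thus "(\<lambda>w. restrict w (- insert i (demand j))) ` ?Wt \<subseteq> ?O" by blast
  qed (auto intro!: finite_PiE)
  also have "\<dots> \<le> (\<Sum>v\<in>?O. ennreal bnd)" by (intro sum_mono group)
  also have "\<dots> = ennreal (real (card ?O) * bnd)"
    by (simp add: ennreal_mult' ennreal_of_nat_eq_real_of_nat)
  also have "card ?O = (\<Prod>k\<in>- insert i (demand j). num_msgs c k)" by (simp add: card_PiE)
  finally show ?thesis unfolding bnd_def \<Lambda>_def .
qed

end

section \<open>The outer bound\<close>

context interference_channel
begin

lemma AE_channel_entries_le:
  assumes "n > 0"
  shows "AE u in PiM (chan_entries n) (\<lambda>_. \<mu>). \<forall>e\<in>chan_entries n. cmod (u e) \<le> hmax"
proof -
  let ?N = "PiM (chan_entries n) (\<lambda>_. borel) :: (('j, 'k, 'm) entry \<Rightarrow> complex) measure"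
  have "Inl (0, undefined) \<in> (chan_entries n :: ('j, 'k, 'm) entry set)"
    using assms by (auto simp: chan_entries_def entries_def)
  hence "chan_entries n \<noteq> ({} :: ('j, 'k, 'm) entry set)" by auto
  from X_joint_law[OF this]
  have law: "PiM (chan_entries n) (\<lambda>_. \<mu>) = distr \<Omega> ?N (\<lambda>\<omega>. \<lambda>i\<in>chan_entries n. X i \<omega>)"
    by (simp, intro PiM_cong) (auto simp: chan_entries_def entry_law_def)
  have fin: "finite (chan_entries n :: ('j, 'k, 'm) entry set)"
    unfolding chan_entries_def by auto
  have rv: "(\<lambda>\<omega>. \<lambda>i\<in>chan_entries n. X i \<omega>) \<in> \<Omega> \<rightarrow>\<^sub>M ?N"
    by (intro measurable_restrict X_measurable)
  have "Measurable.pred ?N (\<lambda>u. \<forall>e\<in>chan_entries n. cmod (u e) \<le> hmax)"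
  proof (rule pred_ball_countable[OF countable_finite[OF fin]])
    fix e :: "('j, 'k, 'm) entry" assume "e \<in> chan_entries n"
    hence [measurable]: "(\<lambda>u. u e) \<in> borel_measurable ?N" by (rule measurable_component_singleton)
    show "Measurable.pred ?N (\<lambda>u. cmod (u e) \<le> hmax)" by measurable
  qed
  hence "{u \<in> space ?N. \<forall>e\<in>chan_entries n. cmod (u e) \<le> hmax} \<in> sets ?N" by (simp only: pred_def)
  moreover have "AE \<omega> in \<Omega>. \<forall>e\<in>chan_entries n. cmod ((\<lambda>i\<in>chan_entries n. X i \<omega>) e) \<le> hmax"
    using channel_entry_bounds
  proof eventually_elim
    case (elim \<omega>)
    show ?case
    proof
      fix e :: "('j, 'k, 'm) entry" assume e: "e \<in> chan_entries n"
      then obtain t j k r c where "e = Inl (t, j, k, r, c)" by (auto simp: chan_entries_def)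
      thus "cmod ((\<lambda>i\<in>chan_entries n. X i \<omega>) e) \<le> hmax" using elim e by simp
    qed
  qed
  ultimately show ?thesis unfolding law by (simp only: AE_distr_iff[OF rv])
qed

text \<open>For every tuple one of four things happens: a decoding error, excess energy, too many
  fades, or correct decoding under typical conditions. The first three average to at most
  \<open>1/4 + 1/8 + 1/8\<close>, so the last keeps half of the weight, and packing bounds its total
  after integration over the channel.\<close>

lemma converse_one_block:
  fixes demand :: "'j \<Rightarrow> 'k set"
  assumes j': "i \<in> demand j'" "i \<notin> demand j \<Longrightarrow> j' \<noteq> j"
    and F: "polyfun F" "\<And>h v c. F h * v c = (\<Sum>r\<in>UNIV. L h c r * (\<Sum>c'\<in>UNIV. h (r, c') * v c'))"
    and Ca: "\<And>h c r. (\<forall>p. cmod (h p) \<le> hmax) \<Longrightarrow> cmod (L h c r) \<le> Ca" and \<delta>: "\<delta> > 0"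
    and fade: "\<And>t. prob {\<omega> \<in> space \<Omega>. cmod (F (gains j i (H t \<omega>))) < \<delta>} \<le> \<beta> / 8"
    and \<rho>: "\<rho> > 0" "(2 * (real CARD('k))\<^sup>2 * ((real CARD('m))\<^sup>2 * hmax)\<^sup>2) / \<rho> \<le> 1 / 8"
    and \<beta>: "\<beta> > 0" and P: "P \<ge> 1" and n: "n > 0"
    and c: "measurable_code n c" "power_constraint \<Omega> H n c P" and num: "\<And>k. num_msgs c k > 0"
    and err: "error_prob \<Omega> H Z demand n c \<le> 1 / 4"
  shows "real (\<Prod>k\<in>insert i (demand j). num_msgs c k) \<le> 2 *
        (exp (real n * (real CARD('m) * (6 + (real CARD('m) * (real CARD('m) * (hmax * Ca) / \<delta>))\<^sup>2) + 2 * \<rho>))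
          * P powr (real CARD('m) * (real n * (1 + \<beta>))))"
proof -
  let ?W = "PiE UNIV (\<lambda>k. {..<num_msgs c k})"
  let ?CE = "chan_entries n :: ('j, 'k, 'm) entry set" and ?NE = "noise_entries n :: ('j, 'k, 'm) entry set"
  let ?U = "PiM ?CE (\<lambda>_. borel) :: (('j, 'k, 'm) entry \<Rightarrow> complex) measure"
  let ?V = "PiM ?NE (\<lambda>_. borel) :: (('j, 'k, 'm) entry \<Rightarrow> complex) measure"
  let ?LU = "PiM ?CE (\<lambda>_. \<mu>)" and ?LV = "PiM ?NE (\<lambda>_. CN)"
  define J where "J \<omega> = (\<lambda>i\<in>?CE. X i \<omega>, \<lambda>i\<in>?NE. X i \<omega>)" for \<omega>
  define bnd where "bnd = exp (real n * (real CARD('m) * (6 + (real CARD('m) * (real CARD('m) * (hmax * Ca) / \<delta>))\<^sup>2) + 2 * \<rho>))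
          * P powr (real CARD('m) * (real n * (1 + \<beta>)))"
  define TN where "TN = real (\<Prod>k\<in>UNIV. num_msgs c k)"
  define No where "No = real (\<Prod>k\<in>- insert i (demand j). num_msgs c k)"
  define ok where "ok S w \<longleftrightarrow> energy c n j j' S w \<le> \<rho> * real n * P \<and> real (card (fades F \<delta> n j i S)) \<le> \<beta> * real n"
    for S w
  \<comment> \<open>A set of pairs of channel and noise entries. Its section at a fixed channel is
    the set of the packing bound, or empty if the conditions are atypical.\<close>
  define Q where "Q w = {q \<in> space (?U \<Otimes>\<^sub>M ?V). snd q \<in> correct c n demand j j' i (state_of n (fst q)) w
      \<and> ok (state_of n (fst q)) w}" for w
  have bnd0: "bnd \<ge> 0" by (simp add: bnd_def)
  have No0: "No \<ge> 0" unfolding No_def by (rule of_nat_0_le_iff)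
  have Jm: "J \<in> \<Omega> \<rightarrow>\<^sub>M ?U \<Otimes>\<^sub>M ?V"
    unfolding J_def[abs_def] by (intro measurable_Pair measurable_restrict X_measurable)
  have lawJ: "distr \<Omega> (?U \<Otimes>\<^sub>M ?V) J = ?LU \<Otimes>\<^sub>M ?LV"
    unfolding J_def[abs_def] by (rule channel_noise_law[OF n])
  have setsU: "sets ?LU = sets ?U" and setsV: "sets ?LV = sets ?V" by (intro sets_PiM_cong; simp)+
  have setsUV: "sets (?LU \<Otimes>\<^sub>M ?LV) = sets (?U \<Otimes>\<^sub>M ?V)"
    by (intro sets_pair_measure_cong setsU setsV)
  interpret V: prob_space ?LV by (intro prob_space_PiM prob_CN)
  have wk: "\<And>k. w k < num_msgs c k" if "w \<in> ?W" for w using that by auto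
  have dec: "Measurable.pred (?U \<Otimes>\<^sub>M ?V) (\<lambda>q. decode c jj k (receive c n (state_of n (fst q)) w jj (snd q)) (state_of n (fst q)) = x)"
    if w: "w \<in> ?W" for jj k w x
    using decision_measurable[OF c(1) wk[OF w], of jj k] by measurable
  have okm: "Measurable.pred ?U (\<lambda>u. ok (state_of n u) w)" if w: "w \<in> ?W" for w
  proof -
    have [measurable]: "(\<lambda>u. energy c n j j' (state_of n u) w) \<in> borel_measurable ?U"
      by (rule measurable_compose[OF state_of_measurable energy_measurable[OF c(1) wk[OF w]]])
    have [measurable]: "(\<lambda>u. real (card (fades F \<delta> n j i (state_of n u)))) \<in> borel_measurable ?U"
      by (rule measurable_compose[OF state_of_measurable fades_measurable[OF F(1)]])
    show ?thesis unfolding ok_def by measurable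
  qed
  have Qs: "Q w \<in> sets (?U \<Otimes>\<^sub>M ?V)" if w: "w \<in> ?W" for w
  proof -
    have okp: "Measurable.pred (?U \<Otimes>\<^sub>M ?V) (\<lambda>q. ok (state_of n (fst q)) w)"
      by (rule measurable_compose[OF measurable_fst okm[OF w]])
    have "Measurable.pred (?U \<Otimes>\<^sub>M ?V) (\<lambda>q.
       ((\<forall>k\<in>demand j. decode c j k (receive c n (state_of n (fst q)) w j (snd q)) (state_of n (fst q)) = w k)
        \<and> decode c j' i (receive c n (state_of n (fst q)) w j' (snd q)) (state_of n (fst q)) = w i) \<and> ok (state_of n (fst q)) w)"
      by (intro pred_intros_logic pred_ball_countable countable_finite finite dec[OF w] okp)
    moreover have "Q w = {q \<in> space (?U \<Otimes>\<^sub>M ?V).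
       ((\<forall>k\<in>demand j. decode c j k (receive c n (state_of n (fst q)) w j (snd q)) (state_of n (fst q)) = w k)
        \<and> decode c j' i (receive c n (state_of n (fst q)) w j' (snd q)) (state_of n (fst q)) = w i) \<and> ok (state_of n (fst q)) w}"
      unfolding Q_def correct_def by (auto simp: space_pair_measure space_PiM)
    ultimately show ?thesis by (simp only: pred_def)
  qed
  have sum_Q: "(\<Sum>w\<in>?W. prob (J -` Q w \<inter> space \<Omega>)) \<le> No * bnd"
  proof -
    have "ennreal (\<Sum>w\<in>?W. prob (J -` Q w \<inter> space \<Omega>)) = (\<Sum>w\<in>?W. emeasure \<Omega> (J -` Q w \<inter> space \<Omega>))"
      by (simp add: emeasure_eq_measure sum_ennreal)
    also have "\<dots> = (\<Sum>w\<in>?W. emeasure (?LU \<Otimes>\<^sub>M ?LV) (Q w))"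
      using Qs by (intro sum.cong refl) (simp add: lawJ[symmetric] emeasure_distr[OF Jm])
    also have "\<dots> = (\<Sum>w\<in>?W. \<integral>\<^sup>+u. emeasure ?LV (Pair u -` Q w) \<partial>?LU)"
      using Qs setsUV by (intro sum.cong refl V.emeasure_pair_measure_alt) auto
    also have "\<dots> = (\<integral>\<^sup>+u. (\<Sum>w\<in>?W. emeasure ?LV (Pair u -` Q w)) \<partial>?LU)"
      using Qs setsUV by (intro nn_integral_sum[symmetric] V.measurable_emeasure_Pair) auto
    also have "\<dots> \<le> (\<integral>\<^sup>+u. ennreal (No * bnd) \<partial>?LU)"
    proof (rule nn_integral_mono_AE)
      show "AE u in ?LU. (\<Sum>w\<in>?W. emeasure ?LV (Pair u -` Q w)) \<le> ennreal (No * bnd)"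
        using AE_channel_entries_le[OF n] AE_space
      proof eventually_elim
        case (elim u)
        let ?S = "state_of n u"
        have u: "u \<in> space ?U" using elim(2) sets_eq_imp_space_eq[OF setsU] by simp
        have S: "?S \<in> space (PiM {..<n} (\<lambda>_. borel))" by (rule measurable_space[OF state_of_measurable u])
        have S_le: "cmod (?S t $ j $ k $ r $ c) \<le> hmax" if "t < n" for t j k r c
          using elim(1) that by (simp add: state_of_def chan_entries_def entries_def)
        have corr_space: "z \<in> space ?V" if "z \<in> correct c n demand j j' i ?S w" for z w
          using that by (simp add: correct_def space_PiM)
        show ?case
        proof (cases "real (card (fades F \<delta> n j i ?S)) \<le> \<beta> * real n")
          case True
          have "(\<Sum>w\<in>?W. emeasure ?LV (Pair u -` Q w))
              = (\<Sum>w\<in>?W. if energy c n j j' ?S w \<le> \<rho> * real n * P then emeasure ?LV (correct c n demand j j' i ?S w) else 0)"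
          proof (rule sum.cong[OF refl])
            fix w
            have "Pair u -` Q w = (if energy c n j j' ?S w \<le> \<rho> * real n * P then correct c n demand j j' i ?S w else {})"
              using True u corr_space by (auto simp: Q_def ok_def space_pair_measure)
            thus "emeasure ?LV (Pair u -` Q w) = (if energy c n j j' ?S w \<le> \<rho> * real n * P then emeasure ?LV (correct c n demand j j' i ?S w) else 0)"
              by simp
          qed
          also have "\<dots> = (\<Sum>w\<in>{w \<in> ?W. energy c n j j' ?S w \<le> \<rho> * real n * P}. emeasure ?LV (correct c n demand j j' i ?S w))"
            by (rule sum.inter_filter[symmetric]) (auto intro!: finite_PiE)
          also have "\<dots> \<le> ennreal (No * bnd)"
            unfolding No_def bnd_def
            by (rule count_typical[where demand = demand and i = i and j = j and j' = j' and F = F and L = L, OF j' F(2) Ca \<delta> c(1) S S_le True P])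
          finally show ?thesis .
        next
          case False
          hence "Pair u -` Q w = {}" for w by (auto simp: Q_def ok_def)
          thus ?thesis by simp
        qed
      qed
    qed
    also have "\<dots> = ennreal (No * bnd)"
      using prob_space.emeasure_space_1[OF prob_space_PiM[of ?CE "\<lambda>_. \<mu>", OF prob_mu]] by simp
    finally show ?thesis by (subst (asm) ennreal_le_iff) (simp_all add: No0 bnd0)
  qed
  let ?err = "\<lambda>w. {\<omega> \<in> space \<Omega>. \<exists>j. \<exists>k\<in>demand j.
          decode c j k (received_block H Z n c w j \<omega>) (state_block H n \<omega>) \<noteq> w k}"
  let ?hot = "\<lambda>w. {\<omega> \<in> space \<Omega>. \<rho> * real n * P < energy c n j j' (state_block H n \<omega>) w}"
  let ?faded = "{\<omega> \<in> space \<Omega>. \<beta> * real n < real (card (fades F \<delta> n j i (state_block H n \<omega>)))}"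
  have cover: "1 \<le> prob (?err w) + prob (J -` Q w \<inter> space \<Omega>) + prob (?hot w) + prob ?faded" if w: "w \<in> ?W" for w
  proof -
    have dJ: "Measurable.pred \<Omega> (\<lambda>\<omega>. decode c jj k (received_block H Z n c w jj \<omega>) (state_block H n \<omega>) = x)" for jj k x
      using measurable_compose[OF Jm dec[OF w, of jj k x]]
      by (simp add: J_def received_block_eq state_block_eq)
    have "Measurable.pred \<Omega> (\<lambda>\<omega>. \<exists>j\<in>UNIV. \<exists>k\<in>demand j.
          decode c j k (received_block H Z n c w j \<omega>) (state_block H n \<omega>) \<noteq> w k)"
      by (intro pred_bex_finite finite pred_intros_logic dJ)
    hence e: "?err w \<in> events" by (simp only: pred_def bex_UNIV)
    have h: "?hot w \<in> events"
    proof -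
      have [measurable]: "(\<lambda>\<omega>. energy c n j j' (state_block H n \<omega>) w) \<in> borel_measurable \<Omega>"
        by (rule measurable_compose[OF state_block_measurable energy_measurable[OF c(1) wk[OF w]]])
      show ?thesis by measurable
    qed
    have f: "?faded \<in> events"
    proof -
      have [measurable]: "(\<lambda>\<omega>. real (card (fades F \<delta> n j i (state_block H n \<omega>)))) \<in> borel_measurable \<Omega>"
        by (rule measurable_compose[OF state_block_measurable fades_measurable[OF F(1)]])
      show ?thesis by measurable
    qed
    have q: "J -` Q w \<inter> space \<Omega> \<in> events" by (rule measurable_sets[OF Jm Qs[OF w]])
    have "space \<Omega> \<subseteq> ?err w \<union> (J -` Q w \<inter> space \<Omega>) \<union> ?hot w \<union> ?faded"
    proof
      fix \<omega> assume \<omega>: "\<omega> \<in> space \<Omega>"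
      show "\<omega> \<in> ?err w \<union> (J -` Q w \<inter> space \<Omega>) \<union> ?hot w \<union> ?faded"
      proof (rule ccontr)
        assume no: "\<omega> \<notin> ?err w \<union> (J -` Q w \<inter> space \<Omega>) \<union> ?hot w \<union> ?faded"
        have right: "decode c jj k (received_block H Z n c w jj \<omega>) (state_block H n \<omega>) = w k" if "k \<in> demand jj" for jj k
          using no \<omega> that by blast
        have "ok (state_block H n \<omega>) w" using no \<omega> by (auto simp: ok_def not_less)
        moreover have "(\<lambda>i\<in>?NE. X i \<omega>) \<in> correct c n demand j j' i (state_block H n \<omega>) w"
          using right j'(1) by (auto simp: correct_def space_PiM received_block_eq[symmetric])
        moreover have "J \<omega> \<in> space (?U \<Otimes>\<^sub>M ?V)" by (rule measurable_space[OF Jm \<omega>])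
        ultimately have "J \<omega> \<in> Q w" by (simp add: Q_def J_def state_block_eq)
        thus False using no \<omega> by blast
      qed
    qed
    moreover have qe: "?err w \<union> (J -` Q w \<inter> space \<Omega>) \<in> events" and qh: "?err w \<union> (J -` Q w \<inter> space \<Omega>) \<union> ?hot w \<in> events"
      by (intro sets.Un e q h)+
    ultimately have "prob (space \<Omega>) \<le> prob (?err w \<union> (J -` Q w \<inter> space \<Omega>) \<union> ?hot w \<union> ?faded)"
      by (intro finite_measure_mono sets.Un[OF qh f])
    also have "\<dots> \<le> prob (?err w \<union> (J -` Q w \<inter> space \<Omega>) \<union> ?hot w) + prob ?faded"
      by (rule measure_Un_le[OF qh f])
    also have "prob (?err w \<union> (J -` Q w \<inter> space \<Omega>) \<union> ?hot w) \<le> prob (?err w \<union> (J -` Q w \<inter> space \<Omega>)) + prob (?hot w)"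
      by (rule measure_Un_le[OF qe h])
    also have "prob (?err w \<union> (J -` Q w \<inter> space \<Omega>)) \<le> prob (?err w) + prob (J -` Q w \<inter> space \<Omega>)"
      by (rule measure_Un_le[OF e q])
    finally have "prob (space \<Omega>) \<le> prob (?err w) + prob (J -` Q w \<inter> space \<Omega>) + prob (?hot w) + prob ?faded" by simp
    thus ?thesis by (simp only: prob_space)
  qed
  have TN0: "TN > 0" unfolding TN_def using num by (simp add: prod_pos)
  have cardW: "real (card ?W) = TN" by (simp add: card_PiE TN_def)
  have "TN = (\<Sum>w\<in>?W. 1)" by (simp add: cardW)
  also have "\<dots> \<le> (\<Sum>w\<in>?W. prob (?err w) + prob (J -` Q w \<inter> space \<Omega>) + prob (?hot w) + prob ?faded)"
    by (intro sum_mono cover)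
  also have "\<dots> = (\<Sum>w\<in>?W. prob (?err w)) + (\<Sum>w\<in>?W. prob (J -` Q w \<inter> space \<Omega>)) + (\<Sum>w\<in>?W. prob (?hot w)) + TN * prob ?faded"
    by (simp add: sum.distrib cardW)
  also have "(\<Sum>w\<in>?W. prob (?err w)) \<le> TN / 4"
  proof -
    have "error_prob \<Omega> H Z demand n c = (\<Sum>w\<in>?W. prob (?err w)) / TN"
      by (simp add: error_prob_def TN_def)
    thus ?thesis using err TN0 by (simp add: divide_le_eq)
  qed
  also have "(\<Sum>w\<in>?W. prob (?hot w)) \<le> TN / 8"
  proof -
    have "(\<Sum>w\<in>?W. prob (?hot w)) \<le> TN * ((2 * (real CARD('k))\<^sup>2 * ((real CARD('m))\<^sup>2 * hmax)\<^sup>2) / \<rho>)"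
      using energy_markov[OF c(1) num c(2) _ n \<rho>(1), of j j'] P by (simp add: TN_def)
    also have "\<dots> \<le> TN * (1 / 8)" using \<rho>(2) TN0 by (intro mult_left_mono) auto
    finally show ?thesis by simp
  qed
  also have "TN * prob ?faded \<le> TN * (1 / 8)"
    using few_fades[OF F(1) fade \<beta> n] TN0 by (intro mult_left_mono) auto
  also note sum_Q
  finally have half: "TN / 2 \<le> No * bnd" by simp
  \<comment> \<open>The messages outside \<open>insert i (demand j)\<close> occur on both sides and
    cancel, leaving a bound for the others alone.\<close>
  have "TN = real (\<Prod>k\<in>insert i (demand j). num_msgs c k) * No"
    unfolding TN_def No_def
    by (subst of_nat_mult[symmetric], subst prod.union_disjoint[symmetric]) (auto intro!: arg_cong[of _ _ real] prod.cong)
  moreover have "No > 0" unfolding No_def using num by (simp add: prod_pos)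
  ultimately have "No * real (\<Prod>k\<in>insert i (demand j). num_msgs c k) \<le> No * (2 * bnd)"
    using half by (simp add: mult_ac)
  hence "real (\<Prod>k\<in>insert i (demand j). num_msgs c k) \<le> 2 * bnd"
    using \<open>No > 0\<close> by (simp only: mult_le_cancel_left_pos)
  thus ?thesis by (simp only: bnd_def)
qed

text \<open>A single block length with error below \<open>1/4\<close> suffices: taking logarithms
  and dividing by \<open>n\<close> leaves a constant that does not involve \<open>P\<close>. The
  bound defines a closed half space, hence survives the closure in the capacity region.\<close>

lemma converse_bound:
  fixes demand :: "'j \<Rightarrow> 'k set"
  assumes j': "i \<in> demand j'" "i \<notin> demand j \<Longrightarrow> j' \<noteq> j" and \<beta>: "\<beta> > 0"
  shows "\<exists>C. \<forall>P\<ge>1. \<forall>R\<in>capacity_region \<Omega> H Z demand P.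
     (\<Sum>k\<in>insert i (demand j). R $ k) \<le> C + real CARD('m) * (1 + \<beta>) * log 2 P"
proof -
  obtain F L where F: "polyfun F" "F (\<lambda>(r, c). if r = c then 1 else 0) \<noteq> 0"
    and L: "\<And>c r. polyfun (\<lambda>h. L h c r)"
    and FL: "\<And>h v c. F h * v c = (\<Sum>r\<in>UNIV. L h c r * (\<Sum>c'\<in>(UNIV::'m set). h (r, c') * v c'))"
    using generic_adjugate[where 'm = 'm] by blast
  obtain \<delta> where \<delta>: "\<delta> > 0" and fade: "\<And>t. prob {\<omega> \<in> space \<Omega>. cmod (F (gains j i (H t \<omega>))) < \<delta>} \<le> \<beta> / 8"
    using fade_small[OF F, of "\<beta> / 8" j i] \<beta> by auto
  have "\<forall>p. \<exists>C. \<forall>h. (\<forall>i. cmod (h i) \<le> hmax) \<longrightarrow> cmod (L h (fst p) (snd p)) \<le> C"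
    using polyfun_bounded[OF L] by blast
  from choice[OF this] obtain C0 where C0: "\<And>p h. (\<forall>i. cmod (h i) \<le> hmax) \<Longrightarrow> cmod (L h (fst p) (snd p)) \<le> C0 p"
    by blast
  define Ca where "Ca = Max (range C0)"
  have Ca: "cmod (L h c r) \<le> Ca" if "\<forall>p. cmod (h p) \<le> hmax" for h c r
  proof -
    have "cmod (L h c r) \<le> C0 (c, r)" using C0[OF that, of "(c, r)"] by simp
    also have "\<dots> \<le> Ca" unfolding Ca_def by (intro Max_ge) auto
    finally show ?thesis .
  qed
  define K where "K = 2 * (real CARD('k))\<^sup>2 * ((real CARD('m))\<^sup>2 * hmax)\<^sup>2"
  \<comment> \<open>Puts the Markov bound for excess energy at most at \<open>1/8\<close>.\<close>
  define \<rho> where "\<rho> = 8 * K + 1"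
  have K0: "K \<ge> 0" by (simp add: K_def)
  have \<rho>: "\<rho> > 0" "K / \<rho> \<le> 1 / 8" using K0 by (auto simp: \<rho>_def field_simps)
  define E where "E = real CARD('m) * (6 + (real CARD('m) * (real CARD('m) * (hmax * Ca) / \<delta>))\<^sup>2) + 2 * \<rho>"
  \<comment> \<open>The summand 1 covers the factor 2, worth \<open>1 / n\<close> bits per use; the
    rest converts the exponential rate \<open>E\<close> into bits.\<close>
  define C where "C = 1 + \<bar>E\<bar> / ln 2"
  have ach: "(\<Sum>k\<in>insert i (demand j). R $ k) \<le> C + real CARD('m) * (1 + \<beta>) * log 2 P"
    if P: "P \<ge> 1" and R: "achievable \<Omega> H Z demand P R" for P R
  proof -
    obtain c where c: "\<And>n. measurable_code n (c n)" "\<And>n. power_constraint \<Omega> H n (c n) P"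
        "\<And>n k. num_msgs (c n) k = nat \<lceil>2 powr (real n * R $ k)\<rceil>"
      and lim: "(\<lambda>n. error_prob \<Omega> H Z demand n (c n)) \<longlonglongrightarrow> 0"
      using R unfolding achievable_def by blast
    have "\<forall>\<^sub>F n in sequentially. error_prob \<Omega> H Z demand n (c n) < 1 / 4 \<and> n > 0"
      using order_tendstoD(2)[OF lim, of "1/4"] eventually_gt_at_top[of "0::nat"] by (auto intro: eventually_conj)
    then obtain n where "error_prob \<Omega> H Z demand n (c n) < 1 / 4 \<and> n > 0"
      unfolding eventually_sequentially by blast
    hence n: "error_prob \<Omega> H Z demand n (c n) \<le> 1 / 4" "n > 0" by simp_all
    have num_ge: "2 powr (real n * R $ k) \<le> real (num_msgs (c n) k)" for k
      unfolding c(3) by (rule real_nat_ceiling_ge)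
    have num: "num_msgs (c n) k > 0" for k
    proof -
      have "0 < 2 powr (real n * R $ k)" by simp
      also note num_ge
      finally show ?thesis by simp
    qed
    have "2 powr (real n * (\<Sum>k\<in>insert i (demand j). R $ k)) = (\<Prod>k\<in>insert i (demand j). 2 powr (real n * R $ k))"
      by (simp only: sum_distrib_left) (rule powr_sum, auto)
    also have "\<dots> \<le> (\<Prod>k\<in>insert i (demand j). real (num_msgs (c n) k))"
      by (intro prod_mono conjI num_ge) auto
    also have "\<dots> = real (\<Prod>k\<in>insert i (demand j). num_msgs (c n) k)" by (rule of_nat_prod[symmetric])
    also have "\<dots> \<le> 2 * (exp (real n * E) * P powr (real CARD('m) * (real n * (1 + \<beta>))))"
      unfolding E_def
      by (rule converse_one_block[where demand = demand and i = i and j = j and j' = j' and F = F and L = L, OF j' F(1) FL Ca \<delta> fade \<rho>(1) \<rho>(2)[unfolded K_def] \<beta> P n(2) c(1,2) num n(1)])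
    finally have "log 2 (2 powr (real n * (\<Sum>k\<in>insert i (demand j). R $ k)))
        \<le> log 2 (2 * (exp (real n * E) * P powr (real CARD('m) * (real n * (1 + \<beta>)))))"
      using P by (subst log_le_cancel_iff) auto
    also have "\<dots> = 1 + (real n * E / ln 2 + real CARD('m) * (real n * (1 + \<beta>)) * log 2 P)"
    proof -
      have "log 2 (exp (real n * E)) = real n * E / ln 2" by (simp add: log_def)
      moreover have "log 2 (P powr (real CARD('m) * (real n * (1 + \<beta>)))) = real CARD('m) * (real n * (1 + \<beta>)) * log 2 P"
        using P by (simp add: log_powr)
      ultimately show ?thesis using P by (simp add: log_mult)
    qed
    finally have "real n * (\<Sum>k\<in>insert i (demand j). R $ k)
        \<le> 1 + (real n * E / ln 2 + real CARD('m) * (real n * (1 + \<beta>)) * log 2 P)" by simp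
    also have "\<dots> \<le> real n * 1 + (real n * (\<bar>E\<bar> / ln 2) + real CARD('m) * (real n * (1 + \<beta>)) * log 2 P)"
      using n(2) by (intro add_mono order_refl) (auto simp: divide_right_mono mult_left_mono)
    also have "\<dots> = real n * (C + real CARD('m) * (1 + \<beta>) * log 2 P)"
      unfolding C_def by (simp add: algebra_simps)
    finally show ?thesis using n(2) by (subst (asm) mult_le_cancel_left_pos) auto
  qed
  show ?thesis
  proof (intro exI[of _ C] allI impI ballI)
    fix P R assume P: "P \<ge> 1" and R: "R \<in> capacity_region \<Omega> H Z demand P"
    let ?T = "{R :: real ^ 'k. (\<Sum>k\<in>insert i (demand j). R $ k) \<le> C + real CARD('m) * (1 + \<beta>) * log 2 P}"
    have "closed ?T" by (intro closed_Collect_le continuous_intros)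
    moreover have "{R. achievable \<Omega> H Z demand P R} \<subseteq> ?T" using ach[OF P] by blast
    ultimately have "capacity_region \<Omega> H Z demand P \<subseteq> ?T"
      unfolding capacity_region_def by (intro closure_minimal)
    thus "(\<Sum>k\<in>insert i (demand j). R $ k) \<le> C + real CARD('m) * (1 + \<beta>) * log 2 P" using R by blast
  qed
qed

text \<open>Division by \<open>log 2 P\<close> removes the constant, and the share of the fades,
  \<open>M * \<beta> = \<epsilon>\<close>, is arbitrarily small. The case
  \<open>i \<in> demand j\<close> is kept for receivers that want every message.\<close>

lemma DoF_outer:
  fixes demand :: "'j \<Rightarrow> 'k set" and d :: "real ^ 'k"
  assumes j': "i \<in> demand j'" "i \<notin> demand j \<Longrightarrow> j' \<noteq> j" and d: "d \<in> DoF_region \<Omega> H Z demand"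
  shows "(\<Sum>k\<in>insert i (demand j). d $ k) \<le> real CARD('m)"
proof (rule field_le_epsilon)
  fix \<epsilon> :: real assume \<epsilon>: "\<epsilon> > 0"
  define M where "M = real CARD('m)"
  have M: "M > 0" by (simp add: M_def)
  define \<beta> where "\<beta> = \<epsilon> / M"
  have \<beta>: "\<beta> > 0" using \<epsilon> M by (simp add: \<beta>_def)
  obtain R where R: "\<And>P. P > 0 \<Longrightarrow> R P \<in> capacity_region \<Omega> H Z demand P"
    and lim: "\<And>k. ((\<lambda>P. R P $ k / log 2 P) \<longlongrightarrow> d $ k) at_top"
    using d unfolding DoF_region_def by blast
  obtain C where C: "\<And>P R. P \<ge> 1 \<Longrightarrow> R \<in> capacity_region \<Omega> H Z demand P \<Longrightarrow>
      (\<Sum>k\<in>insert i (demand j). R $ k) \<le> C + M * (1 + \<beta>) * log 2 P"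
    using converse_bound[where demand = demand and i = i and j = j and j' = j', OF j' \<beta>] unfolding M_def by blast
  have log_top: "filterlim (\<lambda>P :: real. log 2 P) at_top at_top"
    unfolding log_def
    by (rule filterlim_at_top_mult_tendsto_pos[OF tendsto_const, of "1 / ln 2", simplified]) (auto intro: ln_at_top)
  have "((\<lambda>P. \<Sum>k\<in>insert i (demand j). R P $ k / log 2 P) \<longlongrightarrow> (\<Sum>k\<in>insert i (demand j). d $ k)) at_top"
    by (intro tendsto_sum lim)
  moreover have "((\<lambda>P. C / log 2 P + M * (1 + \<beta>)) \<longlongrightarrow> 0 + M * (1 + \<beta>)) at_top"
    by (intro tendsto_add tendsto_const tendsto_divide_0[OF tendsto_const] filterlim_at_top_imp_at_infinity log_top)
  moreover have "\<forall>\<^sub>F P in at_top. (\<Sum>k\<in>insert i (demand j). R P $ k / log 2 P) \<le> C / log 2 P + M * (1 + \<beta>)"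
    using eventually_gt_at_top[of 1]
  proof eventually_elim
    case (elim P)
    have l: "log 2 P > 0" using elim by simp
    have "(\<Sum>k\<in>insert i (demand j). R P $ k / log 2 P) = (\<Sum>k\<in>insert i (demand j). R P $ k) / log 2 P"
      by (rule sum_divide_distrib[symmetric])
    also have "\<dots> \<le> (C + M * (1 + \<beta>) * log 2 P) / log 2 P"
      using l elim by (intro divide_right_mono C R) auto
    also have "\<dots> = C / log 2 P + M * (1 + \<beta>)" using l by (simp add: add_divide_distrib)
    finally show ?case .
  qed
  ultimately have "(\<Sum>k\<in>insert i (demand j). d $ k) \<le> 0 + M * (1 + \<beta>)"
    by (intro tendsto_le[OF trivial_limit_at_top_linorder])
  also have "\<dots> = M + \<epsilon>" using M by (simp add: \<beta>_def distrib_left)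
  finally show "(\<Sum>k\<in>insert i (demand j). d $ k) \<le> real CARD('m) + \<epsilon>" by (simp add: M_def)
qed

end

theorem theorem1:
  fixes \<Omega> :: "'w measure"
    and H :: "nat \<Rightarrow> 'w \<Rightarrow> ('j::finite, 'k::finite, 'm::finite) channel_state"
    and Z :: "nat \<Rightarrow> 'w \<Rightarrow> complex ^ 'm ^ 'j"
    and \<mu> :: "complex measure"
    and hmin hmax :: real
    and demand :: "'j \<Rightarrow> 'k set"
  assumes "interference_channel \<Omega> H Z \<mu> hmin hmax"
    and "\<And>k. \<exists>j. k \<in> demand j"
  shows "DoF_region \<Omega> H Z demand =
    {d. (\<forall>k. 0 \<le> d $ k) \<and>
        (\<forall>j. (\<Sum>k\<in>demand j. d $ k)
              + (if - demand j = {} then 0 else Max ((\<lambda>i. d $ i) ` (- demand j)))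
              \<le> real CARD('m))}"
proof (intro equalityI subsetI)
  interpret interference_channel \<Omega> H Z \<mu> hmin hmax by (fact assms(1))
  fix d assume d: "d \<in> DoF_region \<Omega> H Z demand"
  have "(\<Sum>k\<in>demand j. d $ k) + (if - demand j = {} then 0 else Max ((\<lambda>i. d $ i) ` (- demand j))) \<le> real CARD('m)" for j
  proof (cases "- demand j = {}")
    case True
    \<comment> \<open>Receiver \<open>j\<close> wants everything: any of its own messages can take
      the part of \<open>i\<close>, with \<open>j' = j\<close>.\<close>
    hence "undefined \<in> demand j" by blast
    with DoF_outer[where demand = demand and i = undefined and j = j and j' = j, OF this _ d]
    show ?thesis using True by (simp add: insert_absorb)
  next
    case False
    hence "Max ((\<lambda>i. d $ i) ` (- demand j)) \<in> (\<lambda>i. d $ i) ` (- demand j)" by (intro Max_in) auto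
    then obtain i where i: "i \<notin> demand j" "Max ((\<lambda>i. d $ i) ` (- demand j)) = d $ i" by auto
    \<comment> \<open>The interferer of largest DoF must be decoded somewhere; a message wanted
      nowhere would have an unrestricted rate.\<close>
    obtain j' where j': "i \<in> demand j'" using assms(2) by blast
    hence "j' \<noteq> j" using i by blast
    from DoF_outer[where demand = demand and i = i and j = j and j' = j', OF j' this d] have "(\<Sum>k\<in>insert i (demand j). d $ k) \<le> real CARD('m)" .
    thus ?thesis using False i by (simp add: add.commute)
  qed
  moreover have "\<forall>k. 0 \<le> d $ k" using d by (simp add: DoF_region_def)
  ultimately show "d \<in> {d. (\<forall>k. 0 \<le> d $ k) \<and>
        (\<forall>j. (\<Sum>k\<in>demand j. d $ k)
              + (if - demand j = {} then 0 else Max ((\<lambda>i. d $ i) ` (- demand j)))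
              \<le> real CARD('m))}" by blast
next
  interpret interference_channel \<Omega> H Z \<mu> hmin hmax by (fact assms(1))
  fix d assume "d \<in> {d. (\<forall>k. 0 \<le> d $ k) \<and>
        (\<forall>j. (\<Sum>k\<in>demand j. d $ k)
              + (if - demand j = {} then 0 else Max ((\<lambda>i. d $ i) ` (- demand j)))
              \<le> real CARD('m))}"
  thus "d \<in> DoF_region \<Omega> H Z demand" by (intro DoF_inner) auto
qed

end
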